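(* Let $\mathbf{MS}_{\mathbb R^4_2}$ and $\mathbf{MS}_{\mathbb R^3_1}$ be the sets of equivalence classes, up to proper motions, of germs at $0$ of maximal space-like surfaces of general type in $\mathbb R^4_2$, respectively $\mathbb R^3_1$, parametrized by canonical coordinates (see context). Given a class in $\mathbf{MS}_{\mathbb R^4_2}$, choose a representative $\mathcal M$ having near $0$ a representation $$\Phi=\left(\frac12\frac{g_1g_2+1}{\sqrt{g_1'g_2'}},\ \frac{\mathrm i}{2}\frac{g_1g_2-1}{\sqrt{g_1'g_2'}},\ \frac12\frac{g_1+g_2}{\sqrt{g_1'g_2'}},\ \frac{\mathrm i}{2}\frac{g_1-g_2}{\sqrt{g_1'g_2'}}\right)$$ with $g_1,g_2$ holomorphic, $g_1'g_2'\neq0$, $(|g_1|^2-1)(|g_2|^2-1)>0$, and associate to it the classes of the two surfaces $\mathcal M_1,\mathcal M_2$ in $\mathbb R^3_1$ which are given near $0$ by $$\Phi_j=\left(\frac12\frac{g_j^2+1}{g_j'},\ \frac{\mathrm i}{2}\frac{g_j^2-1}{g_j'},\ \frac{g_j}{g_j'}\right),\qquad j=1,2.$$ This assignment is well defined on equivalence classes and gives a bijection $$\mathbf{MS}_{\mathbb R^4_2}\;\longrightarrow\;\mathbf{MS}_{\mathbb R^3_1}\times\mathbf{MS}_{\mathbb R^3_1}.$$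
   Context: $\mathbb R^4_2$ is $\mathbb R^4$ with $a\cdot b=a_1b_1+a_2b_2-a_3b_3-a_4b_4$; $\mathbb R^3_1$ is $\mathbb R^3$ with $a\cdot b=a_1b_1+a_2b_2-a_3b_3$, identified with the subspace $x_4=0$ of $\mathbb R^4_2$. The products are extended complex-bilinearly; $a^2=a\cdot a$. A surface $(\mathcal D,x)$ (immersion of $\mathcal D\subset\mathbb R^2\equiv\mathbb C$) is space-like if the induced metric is positive definite and maximal if its mean curvature vector vanishes. Coordinates $t=u+\mathrm i v$ are isothermal if $x_u^2=x_v^2$, $x_u\cdot x_v=0$; $\Phi=x_u-\mathrm i x_v$ is then holomorphic on a maximal surface, and it determines the surface up to translation. $\Phi'^{\bot}$ is the component of $\Phi'$ in the complexified normal space. The surface is of general type if $(\Phi'^{\bot})^2\neq0$ everywhere. In $\mathbb R^4_2$ isothermal coordinates are canonical if $(\Phi'^{\bot})^2=-1$. In $\mathbb R^3_1$ isothermal coordinates are canonical if the coefficients of the second fundamental form satisfy $L=-N=1$, $M=0$, where $x_{uu}^{\bot}=L\,n$, $x_{uv}^{\bot}=M\,n$, $x_{vv}^{\bot}=N\,n$ and $n$ is the unit normal ($n^2=-1$) for which $(x_u,x_v,n)$ is positively oriented. $\mathbf{MS}_{\mathbb R^4_2}$ (resp. $\mathbf{MS}_{\mathbb R^3_1}$): consider maximal space-like surfaces of general type $(\mathcal D,x)$ with $\mathcal D$ a neighborhood of $0\in\mathbb C$ in which the coordinates are canonical; $(\mathcal D,x)$ and $(\hat{\mathcal D},\hat x)$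 are equivalent if on some neighborhood of zero contained in $\mathcal D\cap\hat{\mathcal D}$ one has $\hat x=Ax+b$ with $A\in\mathbf{SO}(2,2,\mathbb R)$ (resp. $A\in\mathbf{SO}(2,1,\mathbb R)$), i.e. a linear isometry of determinant $1$, and $b$ a constant vector. *)

theory Defs
  imports "HOL-Analysis.Analysis"
begin

section \<open>Pseudo-Euclidean products\<close>

text \<open>The product on real or complex \<open>n\<close>-space with signs \<open>\<epsilon> $ i\<close>. At complex type it is the
  complex-bilinear (not Hermitian) extension of the product at real type.\<close>

definition pdot :: "real ^ 'n \<Rightarrow> 'a::real_field ^ 'n \<Rightarrow> 'a ^ 'n \<Rightarrow> 'a" where
  "pdot \<epsilon> a b = (\<Sum>i\<in>UNIV. of_real (\<epsilon> $ i) * a $ i * b $ i)"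

definition sign42 :: "real ^ 4" where
  "sign42 = vector [1, 1, -1, -1]"

definition sign31 :: "real ^ 3" where
  "sign31 = vector [1, 1, -1]"

definition special_isometries :: "real ^ 'n \<Rightarrow> (real ^ 'n ^ 'n) set" where
  "special_isometries \<epsilon> = {A. det A = 1 \<and> (\<forall>a b. pdot \<epsilon> (A *v a) (A *v b) = pdot \<epsilon> a b)}"

definition vec_of_real :: "real ^ 'n \<Rightarrow> 'a::real_field ^ 'n" where
  "vec_of_real a = (\<chi> i. of_real (a $ i))"


section \<open>Smooth maps of a plane domain\<close>

text \<open>The parameter plane is the type of complex numbers, with coordinate \<open>t = u + \<i> v\<close>.\<close>

definition du :: "(complex \<Rightarrow> 'b::real_normed_vector) \<Rightarrow> complex \<Rightarrow> 'b" where
  "du f t = frechet_derivative f (at t) 1"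

definition dv :: "(complex \<Rightarrow> 'b::real_normed_vector) \<Rightarrow> complex \<Rightarrow> 'b" where
  "dv f t = frechet_derivative f (at t) \<i>"

primrec Ck_on :: "nat \<Rightarrow> (complex \<Rightarrow> 'b::real_normed_vector) \<Rightarrow> complex set \<Rightarrow> bool" where
  "Ck_on 0 f D \<longleftrightarrow> continuous_on D f"
| "Ck_on (Suc k) f D \<longleftrightarrow>
     (\<forall>t\<in>D. f differentiable (at t)) \<and> Ck_on k (du f) D \<and> Ck_on k (dv f) D"

definition smooth_on :: "(complex \<Rightarrow> 'b::real_normed_vector) \<Rightarrow> complex set \<Rightarrow> bool" where
  "smooth_on f D \<longleftrightarrow> (\<forall>k. Ck_on k f D)"


section \<open>Space-like surfaces\<close>

text \<open>Everything below is relative to the signs \<open>\<epsilon>\<close> of the ambient product and a parametrization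
  \<open>x\<close>. Tangent and normal spaces at type \<open>real\<close> are the usual ones, at type \<open>complex\<close> they are
  their complexifications.\<close>

definition tangent_space :: "(complex \<Rightarrow> real ^ 'n) \<Rightarrow> complex \<Rightarrow> ('a::real_field ^ 'n) set" where
  "tangent_space x t = {\<alpha> *s vec_of_real (du x t) + \<beta> *s vec_of_real (dv x t) | \<alpha> \<beta>. True}"

definition normal_space ::
    "real ^ 'n \<Rightarrow> (complex \<Rightarrow> real ^ 'n) \<Rightarrow> complex \<Rightarrow> ('a::real_field ^ 'n) set" where
  "normal_space \<epsilon> x t = {w. \<forall>y \<in> tangent_space x t. pdot \<epsilon> w y = 0}"

definition normal_part ::
    "real ^ 'n \<Rightarrow> (complex \<Rightarrow> real ^ 'n) \<Rightarrow> complex \<Rightarrow> 'a::real_field ^ 'n \<Rightarrow> 'a ^ 'n" where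
  "normal_part \<epsilon> x t w = (THE m. m \<in> normal_space \<epsilon> x t \<and> w - m \<in> tangent_space x t)"

definition spacelike_surface :: "real ^ 'n \<Rightarrow> complex set \<Rightarrow> (complex \<Rightarrow> real ^ 'n) \<Rightarrow> bool" where
  "spacelike_surface \<epsilon> D x \<longleftrightarrow>
     open D \<and> smooth_on x D \<and>
     (\<forall>t\<in>D. inj (frechet_derivative x (at t))) \<and>
     (\<forall>t\<in>D. \<forall>h. h \<noteq> 0 \<longrightarrow>
        pdot \<epsilon> (frechet_derivative x (at t) h) (frechet_derivative x (at t) h) > 0)"

text \<open>Half the trace of the vector-valued second fundamental form with respect to the first
  fundamental form \<open>(E, F, G)\<close>, in arbitrary coordinates.\<close>

definition mean_curvature ::
    "real ^ 'n \<Rightarrow> (complex \<Rightarrow> real ^ 'n) \<Rightarrow> complex \<Rightarrow> real ^ 'n" where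
  "mean_curvature \<epsilon> x t =
     (let E = pdot \<epsilon> (du x t) (du x t);
          F = pdot \<epsilon> (du x t) (dv x t);
          G = pdot \<epsilon> (dv x t) (dv x t)
      in (1 / (2 * (E * G - F\<^sup>2))) *\<^sub>R
           (G *\<^sub>R normal_part \<epsilon> x t (du (du x) t)
            - (2 * F) *\<^sub>R normal_part \<epsilon> x t (dv (du x) t)
            + E *\<^sub>R normal_part \<epsilon> x t (dv (dv x) t)))"

definition maximal_surface :: "real ^ 'n \<Rightarrow> complex set \<Rightarrow> (complex \<Rightarrow> real ^ 'n) \<Rightarrow> bool" where
  "maximal_surface \<epsilon> D x \<longleftrightarrow> spacelike_surface \<epsilon> D x \<and> (\<forall>t\<in>D. mean_curvature \<epsilon> x t = 0)"

definition isothermal :: "real ^ 'n \<Rightarrow> complex set \<Rightarrow> (complex \<Rightarrow> real ^ 'n) \<Rightarrow> bool" where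
  "isothermal \<epsilon> D x \<longleftrightarrow>
     (\<forall>t\<in>D. pdot \<epsilon> (du x t) (du x t) = pdot \<epsilon> (dv x t) (dv x t) \<and>
            pdot \<epsilon> (du x t) (dv x t) = 0)"

definition Phi :: "(complex \<Rightarrow> real ^ 'n) \<Rightarrow> complex \<Rightarrow> complex ^ 'n" where
  "Phi x t = vec_of_real (du x t) - \<i> *s vec_of_real (dv x t)"

definition Phi_deriv :: "(complex \<Rightarrow> real ^ 'n) \<Rightarrow> complex \<Rightarrow> complex ^ 'n" where
  "Phi_deriv x t = (\<chi> i. deriv (\<lambda>w. Phi x w $ i) t)"

definition Phi_deriv_normal_sq ::
    "real ^ 'n \<Rightarrow> (complex \<Rightarrow> real ^ 'n) \<Rightarrow> complex \<Rightarrow> complex" where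
  "Phi_deriv_normal_sq \<epsilon> x t =
     pdot \<epsilon> (normal_part \<epsilon> x t (Phi_deriv x t)) (normal_part \<epsilon> x t (Phi_deriv x t))"

definition general_type :: "real ^ 'n \<Rightarrow> complex set \<Rightarrow> (complex \<Rightarrow> real ^ 'n) \<Rightarrow> bool" where
  "general_type \<epsilon> D x \<longleftrightarrow> (\<forall>t\<in>D. Phi_deriv_normal_sq \<epsilon> x t \<noteq> 0)"


section \<open>Canonical coordinates\<close>

definition canonical42 :: "complex set \<Rightarrow> (complex \<Rightarrow> real ^ 4) \<Rightarrow> bool" where
  "canonical42 D x \<longleftrightarrow> isothermal sign42 D x \<and> (\<forall>t\<in>D. Phi_deriv_normal_sq sign42 x t = -1)"

definition unit_normal :: "(complex \<Rightarrow> real ^ 3) \<Rightarrow> complex \<Rightarrow> real ^ 3" where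
  "unit_normal x t =
     (THE n. n \<in> normal_space sign31 x t \<and> pdot sign31 n n = -1 \<and>
             det (vector [du x t, dv x t, n] :: real ^ 3 ^ 3) > 0)"

definition second_form_coeffs ::
    "(complex \<Rightarrow> real ^ 3) \<Rightarrow> complex \<Rightarrow> real \<Rightarrow> real \<Rightarrow> real \<Rightarrow> bool" where
  "second_form_coeffs x t L M N \<longleftrightarrow>
     normal_part sign31 x t (du (du x) t) = L *\<^sub>R unit_normal x t \<and>
     normal_part sign31 x t (dv (du x) t) = M *\<^sub>R unit_normal x t \<and>
     normal_part sign31 x t (dv (dv x) t) = N *\<^sub>R unit_normal x t"

definition canonical31 :: "complex set \<Rightarrow> (complex \<Rightarrow> real ^ 3) \<Rightarrow> bool" where
  "canonical31 D x \<longleftrightarrow> isothermal sign31 D x \<and> (\<forall>t\<in>D. second_form_coeffs x t 1 0 (-1))"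


section \<open>Germs up to proper motions\<close>

text \<open>A surface is a pair \<open>(D, x)\<close>; the values of \<open>x\<close> outside \<open>D\<close> are immaterial, since the
  equivalence below only looks at a neighborhood of \<open>0\<close> inside the domains.\<close>

type_synonym 'n surface = "complex set \<times> (complex \<Rightarrow> real ^ 'n)"

definition surfaces42 :: "4 surface set" where
  "surfaces42 = {(D, x). 0 \<in> D \<and> maximal_surface sign42 D x \<and> general_type sign42 D x \<and>
                         canonical42 D x}"

definition surfaces31 :: "3 surface set" where
  "surfaces31 = {(D, x). 0 \<in> D \<and> maximal_surface sign31 D x \<and> general_type sign31 D x \<and>
                         canonical31 D x}"

definition germ_motion_equiv :: "real ^ 'n \<Rightarrow> 'n surface \<Rightarrow> 'n surface \<Rightarrow> bool" where
  "germ_motion_equiv \<epsilon> S S' \<longleftrightarrow>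
     (\<exists>U A b. open U \<and> 0 \<in> U \<and> U \<subseteq> fst S \<inter> fst S' \<and> A \<in> special_isometries \<epsilon> \<and>
              (\<forall>t\<in>U. snd S' t = A *v snd S t + b))"

definition rel42 :: "4 surface rel" where
  "rel42 = {(S, S'). S \<in> surfaces42 \<and> S' \<in> surfaces42 \<and> germ_motion_equiv sign42 S S'}"

definition rel31 :: "3 surface rel" where
  "rel31 = {(S, S'). S \<in> surfaces31 \<and> S' \<in> surfaces31 \<and> germ_motion_equiv sign31 S S'}"

definition MS42 :: "4 surface set set" where
  "MS42 = surfaces42 // rel42"

definition MS31 :: "3 surface set set" where
  "MS31 = surfaces31 // rel31"


section \<open>Representations by holomorphic functions\<close>

text \<open>The function \<open>r\<close> is a holomorphic branch of the square root of \<open>g\<^sub>1' g\<^sub>2'\<close>; both branches are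
  admitted.\<close>

definition represented42 ::
    "4 surface \<Rightarrow> (complex \<Rightarrow> complex) \<Rightarrow> (complex \<Rightarrow> complex) \<Rightarrow> bool" where
  "represented42 S g1 g2 \<longleftrightarrow>
     (\<exists>U r. open U \<and> 0 \<in> U \<and> U \<subseteq> fst S \<and>
        g1 holomorphic_on U \<and> g2 holomorphic_on U \<and> r holomorphic_on U \<and>
        (\<forall>t\<in>U. deriv g1 t * deriv g2 t \<noteq> 0 \<and>
               ((cmod (g1 t))\<^sup>2 - 1) * ((cmod (g2 t))\<^sup>2 - 1) > 0 \<and>
               (r t)\<^sup>2 = deriv g1 t * deriv g2 t \<and>
               Phi (snd S) t = vector
                 [1 / 2 * ((g1 t * g2 t + 1) / r t),
                  \<i> / 2 * ((g1 t * g2 t - 1) / r t),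
                  1 / 2 * ((g1 t + g2 t) / r t),
                  \<i> / 2 * ((g1 t - g2 t) / r t)]))"

definition represented31 :: "3 surface \<Rightarrow> (complex \<Rightarrow> complex) \<Rightarrow> bool" where
  "represented31 S g \<longleftrightarrow>
     (\<exists>U. open U \<and> 0 \<in> U \<and> U \<subseteq> fst S \<and>
        (\<forall>t\<in>U. Phi (snd S) t = vector
                 [1 / 2 * (((g t)\<^sup>2 + 1) / deriv g t),
                  \<i> / 2 * (((g t)\<^sup>2 - 1) / deriv g t),
                  g t / deriv g t]))"


section \<open>The relations are equivalences\<close>

lemma special_isometries_inverse:
  assumes "A \<in> special_isometries \<epsilon>"
  obtains B where "B \<in> special_isometries \<epsilon>" "B ** A = mat 1" "A ** B = mat 1"
proof -
  from assms have d: "det A = 1"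
    and i: "\<And>a b. pdot \<epsilon> (A *v a) (A *v b) = pdot \<epsilon> a b"
    by (auto simp: special_isometries_def)
  from d have "invertible A" by (simp add: invertible_det_nz)
  then obtain B where B: "A ** B = mat 1" "B ** A = mat 1" by (auto simp: invertible_def)
  have "det B = 1" using d det_mul[of A B] B by simp
  moreover have "pdot \<epsilon> (B *v a) (B *v b) = pdot \<epsilon> a b" for a b
    using i[of "B *v a" "B *v b"] B by (simp add: matrix_vector_mul_assoc)
  ultimately show ?thesis using that B by (auto simp: special_isometries_def)
qed

lemma germ_motion_equiv_refl:
  assumes "open D" "0 \<in> D"
  shows "germ_motion_equiv \<epsilon> (D, x) (D, x)"
  unfolding germ_motion_equiv_def
  by (rule exI[of _ D], rule exI[of _ "mat 1"], rule exI[of _ 0])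
     (use assms in \<open>auto simp: special_isometries_def\<close>)

lemma germ_motion_equiv_sym:
  assumes "germ_motion_equiv \<epsilon> S T"
  shows "germ_motion_equiv \<epsilon> T S"
proof -
  from assms obtain U A b where U: "open U" "0 \<in> U" "U \<subseteq> fst S \<inter> fst T"
    and A: "A \<in> special_isometries \<epsilon>" and e: "\<forall>t\<in>U. snd T t = A *v snd S t + b"
    unfolding germ_motion_equiv_def by blast
  obtain B where B: "B \<in> special_isometries \<epsilon>" "B ** A = mat 1"
    using special_isometries_inverse[OF A] by blast
  have "\<forall>t\<in>U. snd S t = B *v snd T t + - (B *v b)"
    using e B(2) by (simp add: matrix_vector_right_distrib matrix_vector_mul_assoc)
  with U B show ?thesis unfolding germ_motion_equiv_def by blast
qed

lemma germ_motion_equiv_trans: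
  assumes "germ_motion_equiv \<epsilon> S T" "germ_motion_equiv \<epsilon> T R"
  shows "germ_motion_equiv \<epsilon> S R"
proof -
  from assms(1) obtain U A b where U: "open U" "0 \<in> U" "U \<subseteq> fst S \<inter> fst T"
    and A: "A \<in> special_isometries \<epsilon>" and e: "\<forall>t\<in>U. snd T t = A *v snd S t + b"
    unfolding germ_motion_equiv_def by blast
  from assms(2) obtain V B c where V: "open V" "0 \<in> V" "V \<subseteq> fst T \<inter> fst R"
    and B: "B \<in> special_isometries \<epsilon>" and f: "\<forall>t\<in>V. snd R t = B *v snd T t + c"
    unfolding germ_motion_equiv_def by blast
  have "\<forall>t\<in>U \<inter> V. snd R t = (B ** A) *v snd S t + (B *v b + c)"
    using e f by (simp add: matrix_vector_right_distrib matrix_vector_mul_assoc)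
  moreover have "B ** A \<in> special_isometries \<epsilon>"
    using A B by (auto simp: special_isometries_def det_mul simp flip: matrix_vector_mul_assoc)
  moreover have "open (U \<inter> V)" "0 \<in> U \<inter> V" "U \<inter> V \<subseteq> fst S \<inter> fst R"
    using U V by auto
  ultimately show ?thesis unfolding germ_motion_equiv_def by blast
qed

lemma equiv_rel42: "equiv surfaces42 rel42"
proof (rule equivI)
  show "rel42 \<subseteq> surfaces42 \<times> surfaces42" by (auto simp: rel42_def)
  show "refl_on surfaces42 rel42"
    by (auto simp: refl_on_def rel42_def surfaces42_def maximal_surface_def spacelike_surface_def
        intro!: germ_motion_equiv_refl)
  show "sym rel42" by (auto simp: sym_def rel42_def intro: germ_motion_equiv_sym)
  show "trans rel42" by (auto simp: trans_def rel42_def intro: germ_motion_equiv_trans)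
qed

lemma equiv_rel31: "equiv surfaces31 rel31"
proof (rule equivI)
  show "rel31 \<subseteq> surfaces31 \<times> surfaces31" by (auto simp: rel31_def)
  show "refl_on surfaces31 rel31"
    by (auto simp: refl_on_def rel31_def surfaces31_def maximal_surface_def spacelike_surface_def
        intro!: germ_motion_equiv_refl)
  show "sym rel31" by (auto simp: sym_def rel31_def intro: germ_motion_equiv_sym)
  show "trans rel31" by (auto simp: trans_def rel31_def intro: germ_motion_equiv_trans)
qed

end

theory Submission
  imports Defs "HOL-Complex_Analysis.Cauchy_Integral_Formula"
begin

text \<open>For a null vector \<open>\<Phi>\<close> put \<open>f = \<Phi>\<^sub>1 + \<i>\<Phi>\<^sub>2\<close>, \<open>g\<^sub>1 = (\<Phi>\<^sub>3 - \<i>\<Phi>\<^sub>4) / f\<close> and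
  \<open>g\<^sub>2 = (\<Phi>\<^sub>3 + \<i>\<Phi>\<^sub>4) / f\<close>. On a maximal surface in isothermal coordinates
  \<open>(\<Phi>'\<^sup>\<bottom>)\<^sup>2 = \<Phi>'\<^sup>2 = - f\<^sup>2 g\<^sub>1' g\<^sub>2'\<close>, so canonical coordinates mean \<open>f\<^sup>2 g\<^sub>1' g\<^sub>2' = 1\<close>, and in
  \<open>\<real>\<^sup>3\<^sub>1\<close> the choice of the unit normal sharpens this to \<open>f g' = 1\<close>.

  Both equivalence relations are detected by the metrics \<open>E\<^sub>j = (|g\<^sub>j|\<^sup>2 - 1)\<^sup>2 / |g\<^sub>j'|\<^sup>2\<close>. A surface in
  \<open>\<real>\<^sup>4\<^sub>2\<close> has \<open>(4 x\<^sub>u\<^sup>2)\<^sup>2 = E\<^sub>1 E\<^sub>2\<close> and \<open>16 det (x\<^sub>u, x\<^sub>v, x\<^sub>u\<^sub>u, x\<^sub>u\<^sub>v) = E\<^sub>1 - E\<^sub>2\<close>, and both left-hand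
  sides are invariant under proper motions, so the two positive numbers \<open>E\<^sub>1\<close> and \<open>E\<^sub>2\<close> are invariant
  separately. Conversely, if \<open>g\<close> and \<open>h\<close> have the same metric then polarizing the equality shows
  that \<open>h\<close> is a Moebius transform of \<open>g\<close> preserving the unit circle, and such transforms of \<open>g\<^sub>1\<close>
  and \<open>g\<^sub>2\<close> are induced by proper motions as long as both preserve or both exchange the two sides of
  the circle. Surjectivity uses that every surface in \<open>\<real>\<^sup>3\<^sub>1\<close> can be moved so that \<open>|g| < 1\<close>.\<close>

section \<open>Vectors and determinants in dimensions three and four\<close>

text \<open>Orientation is what keeps the pair (g1, g2) ordered: the isometry \<open>flip4\<close>,
  of determinant -1, exchanges g1 and g2 and changes the sign of E1 - E2.

  A Moebius map with coefficients p, q carries the number d = |p|^2 - |q|^2, which is negative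
  exactly when the sides of the unit circle are exchanged. In R^3_1 it acts by congruence and
  multiplies the product by d^2, so dividing by d gives a motion for either sign. In R^4_2 the two
  maps act on the two sides of the matrix and multiply the product by d1 d2, which a real rescaling
  can undo only if d1 d2 > 0. This sign is the obstacle in dimension four, and the condition (|g1|^2
  - 1)(|g2|^2 - 1) > 0 on both surfaces removes it. The choice of the branch of sqrt(g1' g2') is
  harmless because -1 lies in SO(2,2).

  Well-definedness and injectivity are the two directions of a single equivalence,
  \<open>rel42_iff_rel31\<close>.\<close>

lemma vector_4 [simp]:
  "(vector [a, b, c, d] :: 'a::zero ^ 4) $ 1 = a"
  "(vector [a, b, c, d] :: 'a::zero ^ 4) $ 2 = b"
  "(vector [a, b, c, d] :: 'a::zero ^ 4) $ 3 = c"
  "(vector [a, b, c, d] :: 'a::zero ^ 4) $ 4 = d"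
  unfolding vector_def by simp_all

lemma det_4:
  "det (A :: 'a::comm_ring_1 ^ 4 ^ 4) =
     A$1$1 * (A$2$2 * (A$3$3 * A$4$4 - A$3$4 * A$4$3) - A$2$3 * (A$3$2 * A$4$4 - A$3$4 * A$4$2)
              + A$2$4 * (A$3$2 * A$4$3 - A$3$3 * A$4$2))
   - A$1$2 * (A$2$1 * (A$3$3 * A$4$4 - A$3$4 * A$4$3) - A$2$3 * (A$3$1 * A$4$4 - A$3$4 * A$4$1)
              + A$2$4 * (A$3$1 * A$4$3 - A$3$3 * A$4$1))
   + A$1$3 * (A$2$1 * (A$3$2 * A$4$4 - A$3$4 * A$4$2) - A$2$2 * (A$3$1 * A$4$4 - A$3$4 * A$4$1)
              + A$2$4 * (A$3$1 * A$4$2 - A$3$2 * A$4$1))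
   - A$1$4 * (A$2$1 * (A$3$2 * A$4$3 - A$3$3 * A$4$2) - A$2$2 * (A$3$1 * A$4$3 - A$3$3 * A$4$1)
              + A$2$3 * (A$3$1 * A$4$2 - A$3$2 * A$4$1))"
proof -
  have f1234: "finite {2::4, 3, 4}" "1 \<notin> {2::4, 3, 4}"
    and f234: "finite {3::4, 4}" "2 \<notin> {3::4, 4}"
    and f34: "finite {4::4}" "3 \<notin> {4::4}"
    by auto
  show ?thesis
    unfolding det_def UNIV_4
    unfolding sum_over_permutations_insert[OF f1234]
    unfolding sum_over_permutations_insert[OF f234]
    unfolding sum_over_permutations_insert[OF f34]
    unfolding permutes_sing
    by (simp add: algebra_simps sign_swap_id permutation_swap_id permutation_compose sign_compose
        sign_id swap_id_eq)
qed

lemma pdot_sign42: "pdot sign42 a b = a$1 * b$1 + a$2 * b$2 - a$3 * b$3 - a$4 * b$4"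
  by (simp add: pdot_def sign42_def sum_4)

lemma pdot_sign31: "pdot sign31 a b = a$1 * b$1 + a$2 * b$2 - a$3 * b$3"
  by (simp add: pdot_def sign31_def sum_3)

section \<open>Weierstrass vectors\<close>

text \<open>The complex-linear extension of a real matrix: this is how a motion of a surface acts on
  \<open>Phi\<close>.\<close>

definition cmv :: "real ^ 'n ^ 'm \<Rightarrow> complex ^ 'n \<Rightarrow> complex ^ 'm" where
  "cmv A w = (\<chi> i. \<Sum>j\<in>UNIV. of_real (A $ i $ j) * w $ j)"

text \<open>The factor f stays free because a Moebius change of g1 multiplies it by p + cnj q g1;
  the canonical value 1 / sqrt(g1' g2') is imposed only later.\<close>

definition weier42 :: "complex \<Rightarrow> complex \<Rightarrow> complex \<Rightarrow> complex ^ 4" where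
  "weier42 f g1 g2 = vector [f * (g1 * g2 + 1) / 2, \<i> * f * (g1 * g2 - 1) / 2,
                             f * (g1 + g2) / 2, \<i> * f * (g1 - g2) / 2]"

definition weier31 :: "complex \<Rightarrow> complex \<Rightarrow> complex ^ 3" where
  "weier31 f g = vector [f * (g\<^sup>2 + 1) / 2, \<i> * f * (g\<^sup>2 - 1) / 2, f * g]"

text \<open>Identify \<open>\<phi>\<close> with the matrix \<open>X\<close> with rows \<open>(\<phi>\<^sub>1 + \<i>\<phi>\<^sub>2, \<phi>\<^sub>3 - \<i>\<phi>\<^sub>4)\<close> and
  \<open>(\<phi>\<^sub>3 + \<i>\<phi>\<^sub>4, \<phi>\<^sub>1 - \<i>\<phi>\<^sub>2)\<close>; then \<open>\<phi>\<^sup>2 = det X\<close>, and \<open>weier42 f g\<^sub>1 g\<^sub>2\<close> is \<open>f\<close> times the column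
  \<open>(1, g\<^sub>2)\<close> times the row \<open>(1, g\<^sub>1)\<close>. With \<open>Q\<close> the matrix with rows \<open>(p, q)\<close> and \<open>(cnj q, cnj p)\<close>,
  \<open>right_mult p q\<close> is \<open>X \<mapsto> X Q\<close>, \<open>flip4\<close> is transposition, and \<open>congr_mult p q\<close> is
  \<open>X \<mapsto> Q\<^sup>T X Q\<close> on the symmetric matrices, i.e. on \<open>\<phi>\<^sub>4 = 0\<close>.\<close>

definition right_mult :: "complex \<Rightarrow> complex \<Rightarrow> real ^ 4 ^ 4" where
  "right_mult p q = vector
     [vector [Re p, - Im p, Re q, - Im q],
      vector [Im p, Re p, - Im q, - Re q],
      vector [Re q, - Im q, Re p, - Im p],
      vector [- Im q, - Re q, Im p, Re p]]"

definition flip4 :: "real ^ 4 ^ 4" where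
  "flip4 = vector
     [vector [1, 0, 0, 0], vector [0, 1, 0, 0], vector [0, 0, 1, 0], vector [0, 0, 0, -1]]"

definition congr_mult :: "complex \<Rightarrow> complex \<Rightarrow> real ^ 3 ^ 3" where
  "congr_mult p q = vector
     [vector [Re (p\<^sup>2 + (cnj q)\<^sup>2), - Im (p\<^sup>2 - (cnj q)\<^sup>2), 2 * Re (p * cnj q)],
      vector [Im (p\<^sup>2 + (cnj q)\<^sup>2), Re (p\<^sup>2 - (cnj q)\<^sup>2), 2 * Im (p * cnj q)],
      vector [2 * Re (p * q), - 2 * Im (p * q), (cmod p)\<^sup>2 + (cmod q)\<^sup>2]]"

text \<open>On 2 by 2 matrices, multiplication by Q on one side has determinant (det Q)^2 and
  multiplies det X by det Q; here det Q = |p|^2 - |q|^2.\<close>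

lemma det_right_mult: "det (right_mult p q) = ((cmod p)\<^sup>2 - (cmod q)\<^sup>2)\<^sup>2"
  unfolding right_mult_def det_4 cmod_power2 vector_4 by algebra

lemma pdot_right_mult:
  "pdot sign42 (right_mult p q *v a) (right_mult p q *v b) =
     ((cmod p)\<^sup>2 - (cmod q)\<^sup>2) * pdot sign42 a b"
  unfolding right_mult_def pdot_sign42 cmod_power2 matrix_vector_mult_def
  by (simp add: sum_4) algebra

text \<open>On symmetric matrices congruence by Q is the symmetric square of Q, of determinant (det
  Q)^3, and it multiplies det X by (det Q)^2.\<close>

lemma det_congr_mult: "det (congr_mult p q) = ((cmod p)\<^sup>2 - (cmod q)\<^sup>2) ^ 3"
  unfolding congr_mult_def det_3 cmod_power2 vector_3 by (simp add: power2_eq_square) algebra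

lemma pdot_congr_mult:
  "pdot sign31 (congr_mult p q *v a) (congr_mult p q *v b) =
     ((cmod p)\<^sup>2 - (cmod q)\<^sup>2)\<^sup>2 * pdot sign31 a b"
  unfolding congr_mult_def pdot_sign31 cmod_power2 matrix_vector_mult_def
  by (simp add: sum_3 power2_eq_square) algebra

lemma det_flip4: "det flip4 = -1"
  unfolding flip4_def det_4 by simp

lemma pdot_flip4: "pdot sign42 (flip4 *v a) (flip4 *v b) = pdot sign42 a b"
  unfolding flip4_def pdot_sign42 matrix_vector_mult_def by (simp add: sum_4)

lemma cmv_flip4: "cmv flip4 (weier42 f g1 g2) = weier42 f g2 g1"
  unfolding flip4_def cmv_def weier42_def
  by (simp add: vec_eq_iff forall_4 sum_4 algebra_simps)

lemma of_real_Re_eq: "complex_of_real (Re z) = (z + cnj z) / 2"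
  by (simp add: complex_eq_iff)

lemma of_real_Im_eq: "complex_of_real (Im z) = \<i> * (cnj z - z) / 2"
  by (simp add: complex_eq_iff)

lemma of_real_minus_Im_eq: "complex_of_real (- Im z) = \<i> * (z - cnj z) / 2"
  by (simp add: complex_eq_iff)

lemma of_real_cmod_power2: "(complex_of_real (cmod z))\<^sup>2 = z * cnj z"
  using complex_norm_square[of z] by simp

lemma of_real_cmod_power4: "(complex_of_real (cmod z)) ^ 4 = (z * cnj z)\<^sup>2"
  by (simp flip: of_real_cmod_power2 power_mult)

lemmas cnj_distribs = complex_cnj_mult complex_cnj_diff complex_cnj_add complex_cnj_power
  complex_cnj_divide complex_cnj_numeral complex_cnj_one complex_cnj_i complex_cnj_cnj

text \<open>Here (a, b) are homogeneous coordinates of g1 = b / a, which keeps the identity free of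
  the Moebius denominator.\<close>

lemma cmv_right_mult_aux:
  "cmv (right_mult p q)
     (vector [f * (b * c + a) / 2, \<i> * f * (b * c - a) / 2,
              f * (b + a * c) / 2, \<i> * f * (b - a * c) / 2]) =
   vector [f * ((a * q + cnj p * b) * c + (a * p + cnj q * b)) / 2,
           \<i> * f * ((a * q + cnj p * b) * c - (a * p + cnj q * b)) / 2,
           f * ((a * q + cnj p * b) + (a * p + cnj q * b) * c) / 2,
           \<i> * f * ((a * q + cnj p * b) - (a * p + cnj q * b) * c) / 2]"
  unfolding right_mult_def cmv_def
  by (simp add: vec_eq_iff forall_4 sum_4 of_real_Re_eq of_real_Im_eq, intro conjI)
     (simp_all add: field_simps)

lemma cmv_right_mult:
  assumes "p + cnj q * g1 \<noteq> 0"
  shows "cmv (right_mult p q) (weier42 f g1 g2) =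
     weier42 (f * (p + cnj q * g1)) ((q + cnj p * g1) / (p + cnj q * g1)) g2"
  using cmv_right_mult_aux[of p q f g1 g2 1] assms unfolding weier42_def
  by (simp add: vec_eq_iff forall_4) (simp add: field_simps)

lemma cmv_congr_mult_aux:
  "cmv (congr_mult p q) (weier31 f g) =
     vector [f * ((q + cnj p * g)\<^sup>2 + (p + cnj q * g)\<^sup>2) / 2,
             \<i> * f * ((q + cnj p * g)\<^sup>2 - (p + cnj q * g)\<^sup>2) / 2,
             f * ((q + cnj p * g) * (p + cnj q * g))]"
proof -
  \<comment> \<open>The algebra method does not treat division, so \<open>h\<close> stands for \<open>1 / 2\<close>.\<close>
  obtain h :: complex where h: "2 * h = 1" by (rule that[of "1/2"]) simp
  have half: "x / 2 = h * x" for x using h by (simp add: field_simps)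
  have i: "\<i> * \<i> = -1" by simp
  have 1: "complex_of_real (Re (p\<^sup>2 + (cnj q)\<^sup>2)) * (f * (g\<^sup>2 + 1) / 2)
      + complex_of_real (- Im (p\<^sup>2 - (cnj q)\<^sup>2)) * (\<i> * f * (g\<^sup>2 - 1) / 2)
      + complex_of_real (2 * Re (p * cnj q)) * (f * g)
     = f * ((q + cnj p * g)\<^sup>2 + (p + cnj q * g)\<^sup>2) / 2"
    unfolding of_real_minus of_real_power of_real_mult of_real_numeral of_real_Re_eq of_real_Im_eq
        cnj_distribs
    unfolding half using i h by algebra
  have 2: "complex_of_real (Im (p\<^sup>2 + (cnj q)\<^sup>2)) * (f * (g\<^sup>2 + 1) / 2)
      + complex_of_real (Re (p\<^sup>2 - (cnj q)\<^sup>2)) * (\<i> * f * (g\<^sup>2 - 1) / 2)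
      + complex_of_real (2 * Im (p * cnj q)) * (f * g)
     = \<i> * f * ((q + cnj p * g)\<^sup>2 - (p + cnj q * g)\<^sup>2) / 2"
    unfolding of_real_minus of_real_power of_real_mult of_real_numeral of_real_Re_eq of_real_Im_eq
        cnj_distribs
    unfolding half using i h by algebra
  have 3: "complex_of_real (2 * Re (p * q)) * (f * (g\<^sup>2 + 1) / 2)
      + complex_of_real (- 2 * Im (p * q)) * (\<i> * f * (g\<^sup>2 - 1) / 2)
      + complex_of_real ((cmod p)\<^sup>2 + (cmod q)\<^sup>2) * (f * g)
     = f * ((q + cnj p * g) * (p + cnj q * g))"
    unfolding of_real_minus of_real_power of_real_mult of_real_add of_real_cmod_power2
        of_real_numeral of_real_Re_eq of_real_Im_eq cnj_distribs
    unfolding half using i h by algebra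
  show ?thesis
    unfolding congr_mult_def cmv_def weier31_def vec_eq_iff forall_3 sum_3 vec_lambda_beta vector_3
    using 1 2 3 by blast
qed

lemma cmv_congr_mult:
  assumes "p + cnj q * g \<noteq> 0"
  shows "cmv (congr_mult p q) (weier31 f g) =
     weier31 (f * (p + cnj q * g)\<^sup>2) ((q + cnj p * g) / (p + cnj q * g))"
proof -
  have "f * P\<^sup>2 * ((Q / P)\<^sup>2 + 1) / 2 = f * (Q\<^sup>2 + P\<^sup>2) / 2"
    "\<i> * (f * P\<^sup>2) * ((Q / P)\<^sup>2 - 1) / 2 = \<i> * f * (Q\<^sup>2 - P\<^sup>2) / 2"
    "f * P\<^sup>2 * (Q / P) = f * (Q * P)" if "P \<noteq> 0" for P Q
    using that by (simp_all add: field_simps power2_eq_square)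
  from this[OF assms] show ?thesis
    unfolding cmv_congr_mult_aux by (simp only: weier31_def)
qed

section \<open>Squares, metrics and frame determinants of Weierstrass vectors\<close>

lemma pdot_weier42:
  "pdot sign42 (weier42 f g1 g2) (weier42 f g1 g2) = 0"
  unfolding pdot_sign42 weier42_def by (simp add: field_simps power2_eq_square)

text \<open>The arguments f', a1, a2 are independent numbers standing for the derivatives of f, g1,
  g2, so that the identities below are purely algebraic.\<close>

definition weier42_deriv :: "complex \<Rightarrow> complex \<Rightarrow> complex \<Rightarrow> complex \<Rightarrow> complex \<Rightarrow> complex \<Rightarrow> complex ^
    4" where
  "weier42_deriv f g1 g2 f' a1 a2 =
     vector [(f' * (g1 * g2 + 1) + f * (a1 * g2 + g1 * a2)) / 2,
       \<i> * (f' * (g1 * g2 - 1) + f * (a1 * g2 + g1 * a2)) / 2,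
       (f' * (g1 + g2) + f * (a1 + a2)) / 2, \<i> * (f' * (g1 - g2) + f * (a1 - a2)) / 2]"

definition weier31_deriv :: "complex \<Rightarrow> complex \<Rightarrow> complex \<Rightarrow> complex \<Rightarrow> complex ^ 3" where
  "weier31_deriv f g f' a =
     vector [(f' * (g\<^sup>2 + 1) + 2 * f * g * a) / 2, \<i> * (f' * (g\<^sup>2 - 1) + 2 * f * g * a) / 2,
       f' * g + f * a]"

lemma pdot_weier31: "pdot sign31 (weier31 f g) (weier31 f g) = 0"
  unfolding pdot_sign31 weier31_def by (simp add: field_simps power2_eq_square)

text \<open>In the matrix picture the derivative is L Y R with L and R unipotent and Y with rows
  (f', f a1) and (f a2, 0); its determinant does not contain f'.\<close>

lemma pdot_weier42_deriv:
  "pdot sign42 (weier42_deriv f g1 g2 f' a1 a2) (weier42_deriv f g1 g2 f' a1 a2) = - (f\<^sup>2 * (a1 * a2))"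
  unfolding pdot_sign42 weier42_deriv_def by (simp add: field_simps power2_eq_square)

lemma pdot_weier31_deriv:
  "pdot sign31 (weier31_deriv f g f' a) (weier31_deriv f g f' a) = - (f * a)\<^sup>2"
  unfolding pdot_sign31 weier31_deriv_def by (simp add: field_simps power2_eq_square)

text \<open>For nonzero f, the part of w containing f' is a complex multiple of the Weierstrass
  vector, so its real and imaginary parts lie in the span of the first two rows. If |f|^4 |a1|^2
  |a2|^2 = 1, the right-hand side is E1 - E2.\<close>

lemma det_frame_weier42:
  fixes f g1 g2 f' a1 a2 :: complex
  defines "w \<equiv> weier42_deriv f g1 g2 f' a1 a2"
  shows "16 * det (vector [\<chi> i. Re (weier42 f g1 g2 $ i), \<chi> i. - Im (weier42 f g1 g2 $ i),
            \<chi> i. Re (w $ i), \<chi> i. - Im (w $ i)] :: real ^ 4 ^ 4) =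
     (cmod f) ^ 4 * ((cmod a2)\<^sup>2 * ((cmod g1)\<^sup>2 - 1)\<^sup>2 - (cmod a1)\<^sup>2 * ((cmod g2)\<^sup>2 - 1)\<^sup>2)"
    (is "?l = ?r")
proof -
  obtain h :: complex where h: "2 * h = 1" by (rule that[of "1/2"]) simp
  have half: "x / 2 = h * x" for x using h by (simp add: field_simps)
  have i: "\<i> * \<i> = -1" by simp
  \<comment> \<open>The real identity is verified among complex numbers, where real parts, imaginary
    parts and moduli become polynomials in z and \<open>cnj z\<close>.\<close>
  have "complex_of_real ?l = complex_of_real ?r"
    unfolding w_def det_4 weier42_deriv_def weier42_def vec_lambda_beta vector_4 of_real_mult
        of_real_diff of_real_add
      of_real_numeral of_real_Re_eq of_real_minus_Im_eq of_real_1 of_real_power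
          of_real_cmod_power2 of_real_cmod_power4 cnj_distribs
    unfolding half using i h by algebra
  then show ?thesis using of_real_eq_iff by blast
qed

text \<open>By linearity in the last row, the left-hand side is four times the complex determinant
  of (x_u, x_v, w) with w = x_uu - i x_uv. Packing two real determinants into one number turns the
  conditions on L and M into the single equation f g' = 1.\<close>

lemma det_frame_weier31:
  fixes f g f' a :: complex
  defines "w \<equiv> weier31_deriv f g f' a"
  shows "4 * (complex_of_real (det (vector [\<chi> i. Re (weier31 f g $ i), \<chi> i. - Im (weier31 f g $ i),
            \<chi> i. Re (w $ i)] :: real ^ 3 ^ 3)) - \<i> *
          complex_of_real (det (vector [\<chi> i. Re (weier31 f g $ i), \<chi> i. - Im (weier31 f g $ i),
            \<chi> i. - Im (w $ i)] :: real ^ 3 ^ 3))) =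
     complex_of_real ((cmod f)\<^sup>2 * ((cmod g)\<^sup>2 - 1)\<^sup>2) * (f * a)"
    (is "?l = ?r")
proof -
  obtain h :: complex where h: "2 * h = 1" by (rule that[of "1/2"]) simp
  have half: "x / 2 = h * x" for x using h by (simp add: field_simps)
  have i: "\<i> * \<i> = -1" by simp
  show "?l = ?r"
    unfolding w_def det_3 weier31_deriv_def weier31_def vec_lambda_beta vector_3 of_real_mult
        of_real_diff of_real_add
      of_real_numeral of_real_Re_eq of_real_minus_Im_eq of_real_1 of_real_power
          of_real_cmod_power2 cnj_distribs
    unfolding half using i h by algebra
qed

text \<open>For a null vector the square of the real part is half the product of the vector with its
  conjugate, and that product factors.\<close>

lemma energy_weier42:
  "8 * pdot sign42 (\<chi> i. Re (weier42 f g1 g2 $ i)) (\<chi> i. Re (weier42 f g1 g2 $ i)) =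
     2 * (cmod f)\<^sup>2 * (((cmod g1)\<^sup>2 - 1) * ((cmod g2)\<^sup>2 - 1))" (is "?l = ?r")
proof -
  obtain h :: complex where h: "2 * h = 1" by (rule that[of "1/2"]) simp
  have half: "x / 2 = h * x" for x using h by (simp add: field_simps)
  have i: "\<i> * \<i> = -1" by simp
  have "complex_of_real ?l = complex_of_real ?r"
    unfolding pdot_sign42 weier42_def vec_lambda_beta vector_4 of_real_mult of_real_diff of_real_add
      of_real_numeral of_real_Re_eq of_real_minus_Im_eq of_real_1 of_real_power
          of_real_cmod_power2 cnj_distribs
    unfolding half using i h by algebra
  then show ?thesis using of_real_eq_iff by blast
qed

lemma energy_weier31:
  "4 * pdot sign31 (\<chi> i. Re (weier31 f g $ i)) (\<chi> i. Re (weier31 f g $ i)) =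
     (cmod f)\<^sup>2 * ((cmod g)\<^sup>2 - 1)\<^sup>2" (is "?l = ?r")
proof -
  obtain h :: complex where h: "2 * h = 1" by (rule that[of "1/2"]) simp
  have half: "x / 2 = h * x" for x using h by (simp add: field_simps)
  have i: "\<i> * \<i> = -1" by simp
  have "complex_of_real ?l = complex_of_real ?r"
    unfolding pdot_sign31 weier31_def vec_lambda_beta vector_3 of_real_mult of_real_diff of_real_add
      of_real_numeral of_real_Re_eq of_real_minus_Im_eq of_real_1 of_real_power
          of_real_cmod_power2 cnj_distribs
    unfolding half using i h by algebra
  then show ?thesis using of_real_eq_iff by blast
qed

lemma open_nonzero_set:
  fixes f :: "'a::topological_space \<Rightarrow> 'b::{t1_space, zero}"
  assumes "open U" "continuous_on U f"
  shows "open {z \<in> U. f z \<noteq> 0}"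
proof -
  have "{z \<in> U. f z \<noteq> 0} = U \<inter> f -` (- {0})" by auto
  then show ?thesis using continuous_open_preimage[OF assms(2,1), of "- {0}"] by auto
qed

section \<open>Polarization and Moebius maps\<close>

text \<open>The real directional derivatives of the vanishing sum along \<open>1\<close> and \<open>\<i>\<close> separate its
  holomorphic from its antiholomorphic derivative.\<close>

lemma dbar_sum:
  fixes u v :: "'i \<Rightarrow> complex \<Rightarrow> complex"
  assumes "open U" "\<And>k. k \<in> K \<Longrightarrow> u k holomorphic_on U" "\<And>k. k \<in> K \<Longrightarrow> v k holomorphic_on U"
    and zero: "\<And>z. z \<in> U \<Longrightarrow> (\<Sum>k\<in>K. u k z * cnj (v k z)) = 0"
    and z: "z \<in> U"
  shows "(\<Sum>k\<in>K. u k z * cnj (deriv (v k) z)) = 0"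
proof -
  have du: "(u k has_derivative (*) (deriv (u k) z)) (at z)" if "k \<in> K" for k
    using holomorphic_derivI[OF assms(2)[OF that] assms(1) z] by (simp add: has_field_derivative_def)
  have dv: "((\<lambda>z. cnj (v k z)) has_derivative (\<lambda>h. cnj (deriv (v k) z * h))) (at z)" if "k \<in> K" for k
    using holomorphic_derivI[OF assms(3)[OF that] assms(1) z]
    by (intro has_derivative_cnj) (simp add: has_field_derivative_def)
  have D: "((\<lambda>z. \<Sum>k\<in>K. u k z * cnj (v k z)) has_derivative
      (\<lambda>h. \<Sum>k\<in>K. u k z * cnj (deriv (v k) z * h) + deriv (u k) z * h * cnj (v k z))) (at z)"
    by (intro has_derivative_sum has_derivative_mult du dv)
  have "((\<lambda>z. \<Sum>k\<in>K. u k z * cnj (v k z)) has_derivative (\<lambda>h. 0)) (at z)"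
    by (rule has_derivative_transform_within_open[OF has_derivative_const[of 0] assms(1) z])
       (simp add: zero)
  from has_derivative_unique[OF D this]
  have e: "(\<Sum>k\<in>K. u k z * cnj (deriv (v k) z * h) + deriv (u k) z * h * cnj (v k z)) = 0" for h
    by meson
  let ?a = "\<Sum>k\<in>K. u k z * cnj (deriv (v k) z)" and ?b = "\<Sum>k\<in>K. deriv (u k) z * cnj (v k z)"
  have "?a + ?b = 0" using e[of 1] by (simp add: sum.distrib)
  moreover have "\<i> * (?b - ?a) = 0"
    using e[of \<i>]
    by (simp add: sum.distrib sum_subtractf sum_distrib_left mult_ac sum_negf right_diff_distrib)
  then have "?b = ?a" by simp
  ultimately show ?thesis by simp
qed

text \<open>Iterating \<open>dbar_sum\<close> gives the identity with every derivative of v_k at the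
  same point z. For fixed z the conjugated sum is holomorphic in w and vanishes to infinite order at
  w = z, hence on the connected set U.\<close>

lemma polarization:
  fixes u v :: "'i \<Rightarrow> complex \<Rightarrow> complex"
  assumes "open U" "connected U"
    and "\<And>k. k \<in> K \<Longrightarrow> u k holomorphic_on U" "\<And>k. k \<in> K \<Longrightarrow> v k holomorphic_on U"
    and zero: "\<And>z. z \<in> U \<Longrightarrow> (\<Sum>k\<in>K. u k z * cnj (v k z)) = 0"
    and z: "z \<in> U" "w \<in> U"
  shows "(\<Sum>k\<in>K. u k z * cnj (v k w)) = 0"
proof -
  have n: "(\<Sum>k\<in>K. u k z * cnj ((deriv ^^ n) (v k) z)) = 0" if "z \<in> U" for n z
    using that
  proof (induction n arbitrary: z)
    case (Suc n)
    have "(\<Sum>k\<in>K. u k z * cnj (deriv ((deriv ^^ n) (v k)) z)) = 0"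
      by (rule dbar_sum[of U]) (use assms Suc in \<open>auto intro!: holomorphic_higher_deriv\<close>)
    then show ?case by simp
  qed (use zero in simp)
  let ?G = "\<lambda>w. \<Sum>k\<in>K. cnj (u k z) * v k w"
  have G: "w \<in> U \<Longrightarrow> (deriv ^^ n) ?G w = (\<Sum>k\<in>K. cnj (u k z) * (deriv ^^ n) (v k) w)" for n w
  proof (induction n arbitrary: w)
    case (Suc n)
    have "(deriv ^^ Suc n) ?G w = deriv (\<lambda>w. \<Sum>k\<in>K. cnj (u k z) * (deriv ^^ n) (v k) w) w"
      using Suc.IH Suc.prems assms(1)
      by (auto intro!: deriv_cong_ev eventually_nhds_in_open[THEN eventually_mono])
    also have "\<dots> = (\<Sum>k\<in>K. cnj (u k z) * (deriv ^^ Suc n) (v k) w)"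
      using Suc.prems assms
      by (intro DERIV_imp_deriv DERIV_sum DERIV_cmult)
         (auto intro!: holomorphic_derivI holomorphic_higher_deriv)
    finally show ?case .
  qed simp
  have "?G w = 0"
  proof (rule holomorphic_fun_eq_0_on_connected[OF _ assms(1,2) _ z])
    show "?G holomorphic_on U" by (intro holomorphic_intros assms)
    show "(deriv ^^ n) ?G z = 0" for n
      using arg_cong[OF n[OF z(1), of n], of cnj] by (simp add: G[OF z(1)])
  qed
  from arg_cong[OF this, of cnj] show ?thesis by simp
qed

text \<open>Such maps preserve the unit circle, since |p + cnj q g|^2 - |q + cnj p g|^2 = (|p|^2 -
  |q|^2)(1 - |g|^2).\<close>

lemma DERIV_moebius:
  assumes g: "(g has_field_derivative g') (at z)" and nz: "p + cnj q * g z \<noteq> 0"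
  shows "((\<lambda>z. (q + cnj p * g z) / (p + cnj q * g z)) has_field_derivative
           (p * cnj p - q * cnj q) * g' / (p + cnj q * g z)\<^sup>2) (at z)"
proof -
  have "((\<lambda>z. (q + cnj p * g z) / (p + cnj q * g z)) has_field_derivative
           ((cnj p * g') * (p + cnj q * g z) - (q + cnj p * g z) * (cnj q * g')) /
           ((p + cnj q * g z) * (p + cnj q * g z))) (at z)"
    using nz by (intro DERIV_divide) (auto intro!: derivative_eq_intros g)
  also have "(cnj p * g') * (p + cnj q * g z) - (q + cnj p * g z) * (cnj q * g') =
      (p * cnj p - q * cnj q) * g'"
    by (simp add: algebra_simps)
  finally show ?thesis by (simp add: power2_eq_square)
qed

lemma deriv_moebius:
  assumes "open V" "g holomorphic_on V" "z \<in> V"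
    and "\<And>z. z \<in> V \<Longrightarrow> p + cnj q * g z \<noteq> 0"
    and "\<And>z. z \<in> V \<Longrightarrow> h z = (q + cnj p * g z) / (p + cnj q * g z)"
  shows "deriv h z = of_real ((cmod p)\<^sup>2 - (cmod q)\<^sup>2) * deriv g z / (p + cnj q * g z)\<^sup>2"
  unfolding of_real_diff complex_norm_square
  using assms
  by (intro DERIV_imp_deriv has_field_derivative_transform_within_open[OF DERIV_moebius])
     (auto intro: holomorphic_derivI)

text \<open>Polarizing and fixing the second point at 0 leaves an equation between holomorphic
  functions: the normalized maps \<open>M\<close> and \<open>N\<close>, both zero at 0, have
  proportional derivatives. The sign of |p|^2 - |q|^2 records whether g 0 and h 0 lie on the same
  side of the unit circle.\<close>

lemma moebius_of_equal_metric:
  assumes U: "open U" "0 \<in> U" and hol: "g holomorphic_on U" "h holomorphic_on U"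
    and nz: "deriv g 0 \<noteq> 0" "deriv h 0 \<noteq> 0" and ne: "cmod (g 0) \<noteq> 1" "cmod (h 0) \<noteq> 1"
    and eq: "\<And>z. z \<in> U \<Longrightarrow> (cmod (deriv g z))\<^sup>2 * ((cmod (h z))\<^sup>2 - 1)\<^sup>2 =
               (cmod (deriv h z))\<^sup>2 * ((cmod (g z))\<^sup>2 - 1)\<^sup>2"
  obtains p q V where "open V" "0 \<in> V" "V \<subseteq> U"
    "(cmod p)\<^sup>2 - (cmod q)\<^sup>2 = ((cmod (g 0))\<^sup>2 - 1) * ((cmod (h 0))\<^sup>2 - 1)"
    "\<And>z. z \<in> V \<Longrightarrow> p + cnj q * g z \<noteq> 0"
    "\<And>z. z \<in> V \<Longrightarrow> h z = (q + cnj p * g z) / (p + cnj q * g z)"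
proof -
  define b c where "b = g 0" and "c = h 0"
  define B C where "B = 1 - b * cnj b" and "C = 1 - c * cnj c"
  have Br: "B = of_real (1 - (cmod b)\<^sup>2)" and Cr: "C = of_real (1 - (cmod c)\<^sup>2)"
    by (simp_all add: B_def C_def complex_norm_square[symmetric])
  have sq1: "x\<^sup>2 = 1 \<Longrightarrow> x \<ge> 0 \<Longrightarrow> x = 1" for x :: real
    by (simp add: power2_eq_1_iff)
  have B0: "B \<noteq> 0" and C0: "C \<noteq> 0"
    using ne sq1[of "cmod b"] sq1[of "cmod c"] unfolding Br Cr of_real_eq_0_iff b_def c_def by auto
  have "open {z \<in> U. 1 - cnj b * g z \<noteq> 0 \<and> 1 - cnj c * h z \<noteq> 0}"
  proof -
    have "open {z \<in> U. 1 - cnj b * g z \<noteq> 0}"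
      by (intro open_nonzero_set U continuous_intros holomorphic_on_imp_continuous_on hol)
    moreover have "open {z \<in> U. 1 - cnj c * h z \<noteq> 0}"
      by (intro open_nonzero_set U continuous_intros holomorphic_on_imp_continuous_on hol)
    ultimately have "open ({z \<in> U. 1 - cnj b * g z \<noteq> 0} \<inter> {z \<in> U. 1 - cnj c * h z \<noteq> 0})"
      by (rule open_Int)
    also have "\<dots> = {z \<in> U. 1 - cnj b * g z \<noteq> 0 \<and> 1 - cnj c * h z \<noteq> 0}" by auto
    finally show ?thesis .
  qed
  moreover have "0 \<in> {z \<in> U. 1 - cnj b * g z \<noteq> 0 \<and> 1 - cnj c * h z \<noteq> 0}"
    using U B0 C0 by (simp add: B_def C_def b_def c_def mult.commute)
  ultimately obtain e where e: "e > 0" "ball 0 e \<subseteq> {z \<in> U. 1 - cnj b * g z \<noteq> 0 \<and> 1 - cnj c * h z \<noteq> 0}"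
    by (rule openE)
  let ?V = "ball (0::complex) e"
  have V: "open ?V" "connected ?V" "0 \<in> ?V" "?V \<subseteq> U" using e by auto
  have gb: "1 - cnj b * g z \<noteq> 0" and hc: "1 - cnj c * h z \<noteq> 0" if "z \<in> ?V" for z using e(2) that by auto
  have hV: "g holomorphic_on ?V" "h holomorphic_on ?V" using hol V(4) holomorphic_on_subset by blast+
  have hV': "deriv g holomorphic_on ?V" "deriv h holomorphic_on ?V" using hV
    by (auto intro: holomorphic_deriv)
  have eqc: "deriv g z * cnj (deriv g z) * (h z * cnj (h z) - 1)\<^sup>2
      = deriv h z * cnj (deriv h z) * (g z * cnj (g z) - 1)\<^sup>2"
    if "z \<in> U" for z
  proof -
    have "complex_of_real ((cmod (deriv g z))\<^sup>2 * ((cmod (h z))\<^sup>2 - 1)\<^sup>2) =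
               complex_of_real ((cmod (deriv h z))\<^sup>2 * ((cmod (g z))\<^sup>2 - 1)\<^sup>2)"
      using eq[OF that] by simp
    then show ?thesis by (simp add: complex_norm_square[symmetric])
  qed
  \<comment> \<open>The six terms of the expanded identity \<open>eqc\<close>.\<close>
  define u where "u k =
    [\<lambda>z. deriv g z, \<lambda>z. - 2 * deriv g z * h z, \<lambda>z. deriv g z * (h z)\<^sup>2,
     \<lambda>z. - deriv h z, \<lambda>z. 2 * deriv h z * g z, \<lambda>z. - deriv h z * (g z)\<^sup>2] ! k" for k :: nat
  define v where "v k =
    [\<lambda>z. deriv g z, \<lambda>z. deriv g z * h z, \<lambda>z. deriv g z * (h z)\<^sup>2,
     \<lambda>z. deriv h z, \<lambda>z. deriv h z * g z, \<lambda>z. deriv h z * (g z)\<^sup>2] ! k" for k :: nat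
  have sum6: "sum f {..<6} = f 0 + f 1 + f 2 + f 3 + f 4 + (f 5 :: complex)" for f :: "nat \<Rightarrow> complex"
    by (simp add: eval_nat_numeral)
  have uv: "(\<Sum>k<6. u k z * cnj (v k w)) =
      deriv g z * cnj (deriv g w) * (h z * cnj (h w) - 1)\<^sup>2 - deriv h z * cnj (deriv h w) * (g z *
          cnj (g w) - 1)\<^sup>2" for z w
    unfolding sum6 u_def v_def by (simp add: algebra_simps power2_eq_square)
  have pol: "deriv g z * cnj (deriv g 0) * (h z * cnj c - 1)\<^sup>2
      = deriv h z * cnj (deriv h 0) * (g z * cnj b - 1)\<^sup>2"
    if "z \<in> ?V" for z
  proof -
    have "(\<Sum>k<6. u k z * cnj (v k 0)) = 0"
    proof (rule polarization[OF V(1,2) _ _ _ that V(3)])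
      fix k :: nat assume "k \<in> {..<6}"
      then have "k = 0 \<or> k = 1 \<or> k = 2 \<or> k = 3 \<or> k = 4 \<or> k = 5" by auto
      then show "u k holomorphic_on ?V" "v k holomorphic_on ?V"
        using hV hV' by (auto simp: u_def v_def intro!: holomorphic_intros)
    next
      show "(\<Sum>k<6. u k z * cnj (v k z)) = 0" if "z \<in> ?V" for z
        using eqc[of z] that V(4) unfolding uv by auto
    qed
    then show ?thesis unfolding uv b_def c_def by simp
  qed
  \<comment> \<open>The constant with N' = l M', read off from \<open>pol\<close>; the equality of
    the metrics at 0 makes it unimodular.\<close>
  define l where "l = C * cnj (deriv g 0) / (B * cnj (deriv h 0))"
  have "cmod l = 1"
  proof -
    have "(cmod l)\<^sup>2 = (cmod (deriv g 0))\<^sup>2 * ((cmod (h 0))\<^sup>2 - 1)\<^sup>2 / ((cmod (deriv h 0))\<^sup>2 * ((cmod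
        (g 0))\<^sup>2 - 1)\<^sup>2)"
      by (simp add: l_def norm_mult norm_divide power_mult_distrib power_divide Br Cr b_def c_def
          power2_commute flip: of_real_power of_real_diff del: of_real_diff of_real_1)
         (simp add: norm_of_real power2_commute mult_ac)
    also have "\<dots> = 1"
    proof -
      have "(cmod (g 0))\<^sup>2 - 1 \<noteq> 0" using ne sq1[of "cmod (g 0)"] by auto
      then have "(cmod (deriv h 0))\<^sup>2 * ((cmod (g 0))\<^sup>2 - 1)\<^sup>2 \<noteq> 0" using nz by simp
      then show ?thesis unfolding eq[OF U(2)] by (rule divide_self)
    qed
    finally show ?thesis using sq1 by simp
  qed
  \<comment> \<open>Circle-preserving maps taking g 0 and h 0 to 0; their derivatives contain
    exactly the squared factors of \<open>pol\<close>.\<close>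
  define M N where "M z = (g z - b) / (1 - cnj b * g z)" and "N z = (h z - c) / (1 - cnj c * h z)" for z
  have dM: "(M has_field_derivative B * deriv g z / (1 - cnj b * g z)\<^sup>2) (at z)"
    and dN: "(N has_field_derivative C * deriv h z / (1 - cnj c * h z)\<^sup>2) (at z)" if "z \<in> ?V" for z
  proof -
    have 1: "(1 * cnj 1 - - b * cnj (- b) :: complex) = B"
        "(1 * cnj 1 - - c * cnj (- c) :: complex) = C"
      by (simp_all add: B_def C_def)
    have 2: "1 + cnj (- b) * x = 1 - cnj b * x" "- b + cnj 1 * x = x - b"
       "1 + cnj (- c) * x = 1 - cnj c * x" "- c + cnj 1 * x = x - c" for x
      by simp_all
    show "(M has_field_derivative B * deriv g z / (1 - cnj b * g z)\<^sup>2) (at z)"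
      using DERIV_moebius[OF holomorphic_derivI[OF hV(1) V(1) that], of 1
          "- b", unfolded 1 2, OF gb[OF that]]
      unfolding M_def[abs_def] .
    show "(N has_field_derivative C * deriv h z / (1 - cnj c * h z)\<^sup>2) (at z)"
      using DERIV_moebius[OF holomorphic_derivI[OF hV(2) V(1) that], of 1
          "- c", unfolded 1 2, OF hc[OF that]]
      unfolding N_def[abs_def] .
  qed
  have abs_eq: "C * X = C * (a / (B * d)) * (B * Y)" if "X = Y * (a / d)" "B \<noteq> 0" for X Y a d
    using that by simp
  have NM: "N z = l * M z" if "z \<in> ?V" for z
  proof -
    have "((\<lambda>z. N z - l * M z) has_field_derivative 0) (at w)" if "w \<in> ?V" for w
    proof -
      have "deriv h w * (1 - cnj b * g w)\<^sup>2 * cnj (deriv h 0)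
          = deriv g w * cnj (deriv g 0) * (1 - cnj c * h w)\<^sup>2"
        using pol[OF that] by (simp add: power2_commute mult_ac)
      then have "deriv h w / (1 - cnj c * h w)\<^sup>2 * cnj (deriv h 0)
          = deriv g w / (1 - cnj b * g w)\<^sup>2 * cnj (deriv g 0)"
        using gb[OF that] hc[OF that] by (simp add: divide_simps mult_ac)
      then have "deriv h w / (1 - cnj c * h w)\<^sup>2
          = deriv g w / (1 - cnj b * g w)\<^sup>2 * (cnj (deriv g 0) / cnj (deriv h 0))"
        using nz by (metis complex_cnj_zero_iff nonzero_eq_divide_eq times_divide_eq_right)
      then have "C * deriv h w / (1 - cnj c * h w)\<^sup>2 = l * (B * deriv g w / (1 - cnj b * g w)\<^sup>2)"
        using abs_eq B0 unfolding l_def times_divide_eq_right[symmetric] by blast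
      then show ?thesis using DERIV_diff[OF dN[OF that] DERIV_cmult[OF dM[OF that], of l]] by simp
    qed
    then have "\<exists>k. \<forall>z\<in>?V. N z - l * M z = k"
      by (intro has_field_derivative_zero_constant) (auto intro: has_field_derivative_at_within)
    then obtain k where k: "\<And>z. z \<in> ?V \<Longrightarrow> N z - l * M z = k" by blast
    have "M 0 = 0" "N 0 = 0" by (simp_all add: M_def N_def b_def c_def)
    then have "k = 0" using k[OF V(3)] by simp
    then show ?thesis using k[OF that] by simp
  qed
  \<comment> \<open>Solving N = l M for h and expanding the fraction by \<open>cnj k\<close> splits
    l evenly, which gives the four coefficients the conjugate form p, q, \<open>cnj q\<close>,
    \<open>cnj p\<close>.\<close>
  define k where "k = csqrt l"
  have k1: "k * k = l" unfolding k_def using power2_csqrt[of l] by (simp only: power2_eq_square)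
  have "(cmod k)\<^sup>2 = 1"
    using arg_cong[OF k1, of cmod] \<open>cmod l = 1\<close> by (simp only: norm_mult power2_eq_square)
  then have k2: "k * cnj k = 1" using complex_norm_square[of k] by simp
  note k = k1 k2
  define p q where "p = cnj k - b * cnj c * k" and "q = c * cnj k - b * k"
  have res: "p + cnj q * g z \<noteq> 0 \<and> h z = (q + cnj p * g z) / (p + cnj q * g z)" if "z \<in> ?V" for z
  proof -
    have n1: "(h z - c) * (1 - cnj b * g z) = l * (g z - b) * (1 - cnj c * h z)"
      using NM[OF that] gb[OF that] hc[OF that] unfolding M_def N_def by (simp add: divide_simps)
    have "cnj k * (k * k) = (k * cnj k) * k" by (simp only: mult_ac)
    then have kl: "cnj k * l = k" unfolding k by simp
    have "cnj k * ((1 - cnj b * g z) + cnj c * l * (g z - b)) =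
        cnj k * (1 - cnj b * g z) + cnj c * (cnj k * l) * (g z - b)"
      by (simp add: algebra_simps)
    also have "\<dots> = p + cnj q * g z"
      unfolding kl p_def q_def by (simp add: algebra_simps)
    finally have pq: "p + cnj q * g z = cnj k * ((1 - cnj b * g z) + cnj c * l * (g z - b))" ..
    have "cnj k * (c * (1 - cnj b * g z) + l * (g z - b)) =
        cnj k * c * (1 - cnj b * g z) + (cnj k * l) * (g z - b)"
      by (simp add: algebra_simps)
    also have "\<dots> = q + cnj p * g z"
      unfolding kl p_def q_def by (simp add: algebra_simps)
    finally have qp: "q + cnj p * g z = cnj k * (c * (1 - cnj b * g z) + l * (g z - b))" ..
    \<comment> \<open>The denominator cannot vanish: its product with 1 - cnj c h is C times a
      nonzero factor.\<close>
    have "((1 - cnj b * g z) + cnj c * l * (g z - b)) * (1 - cnj c * h z) =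
        (1 - cnj b * g z) * (1 - cnj c * h z) + cnj c * (l * (g z - b) * (1 - cnj c * h z))"
      by (simp add: algebra_simps)
    also have "\<dots> = C * (1 - cnj b * g z)"
      unfolding n1[symmetric] C_def by (simp add: algebra_simps)
    finally have "(1 - cnj b * g z) + cnj c * l * (g z - b) \<noteq> 0"
      using C0 gb[OF that] by auto
    then have nz: "p + cnj q * g z \<noteq> 0" using pq k(2) by auto
    have "h z * ((1 - cnj b * g z) + cnj c * l * (g z - b)) = c * (1 - cnj b * g z) + l * (g z - b)"
      using n1 by (simp add: algebra_simps)
    then have "h z * (p + cnj q * g z) = q + cnj p * g z"
      unfolding pq qp mult.left_commute[of "h z" "cnj k"] by (rule arg_cong)
    with nz show ?thesis by (simp add: field_simps)
  qed
  have "p * cnj p - q * cnj q = (k * cnj k) * ((b * cnj b - 1) * (c * cnj c - 1))"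
    unfolding p_def q_def by (simp add: algebra_simps)
  then have "complex_of_real ((cmod p)\<^sup>2 - (cmod q)\<^sup>2)
      = complex_of_real (((cmod (g 0))\<^sup>2 - 1) * ((cmod (h 0))\<^sup>2 - 1))"
    unfolding of_real_diff of_real_mult complex_norm_square of_real_1 b_def[symmetric] c_def[symmetric]
    using k by simp
  then have "(cmod p)\<^sup>2 - (cmod q)\<^sup>2 = ((cmod (g 0))\<^sup>2 - 1) * ((cmod (h 0))\<^sup>2 - 1)"
    by (simp only: of_real_eq_iff)
  then show ?thesis using that[of ?V p q] V(1,3,4) res by blast
qed

section \<open>Smooth maps of the plane\<close>

lemma has_derivative_vec:
  fixes f :: "'a::real_normed_vector \<Rightarrow> real ^ 'n"
  shows "(f has_derivative f') (at t within S) \<longleftrightarrow>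
     (\<forall>i. ((\<lambda>z. f z $ i) has_derivative (\<lambda>h. f' h $ i)) (at t within S))"
  by (subst has_derivative_componentwise_within) (auto simp: Basis_vec_def inner_axis)

lemma du_dv_eqI:
  assumes "(f has_derivative f') (at t)"
  shows "du f t = f' 1" "dv f t = f' \<i>"
  using frechet_derivative_at[OF assms] by (simp_all add: du_def dv_def)

lemma has_derivative_du_dv:
  assumes "f differentiable (at t)"
  shows "(f has_derivative (\<lambda>h. Re h *\<^sub>R du f t + Im h *\<^sub>R dv f t)) (at t)"
proof -
  let ?f = "frechet_derivative f (at t)"
  have f: "(f has_derivative ?f) (at t)" using assms by (simp add: frechet_derivative_works)
  have "?f h = Re h *\<^sub>R du f t + Im h *\<^sub>R dv f t" for h
  proof -
    have "h = Re h *\<^sub>R 1 + Im h *\<^sub>R \<i>" by (simp add: complex_eq_iff)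
    then have "?f h = ?f (Re h *\<^sub>R 1 + Im h *\<^sub>R \<i>)" by simp
    also have "\<dots> = Re h *\<^sub>R ?f 1 + Im h *\<^sub>R ?f \<i>"
      using has_derivative_linear[OF f] by (simp add: linear_add linear_scale)
    finally show ?thesis by (simp add: du_def dv_def)
  qed
  then have "?f = (\<lambda>h. Re h *\<^sub>R du f t + Im h *\<^sub>R dv f t)" by auto
  with f show ?thesis by simp
qed

lemma frechet_derivative_cong_open:
  assumes "open D" "\<And>z. z \<in> D \<Longrightarrow> f z = g z" "t \<in> D"
  shows "frechet_derivative f (at t) = frechet_derivative g (at t)"
proof -
  have "(f has_derivative h) (at t) \<longleftrightarrow> (g has_derivative h) (at t)" for h
    using has_derivative_transform_within_open[OF _ assms(1,3), of f h UNIV g]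
      has_derivative_transform_within_open[OF _ assms(1,3), of g h UNIV f] assms(2) by auto
  then show ?thesis by (simp add: frechet_derivative_def)
qed

lemma du_dv_cong_open:
  assumes "open D" "\<And>z. z \<in> D \<Longrightarrow> f z = g z" "t \<in> D"
  shows "du f t = du g t" "dv f t = dv g t"
  using frechet_derivative_cong_open[OF assms] by (simp_all add: du_def dv_def)

lemma Ck_on_cong:
  assumes "open D" "\<And>z. z \<in> D \<Longrightarrow> f z = g z"
  shows "Ck_on k f D \<Longrightarrow> Ck_on k g D"
  using assms(2)
proof (induction k arbitrary: f g)
  case 0
  then show ?case by (simp cong: continuous_on_cong)
next
  case (Suc k)
  have "g differentiable (at t)" if "t \<in> D" for t
    using Suc.prems that has_derivative_transform_within_open[OF _ assms(1) that]
    by (auto simp: differentiable_def) blast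
  moreover have "Ck_on k (du g) D" "Ck_on k (dv g) D"
    using Suc.IH[of "du f" "du g"] Suc.IH[of "dv f" "dv g"] Suc.prems
      du_dv_cong_open[OF assms(1), of f g] by auto
  ultimately show ?case by simp
qed

text \<open>The mean value theorem is applied along p to the difference in direction q, then along q
  to the derivative in direction p. The left-hand side is symmetric in p and q, which makes the two
  orders of differentiation comparable.\<close>

lemma second_difference:
  fixes \<phi> :: "complex \<Rightarrow> real"
  assumes h: "h > 0" "norm p = 1" "norm q = 1"
    and 1: "\<And>z. dist t z \<le> 2 * h \<Longrightarrow> (\<phi> has_derivative \<phi>' z) (at z)"
    and 2: "\<And>z. dist t z \<le> 2 * h \<Longrightarrow> ((\<lambda>z. \<phi>' z p) has_derivative \<psi> z) (at z)"
  obtains z where "dist t z \<le> 2 * h"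
    "\<phi> (t + h *\<^sub>R p + h *\<^sub>R q) - \<phi> (t + h *\<^sub>R p) - \<phi> (t + h *\<^sub>R q) + \<phi> t = h * h * \<psi> z q"
proof -
  have d: "dist t (t + a *\<^sub>R p + b *\<^sub>R q) \<le> 2 * h" if "0 \<le> a" "a \<le> h" "0 \<le> b" "b \<le> h" for a b
  proof -
    have "dist t (t + a *\<^sub>R p + b *\<^sub>R q) = norm (a *\<^sub>R p + b *\<^sub>R q)"
      by (metis add.assoc add_diff_cancel_left' dist_commute dist_norm)
    also have "\<dots> \<le> norm (a *\<^sub>R p) + norm (b *\<^sub>R q)" by (rule norm_triangle_ineq)
    also have "\<dots> \<le> 2 * h" using that h by simp
    finally show ?thesis .
  qed
  have A: "((\<lambda>s. \<phi> (t + s *\<^sub>R p + b *\<^sub>R q)) has_derivative (\<lambda>k. k * \<phi>' (t + s *\<^sub>R p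
      + b *\<^sub>R q) p)) (at s within {0..h})"
    if "0 \<le> s" "s \<le> h" "0 \<le> b" "b \<le> h" for s b
  proof -
    have D: "(\<phi> has_derivative \<phi>' (t + s *\<^sub>R p + b *\<^sub>R q)) (at (t + s *\<^sub>R p + b *\<^sub>R q))"
      by (rule 1[OF d[OF that]])
    have "((\<lambda>s. \<phi> (t + s *\<^sub>R p + b *\<^sub>R q)) has_derivative (\<lambda>k. \<phi>' (t + s *\<^sub>R p
        + b *\<^sub>R q) (k *\<^sub>R p))) (at s within {0..h})"
      by (rule has_derivative_compose[where f = "\<lambda>s. t + s *\<^sub>R p
          + b *\<^sub>R q", OF _ D]) (auto intro!: derivative_eq_intros)
    then show ?thesis using has_derivative_linear[OF D] by (simp add: linear_scale)
  qed
  have "\<exists>s\<in>{0<..<h}. (\<phi> (t + h *\<^sub>R p + h *\<^sub>R q) - \<phi> (t + h *\<^sub>R p + 0 *\<^sub>R q)) - (\<phi> (t + 0 *\<^sub>R p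
      + h *\<^sub>R q) - \<phi> (t + 0 *\<^sub>R p + 0 *\<^sub>R q))
     = (h - 0) * \<phi>' (t + s *\<^sub>R p + h *\<^sub>R q) p - (h - 0) * \<phi>' (t + s *\<^sub>R p + 0 *\<^sub>R q) p"
    by (rule mvt_simple[OF h(1)]) (intro has_derivative_diff A; use h in simp)
  then obtain s where s: "0 < s" "s < h" and e1: "\<phi> (t + h *\<^sub>R p + h *\<^sub>R q) - \<phi> (t + h *\<^sub>R p) - \<phi> (t
      + h *\<^sub>R q) + \<phi> t =
     h * (\<phi>' (t + s *\<^sub>R p + h *\<^sub>R q) p - \<phi>' (t + s *\<^sub>R p + 0 *\<^sub>R q) p)"
    by (auto simp: algebra_simps)
  have B: "((\<lambda>r. \<phi>' (t + s *\<^sub>R p + r *\<^sub>R q) p) has_derivative (\<lambda>k. k * \<psi> (t + s *\<^sub>R p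
      + r *\<^sub>R q) q)) (at r within {0..h})"
    if "0 \<le> r" "r \<le> h" for r
  proof -
    have D: "((\<lambda>z. \<phi>' z p) has_derivative \<psi> (t + s *\<^sub>R p + r *\<^sub>R q)) (at (t + s *\<^sub>R p + r *\<^sub>R q))"
      by (rule 2[OF d]) (use s that in auto)
    have "((\<lambda>r. \<phi>' (t + s *\<^sub>R p + r *\<^sub>R q) p) has_derivative (\<lambda>k. \<psi> (t + s *\<^sub>R p
        + r *\<^sub>R q) (k *\<^sub>R q))) (at r within {0..h})"
      by (rule has_derivative_compose[where f = "\<lambda>r. t + s *\<^sub>R p
          + r *\<^sub>R q", OF _ D]) (auto intro!: derivative_eq_intros)
    then show ?thesis using has_derivative_linear[OF D] by (simp add: linear_scale)
  qed
  have "\<exists>r\<in>{0<..<h}. \<phi>' (t + s *\<^sub>R p + h *\<^sub>R q) p - \<phi>' (t + s *\<^sub>R p + 0 *\<^sub>R q) p = (h - 0) * \<psi> (t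
      + s *\<^sub>R p + r *\<^sub>R q) q"
    by (rule mvt_simple[OF h(1)]) (rule B; simp)
  then obtain r where "0 < r" "r < h" and e2: "\<phi>' (t + s *\<^sub>R p + h *\<^sub>R q) p - \<phi>' (t + s *\<^sub>R p
      + 0 *\<^sub>R q) p = h * \<psi> (t + s *\<^sub>R p + r *\<^sub>R q) q"
    by auto
  then show ?thesis using that[of "t + s *\<^sub>R p + r *\<^sub>R q"] d[of s r] s e1 by simp
qed

text \<open>One second difference expresses both iterated partials at points near t, and their
  continuity carries the equality to t.\<close>

lemma mixed_partials_commute:
  fixes f :: "complex \<Rightarrow> real ^ 'n"
  assumes D: "open D" "t \<in> D" and C: "Ck_on 2 f D"
  shows "dv (du f) t = du (dv f) t"
proof (rule ccontr)
  assume ne: "dv (du f) t \<noteq> du (dv f) t"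
  then obtain i where i: "dv (du f) t $ i \<noteq> du (dv f) t $ i" by (auto simp: vec_eq_iff)
  have C': "\<And>z. z \<in> D \<Longrightarrow> f differentiable (at z)" "\<And>z. z \<in> D \<Longrightarrow> du f differentiable (at z)"
    "\<And>z. z \<in> D \<Longrightarrow> dv f differentiable (at z)" "continuous_on D (dv (du f))" "continuous_on D (du (dv f))"
    using C by (simp_all add: numeral_2_eq_2)
  \<comment> \<open>Half the supposed gap: moving each partial by less than this cannot close
    it.\<close>
  define \<epsilon> where "\<epsilon> = \<bar>dv (du f) t $ i - du (dv f) t $ i\<bar> / 2"
  have \<epsilon>: "\<epsilon> > 0" using i by (simp add: \<epsilon>_def)
  have ci: "continuous_on D (\<lambda>z. dv (du f) z $ i)" "continuous_on D (\<lambda>z. du (dv f) z $ i)"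
    using C'(4,5) by (auto intro!: continuous_intros)
  obtain d0 where d0: "d0 > 0" "ball t d0 \<subseteq> D" using D openE by blast
  obtain d1 where d1: "d1 > 0" "\<And>z. z \<in> D \<Longrightarrow> dist z t < d1
      \<Longrightarrow> dist (dv (du f) z $ i) (dv (du f) t $ i) < \<epsilon>"
    using ci(1) D(2) \<epsilon> unfolding continuous_on_iff by blast
  obtain d2 where d2: "d2 > 0" "\<And>z. z \<in> D \<Longrightarrow> dist z t < d2
      \<Longrightarrow> dist (du (dv f) z $ i) (du (dv f) t $ i) < \<epsilon>"
    using ci(2) D(2) \<epsilon> unfolding continuous_on_iff by blast
  define h where "h = min d0 (min d1 d2) / 3"
  have h: "h > 0" "2 * h < d0" "2 * h < d1" "2 * h < d2" using d0 d1 d2 by (auto simp: h_def)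
  have inD: "z \<in> D" if "dist t z \<le> 2 * h" for z using that h d0 by auto
  have der: "((\<lambda>z. F z $ i) has_derivative (\<lambda>k. Re k * du F z $ i + Im k * dv F z $ i)) (at z)"
    if "F differentiable (at z)" for F :: "complex \<Rightarrow> real ^ 'n" and z
    using has_derivative_du_dv[OF that] by (simp add: has_derivative_vec)
  obtain z where z: "dist t z \<le> 2 * h"
    and e1: "f (t + h *\<^sub>R 1 + h *\<^sub>R \<i>) $ i - f (t + h *\<^sub>R 1) $ i - f (t + h *\<^sub>R \<i>) $ i + f t $ i
        = h * h * dv (du f) z $ i"
    by (rule second_difference[OF h(1), of 1 \<i> t "\<lambda>z. f z $ i" "\<lambda>z k. Re k * du f z $ i
        + Im k * dv f z $ i"
          "\<lambda>z k. Re k * du (du f) z $ i + Im k * dv (du f) z $ i"])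
       (auto intro!: der C' inD)
  obtain w where w: "dist t w \<le> 2 * h"
    and e2: "f (t + h *\<^sub>R \<i> + h *\<^sub>R 1) $ i - f (t + h *\<^sub>R \<i>) $ i - f (t + h *\<^sub>R 1) $ i + f t $ i
        = h * h * du (dv f) w $ i"
    by (rule second_difference[OF h(1), of \<i> 1 t "\<lambda>z. f z $ i" "\<lambda>z k. Re k * du f z $ i
        + Im k * dv f z $ i"
          "\<lambda>z k. Re k * du (dv f) z $ i + Im k * dv (dv f) z $ i"])
       (auto intro!: der C' inD)
  have "t + h *\<^sub>R \<i> + h *\<^sub>R 1 = t + h *\<^sub>R 1 + h *\<^sub>R \<i>" by simp
  then have "h * h * dv (du f) z $ i = h * h * du (dv f) w $ i" using e1 e2 by (simp only:)
  then have "dv (du f) z $ i = du (dv f) w $ i" using h(1) by simp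
  moreover have "dist (dv (du f) z $ i) (dv (du f) t $ i) < \<epsilon>"
      "dist (du (dv f) w $ i) (du (dv f) t $ i) < \<epsilon>"
    using d1(2)[OF inD[OF z]] d2(2)[OF inD[OF w]] z w h by (auto simp: dist_commute)
  ultimately have "\<bar>dv (du f) t $ i - du (dv f) t $ i\<bar> < 2 * \<epsilon>" unfolding dist_real_def by linarith
  then show False by (simp add: \<epsilon>_def)
qed

lemma real_part_derivatives:
  fixes F :: "'n::finite \<Rightarrow> complex \<Rightarrow> complex"
  assumes "open D" "\<And>i. F i holomorphic_on D" "t \<in> D"
  shows "((\<lambda>z. \<chi> i. Re (F i z)) has_derivative (\<lambda>h. \<chi> i. Re (deriv (F i) t * h))) (at t)"
    "du (\<lambda>z. \<chi> i. Re (F i z)) t = (\<chi> i. Re (deriv (F i) t))"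
    "dv (\<lambda>z. \<chi> i. Re (F i z)) t = (\<chi> i. Re (\<i> * deriv (F i) t))"
proof -
  show *: "((\<lambda>z. \<chi> i. Re (F i z)) has_derivative (\<lambda>h. \<chi> i. Re (deriv (F i) t * h))) (at t)"
    unfolding has_derivative_vec vec_lambda_beta
    using holomorphic_derivI[OF assms(2,1,3)]
    by (intro allI has_derivative_Re) (simp add: has_field_derivative_def)
  show "du (\<lambda>z. \<chi> i. Re (F i z)) t = (\<chi> i. Re (deriv (F i) t))"
    "dv (\<lambda>z. \<chi> i. Re (F i z)) t = (\<chi> i. Re (\<i> * deriv (F i) t))"
    by (simp_all add: du_dv_eqI[OF *])
qed

text \<open>Real parts of holomorphic maps are closed under both partials, which replace F by F' and
  by i F'; this drives the induction.\<close>

lemma Ck_on_real_part: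
  fixes F :: "'n::finite \<Rightarrow> complex \<Rightarrow> complex"
  assumes "open D" "\<And>i. F i holomorphic_on D"
  shows "Ck_on k (\<lambda>z. \<chi> i. Re (F i z)) D"
  using assms(2)
proof (induction k arbitrary: F)
  case 0
  then show ?case
    by (auto intro!: continuous_intros continuous_on_vec_lambda holomorphic_on_imp_continuous_on)
next
  case (Suc k)
  have d: "(\<lambda>z. \<chi> i. Re (F i z)) differentiable (at t)" if "t \<in> D" for t
    using real_part_derivatives(1)[of D F, OF assms(1) Suc.prems that]
      unfolding differentiable_def by blast
  have "Ck_on k (\<lambda>z. \<chi> i. Re (deriv (F i) z)) D"
    by (rule Suc.IH) (intro holomorphic_deriv Suc.prems assms)
  then have 1: "Ck_on k (du (\<lambda>z. \<chi> i. Re (F i z))) D"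
    by (rule Ck_on_cong[OF assms(1), rotated]) (simp add: real_part_derivatives(2)[of D F, OF
        assms(1) Suc.prems])
  have "Ck_on k (\<lambda>z. \<chi> i. Re (\<i> * deriv (F i) z)) D"
    by (rule Suc.IH) (intro holomorphic_intros holomorphic_deriv Suc.prems assms)
  then have 2: "Ck_on k (dv (\<lambda>z. \<chi> i. Re (F i z))) D"
    by (rule Ck_on_cong[OF assms(1), rotated]) (simp add: real_part_derivatives(3)[of D F, OF
        assms(1) Suc.prems])
  show ?case using d 1 2 by simp
qed

section \<open>Isothermal maximal surfaces\<close>

lemma pdot_commute: "pdot \<epsilon> a b = pdot \<epsilon> b a"
  by (simp add: pdot_def mult_ac)

lemma pdot_left:
  "pdot \<epsilon> (a + b) c = pdot \<epsilon> a c + pdot \<epsilon> b c"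
  "pdot \<epsilon> (a - b) c = pdot \<epsilon> a c - pdot \<epsilon> b c"
  "pdot \<epsilon> (k *s a) c = k * pdot \<epsilon> a c"
  by (simp_all add: pdot_def algebra_simps sum.distrib sum_subtractf sum_distrib_left)

lemma pdot_right:
  "pdot \<epsilon> c (a + b) = pdot \<epsilon> c a + pdot \<epsilon> c b"
  "pdot \<epsilon> c (a - b) = pdot \<epsilon> c a - pdot \<epsilon> c b"
  "pdot \<epsilon> c (k *s a) = k * pdot \<epsilon> c a"
  using pdot_left pdot_commute by metis+

lemma pdot_zero: "pdot \<epsilon> 0 a = 0" "pdot \<epsilon> a 0 = 0"
  by (simp_all add: pdot_def)

lemma pdot_vec_of_real: "pdot \<epsilon> (vec_of_real a) (vec_of_real b) = of_real (pdot \<epsilon> a b)"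
  by (simp add: pdot_def vec_of_real_def)

lemma pdot_Re_Im:
  "pdot \<epsilon> w w = complex_of_real (pdot \<epsilon> (\<chi> i. Re (w $ i)) (\<chi> i. Re (w $ i)) -
       pdot \<epsilon> (\<chi> i. - Im (w $ i)) (\<chi> i. - Im (w $ i))) -
     \<i> * of_real (2 * pdot \<epsilon> (\<chi> i. Re (w $ i)) (\<chi> i. - Im (w $ i)))"
  by (simp add: complex_eq_iff pdot_def sum_subtractf sum_negf sum_distrib_left algebra_simps)

lemma has_derivative_pdot:
  fixes f g :: "complex \<Rightarrow> real ^ 'n"
  assumes "(f has_derivative f') (at t)" "(g has_derivative g') (at t)"
  shows "((\<lambda>z. pdot \<epsilon> (f z) (g z)) has_derivative
           (\<lambda>h. pdot \<epsilon> (f' h) (g t) + pdot \<epsilon> (f t) (g' h))) (at t)"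
proof -
  have f: "((\<lambda>z. f z $ i) has_derivative (\<lambda>h. f' h $ i)) (at t)"
    and g: "((\<lambda>z. g z $ i) has_derivative (\<lambda>h. g' h $ i)) (at t)" for i
    using assms by (auto simp: has_derivative_vec)
  show ?thesis
    unfolding pdot_def
    by (rule has_derivative_eq_rhs, (rule derivative_intros f g)+)
       (auto simp: fun_eq_iff sum.distrib[symmetric] algebra_simps)
qed

lemma smooth_on_differentiable:
  assumes "smooth_on x D" "t \<in> D"
  shows "x differentiable (at t)" "du x differentiable (at t)" "dv x differentiable (at t)"
proof -
  have "Ck_on 2 x D" using assms(1) by (simp add: smooth_on_def)
  then show "x differentiable (at t)" "du x differentiable (at t)" "dv x differentiable (at t)"
    using assms(2) by (simp_all add: numeral_2_eq_2)
qed

lemma spacelike_pos: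
  assumes "spacelike_surface \<epsilon> D x" "t \<in> D"
  shows "pdot \<epsilon> (du x t) (du x t) > 0"
  using assms by (simp add: spacelike_surface_def du_def)

lemma normal_space_iff:
  fixes m :: "'a::real_field ^ 'n"
  shows "m \<in> normal_space \<epsilon> x t \<longleftrightarrow>
     pdot \<epsilon> m (vec_of_real (du x t)) = 0 \<and> pdot \<epsilon> m (vec_of_real (dv x t)) = 0"
proof
  let ?A = "vec_of_real (du x t) :: 'a ^ 'n" and ?B = "vec_of_real (dv x t) :: 'a ^ 'n"
  assume m: "m \<in> normal_space \<epsilon> x t"
  have "?A = 1 *s ?A + 0 *s ?B" "?B = 0 *s ?A + 1 *s ?B" by simp_all
  then have "?A \<in> tangent_space x t" "?B \<in> tangent_space x t"
    unfolding tangent_space_def by blast+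
  with m show "pdot \<epsilon> m ?A = 0 \<and> pdot \<epsilon> m ?B = 0"
    by (simp add: normal_space_def)
qed (auto simp: normal_space_def tangent_space_def pdot_right)

text \<open>Orthogonality of x_u and x_v with equal nonzero squares makes the projection explicit
  and settles the definite description. The scalar type is left open to serve both x_uu and the
  complex vector Phi'.\<close>

lemma normal_part_formula:
  fixes w :: "'a::real_field ^ 'n"
  assumes E: "pdot \<epsilon> (du x t) (du x t) = E" "pdot \<epsilon> (dv x t) (dv x t) = E"
    "pdot \<epsilon> (du x t) (dv x t) = 0" "E \<noteq> 0"
  shows "normal_part \<epsilon> x t w =
     w - (pdot \<epsilon> w (vec_of_real (du x t)) / of_real E) *s vec_of_real (du x t)
       - (pdot \<epsilon> w (vec_of_real (dv x t)) / of_real E) *s vec_of_real (dv x t)" (is "_ = ?m")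
proof -
  let ?A = "vec_of_real (du x t) :: 'a ^ 'n" and ?B = "vec_of_real (dv x t) :: 'a ^ 'n"
  have g: "pdot \<epsilon> ?A ?A = of_real E" "pdot \<epsilon> ?B ?B = of_real E" "pdot \<epsilon> ?A ?B = 0" "pdot \<epsilon> ?B ?A = 0"
    using E pdot_commute[of \<epsilon> ?A ?B] by (simp_all add: pdot_vec_of_real)
  note normal = normal_space_iff[of _ \<epsilon> x t]
  show ?thesis unfolding normal_part_def
  proof (rule the_equality)
    have "w - ?m = (pdot \<epsilon> w ?A / of_real E) *s ?A + (pdot \<epsilon> w ?B / of_real E) *s ?B" by simp
    then have "w - ?m \<in> tangent_space x t" unfolding tangent_space_def by blast
    moreover have "?m \<in> normal_space \<epsilon> x t"
      unfolding normal using E(4) g by (simp add: pdot_left)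
    ultimately show "?m \<in> normal_space \<epsilon> x t \<and> w - ?m \<in> tangent_space x t" by blast
  next
    fix m assume m: "m \<in> normal_space \<epsilon> x t \<and> w - m \<in> tangent_space x t"
    then obtain a b where ab: "w - m = a *s ?A + b *s ?B" by (auto simp: tangent_space_def)
    then have w: "w = m + a *s ?A + b *s ?B" by (simp add: algebra_simps)
    have "pdot \<epsilon> w ?A = a * of_real E" "pdot \<epsilon> w ?B = b * of_real E"
      unfolding w using m g by (simp_all add: normal pdot_left)
    then show "m = ?m" using E(4) w by simp
  qed
qed

text \<open>Differentiating E = G and F = 0 along u and v and exchanging mixed partials makes the
  Laplacian of x orthogonal to the tangent plane.\<close>

lemma isothermal_second_derivatives:
  assumes D: "open D" "smooth_on x D" and iso: "isothermal \<epsilon> D x" and t: "t \<in> D"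
  shows "pdot \<epsilon> (du (du x) t + dv (dv x) t) (du x t) = 0"
    "pdot \<epsilon> (du (du x) t + dv (dv x) t) (dv x t) = 0"
proof -
  note dd = smooth_on_differentiable[OF D(2)]
  note A = has_derivative_du_dv[OF dd(2)[OF t]] and B = has_derivative_du_dv[OF dd(3)[OF t]]
  have c: "dv (du x) t = du (dv x) t"
    by (rule mixed_partials_commute[OF D(1) t]) (use D(2) in \<open>auto simp: smooth_on_def\<close>)
  have z: "f' 1 = 0 \<and> f' \<i> = 0" if "(f has_derivative f') (at t)" "\<And>z. z \<in> D \<Longrightarrow> f z = 0"
    for f :: "complex \<Rightarrow> real" and f'
  proof -
    have "(f has_derivative (\<lambda>h. 0)) (at t)"
      by (rule has_derivative_transform_within_open[OF has_derivative_const[of 0] D(1) t]) (simp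
          add: that(2))
    from has_derivative_unique[OF that(1) this] show ?thesis by simp
  qed
  note i = iso[unfolded isothermal_def]
  have 1: "pdot \<epsilon> (du (du x) t) (du x t) = pdot \<epsilon> (du (dv x) t) (dv x t)"
    "pdot \<epsilon> (dv (du x) t) (du x t) = pdot \<epsilon> (dv (dv x) t) (dv x t)"
    using z[OF has_derivative_diff[OF has_derivative_pdot[OF A A, of \<epsilon>] has_derivative_pdot[OF B
        B, of \<epsilon>]]] i
    by (auto simp: pdot_commute[of \<epsilon> "du x t"] pdot_commute[of \<epsilon> "dv x t"])
  have 2: "pdot \<epsilon> (du (du x) t) (dv x t) + pdot \<epsilon> (du (dv x) t) (du x t) = 0"
    "pdot \<epsilon> (dv (du x) t) (dv x t) + pdot \<epsilon> (dv (dv x) t) (du x t) = 0"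
    using z[OF has_derivative_pdot[OF A B, of \<epsilon>]] i
    by (auto simp: pdot_commute[of \<epsilon> "du x t"])
  show "pdot \<epsilon> (du (du x) t + dv (dv x) t) (du x t) = 0"
    "pdot \<epsilon> (du (du x) t + dv (dv x) t) (dv x t) = 0"
    using 1 2 c by (simp_all add: pdot_left)
qed

text \<open>The Laplacian is already normal, so the mean curvature vector is the Laplacian divided
  by 2 E.\<close>

lemma maximal_iff_harmonic:
  assumes S: "spacelike_surface \<epsilon> D x" and iso: "isothermal \<epsilon> D x" and t: "t \<in> D"
  shows "mean_curvature \<epsilon> x t = 0 \<longleftrightarrow> du (du x) t + dv (dv x) t = 0"
proof -
  define E where "E = pdot \<epsilon> (du x t) (du x t)"
  have E: "pdot \<epsilon> (du x t) (du x t) = E" "pdot \<epsilon> (dv x t) (dv x t) = E" "pdot \<epsilon> (du x t) (dv x t)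
      = 0" "E \<noteq> 0"
    using iso t spacelike_pos[OF S t] by (auto simp: isothermal_def E_def)
  let ?w = "du (du x) t + dv (dv x) t"
  have id: "vec_of_real a = a" for a :: "real ^ 'n" by (simp add: vec_of_real_def)
  note np = normal_part_formula[OF E]
  have "normal_part \<epsilon> x t (du (du x) t) + normal_part \<epsilon> x t (dv (dv x) t) = normal_part \<epsilon> x t ?w"
    unfolding np by (simp add: vec_eq_iff pdot_left add_divide_distrib algebra_simps)
  also have "\<dots> = ?w"
    unfolding np id using isothermal_second_derivatives[OF _ _ iso t] S
      by (simp add: spacelike_surface_def)
  finally have w: "normal_part \<epsilon> x t (du (du x) t) + normal_part \<epsilon> x t (dv (dv x) t) = ?w" .
  have "mean_curvature \<epsilon> x t = (1 / (2 * (E * E))) *\<^sub>R E *\<^sub>R ?w"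
    by (simp add: mean_curvature_def E Let_def w[symmetric] scaleR_add_right)
  then show ?thesis using E(4) by simp
qed

lemma du_eq_Re_Phi: "du x t = (\<chi> i. Re (Phi x t $ i))"
  and dv_eq_Im_Phi: "dv x t = (\<chi> i. - Im (Phi x t $ i))"
  by (simp_all add: Phi_def vec_of_real_def vec_eq_iff)

text \<open>Harmonicity of x and equality of its mixed partials are the Cauchy-Riemann equations for
  x_u - i x_v.\<close>

lemma Phi_has_field_derivative:
  assumes M: "maximal_surface \<epsilon> D x" and iso: "isothermal \<epsilon> D x" and t: "t \<in> D"
  shows "((\<lambda>z. Phi x z $ i) has_field_derivative
           of_real (du (du x) t $ i) - \<i> * of_real (dv (du x) t $ i)) (at t)"
proof -
  have S: "spacelike_surface \<epsilon> D x" and D: "open D" "smooth_on x D"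
    using M by (auto simp: maximal_surface_def spacelike_surface_def)
  have h: "du (du x) t + dv (dv x) t = 0"
    using maximal_iff_harmonic[OF S iso t] M t by (simp add: maximal_surface_def)
  have c: "dv (du x) t = du (dv x) t"
    by (rule mixed_partials_commute[OF D(1) t]) (use D(2) in \<open>auto simp: smooth_on_def\<close>)
  note dd = smooth_on_differentiable[OF D(2) t]
  have A: "((\<lambda>z. du x z $ i) has_derivative (\<lambda>h. Re h * du (du x) t $ i
      + Im h * dv (du x) t $ i)) (at t)"
    using has_derivative_du_dv[OF dd(2)] by (simp add: has_derivative_vec)
  have B: "((\<lambda>z. dv x z $ i) has_derivative (\<lambda>h. Re h * du (dv x) t $ i
      + Im h * dv (dv x) t $ i)) (at t)"
    using has_derivative_du_dv[OF dd(3)] by (simp add: has_derivative_vec)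
  have "((\<lambda>z. complex_of_real (du x z $ i) - \<i> * complex_of_real (dv x z $ i)) has_derivative
     (\<lambda>h. of_real (Re h * du (du x) t $ i + Im h * dv (du x) t $ i) -
          \<i> * of_real (Re h * du (dv x) t $ i + Im h * dv (dv x) t $ i))) (at t)"
    by (intro has_derivative_diff has_derivative_of_real has_derivative_mult_right A B)
  moreover have "dv (dv x) t $ i = - du (du x) t $ i"
    using h by (simp add: vec_eq_iff eq_neg_iff_add_eq_0 add.commute)
  then have "(\<lambda>h. of_real (Re h * du (du x) t $ i + Im h * dv (du x) t $ i) -
          \<i> * of_real (Re h * du (dv x) t $ i + Im h * dv (dv x) t $ i)) =
      (*) (of_real (du (du x) t $ i) - \<i> * of_real (dv (du x) t $ i))"
    by (auto simp: fun_eq_iff complex_eq_iff c algebra_simps)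
  ultimately show ?thesis
    by (simp add: has_field_derivative_def Phi_def vec_of_real_def)
qed

lemma Phi_deriv_eq:
  assumes "maximal_surface \<epsilon> D x" "isothermal \<epsilon> D x" "t \<in> D"
  shows "((\<lambda>z. Phi x z $ i) has_field_derivative Phi_deriv x t $ i) (at t)"
    "du (du x) t = (\<chi> i. Re (Phi_deriv x t $ i))"
    "dv (du x) t = (\<chi> i. - Im (Phi_deriv x t $ i))"
proof -
  have "Phi_deriv x t $ i = of_real (du (du x) t $ i) - \<i> * of_real (dv (du x) t $ i)" for i
    using DERIV_imp_deriv[OF Phi_has_field_derivative[OF assms]] by (simp add: Phi_deriv_def)
  then show "((\<lambda>z. Phi x z $ i) has_field_derivative Phi_deriv x t $ i) (at t)"
    "du (du x) t = (\<chi> i. Re (Phi_deriv x t $ i))" "dv (du x) t = (\<chi> i. - Im (Phi_deriv x t $ i))"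
    using Phi_has_field_derivative[OF assms] by (simp_all add: vec_eq_iff)
qed

lemma Phi_holomorphic:
  assumes "maximal_surface \<epsilon> D x" "isothermal \<epsilon> D x"
  shows "(\<lambda>z. Phi x z $ i) holomorphic_on D"
  using Phi_deriv_eq(1)[OF assms] assms(1)
  by (auto simp: holomorphic_on_open maximal_surface_def spacelike_surface_def)

lemma isothermal_iff_Phi_null: "isothermal \<epsilon> D x \<longleftrightarrow> (\<forall>t\<in>D. pdot \<epsilon> (Phi x t) (Phi x t) = 0)"
  unfolding isothermal_def
  by (simp add: pdot_Re_Im[of \<epsilon> "Phi x _"] complex_eq_iff du_eq_Re_Phi[symmetric]
      dv_eq_Im_Phi[symmetric])

text \<open>Differentiating Phi^2 = 0 shows that Phi' is orthogonal to Phi, so its tangential part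
  is a multiple of the null vector Phi and does not contribute to the square.\<close>

lemma Phi_deriv_normal_sq_eq:
  assumes M: "maximal_surface \<epsilon> D x" and iso: "isothermal \<epsilon> D x" and t: "t \<in> D"
  shows "Phi_deriv_normal_sq \<epsilon> x t = pdot \<epsilon> (Phi_deriv x t) (Phi_deriv x t)"
proof -
  have S: "spacelike_surface \<epsilon> D x" and D: "open D" "smooth_on x D"
    using M by (auto simp: maximal_surface_def spacelike_surface_def)
  define E where "E = pdot \<epsilon> (du x t) (du x t)"
  have E: "pdot \<epsilon> (du x t) (du x t) = E" "pdot \<epsilon> (dv x t) (dv x t) = E" "pdot \<epsilon> (du x t) (dv x t)
      = 0" "E \<noteq> 0"
    using iso t spacelike_pos[OF S t] by (auto simp: isothermal_def E_def)
  let ?A = "vec_of_real (du x t) :: complex ^ 'a" and ?B = "vec_of_real (dv x t) :: complex ^ 'a"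
  let ?w = "Phi_deriv x t"
  have g: "pdot \<epsilon> ?A ?A = of_real E" "pdot \<epsilon> ?B ?B = of_real E" "pdot \<epsilon> ?A ?B = 0" "pdot \<epsilon> ?B ?A = 0"
    using E pdot_commute[of \<epsilon> ?A ?B] by (simp_all add: pdot_vec_of_real)
  have "((\<lambda>z. pdot \<epsilon> (Phi x z) (Phi x z)) has_field_derivative
      (\<Sum>i\<in>UNIV. of_real (\<epsilon> $ i) * (2 * Phi_deriv x t $ i * Phi x t $ i))) (at t)"
    unfolding pdot_def
    by (rule DERIV_cong, (rule derivative_intros Phi_deriv_eq(1)[OF M iso t])+)
       (simp add: algebra_simps)
  moreover have "((\<lambda>z. pdot \<epsilon> (Phi x z) (Phi x z)) has_field_derivative 0) (at t)"
    by (rule has_field_derivative_transform_within_open[OF DERIV_const[of 0] D(1) t])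
       (use iso in \<open>simp add: isothermal_iff_Phi_null\<close>)
  ultimately have "(\<Sum>i\<in>UNIV. of_real (\<epsilon> $ i) * (2 * Phi_deriv x t $ i * Phi x t $ i)) = 0"
    by (rule DERIV_unique)
  then have "2 * pdot \<epsilon> ?w (Phi x t) = 0"
    by (simp add: pdot_def sum_distrib_left mult_ac)
  then have wA: "pdot \<epsilon> ?w ?A = \<i> * pdot \<epsilon> ?w ?B"
    by (simp add: Phi_def pdot_right)
  have n: "normal_part \<epsilon> x t ?w = ?w - (pdot \<epsilon> ?w ?A / of_real E) *s ?A - (pdot \<epsilon> ?w ?B / of_real
      E) *s ?B"
    by (rule normal_part_formula[OF E])
  have ii: "\<i> * k * (\<i> * k) = - (k * k)" for k by (simp add: algebra_simps)
  show ?thesis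
    unfolding Phi_deriv_normal_sq_def n
    using E(4) g pdot_commute[of \<epsilon> ?A ?w] pdot_commute[of \<epsilon> ?B ?w]
    by (simp add: pdot_left pdot_right wA ii)
qed

text \<open>The surface is the real part of a primitive of \<open>P\<close>, which exists because
  \<open>D\<close> is convex. Nullity of \<open>P\<close> makes it conformal, so positivity of x_u^2
  alone gives a positive definite metric and an immersion.\<close>

lemma exists_maximal_surface:
  fixes P :: "complex \<Rightarrow> complex ^ 'n"
  assumes D: "open D" "convex D" and hol: "\<And>i. (\<lambda>z. P z $ i) holomorphic_on D"
    and null: "\<And>z. z \<in> D \<Longrightarrow> pdot \<epsilon> (P z) (P z) = 0"
    and pos: "\<And>z. z \<in> D \<Longrightarrow> pdot \<epsilon> (\<chi> i. Re (P z $ i)) (\<chi> i. Re (P z $ i)) > 0"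
  obtains x where "maximal_surface \<epsilon> D x" "isothermal \<epsilon> D x" "\<And>z. z \<in> D \<Longrightarrow> Phi x z = P z"
proof -
  have "\<exists>F. \<forall>z\<in>D. (F has_field_derivative P z $ i) (at z)" for i
    using holomorphic_convex_primitive'[OF D(2,1) hol[of i]] D(1) by (metis at_within_open)
  then obtain F where F: "\<And>i z. z \<in> D \<Longrightarrow> (F i has_field_derivative P z $ i) (at z)" by metis
  have holF: "F i holomorphic_on D" for i using F by (auto simp: holomorphic_on_open[OF D(1)])
  have dF: "deriv (F i) z = P z $ i" if "z \<in> D" for i z using F[OF that] by (rule DERIV_imp_deriv)
  define x where "x z = (\<chi> i. Re (F i z))" for z
  note r = real_part_derivatives[of D F, OF D(1) holF, folded x_def[abs_def]]
  have d: "du x z = (\<chi> i. Re (P z $ i))" "dv x z = (\<chi> i. Re (\<i> * P z $ i))" if "z \<in> D" for z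
    using r(2,3)[OF that] dF[OF that] by simp_all
  have Phi: "Phi x z = P z" if "z \<in> D" for z
    by (simp add: Phi_def d[OF that] vec_of_real_def vec_eq_iff complex_eq_iff)
  have iso: "isothermal \<epsilon> D x" using Phi null by (simp add: isothermal_iff_Phi_null)
  have fd: "frechet_derivative x (at z) h = Re h *s du x z + Im h *s dv x z" if "z \<in> D" for z h
  proof -
    have "x differentiable (at z)" using r(1)[OF that] unfolding differentiable_def by blast
    from frechet_derivative_at[OF has_derivative_du_dv[OF this]] show ?thesis
      by (metis scalar_mult_eq_scaleR)
  qed
  have pos': "pdot \<epsilon> (frechet_derivative x (at z) h) (frechet_derivative x (at z) h) > 0"
    if "z \<in> D" "h \<noteq> 0" for z h
  proof -
    have e: "pdot \<epsilon> (du x z) (du x z) = pdot \<epsilon> (dv x z) (dv x z)" "pdot \<epsilon> (du x z) (dv x z) = 0"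
      using iso that by (auto simp: isothermal_def)
    have "pdot \<epsilon> (frechet_derivative x (at z) h) (frechet_derivative x (at z) h) =
        ((Re h)\<^sup>2 + (Im h)\<^sup>2) * pdot \<epsilon> (du x z) (du x z)"
      unfolding fd[OF that(1)] using e pdot_commute[of \<epsilon> "dv x z" "du x z"]
      by (simp add: pdot_left pdot_right power2_eq_square algebra_simps)
    moreover have "(Re h)\<^sup>2 + (Im h)\<^sup>2 > 0" using that(2) by (simp add: complex_neq_0)
    ultimately show ?thesis using pos[OF that(1)] by (simp add: d[OF that(1)])
  qed
  have inj: "inj (frechet_derivative x (at z))" if "z \<in> D" for z
  proof (rule injI, rule ccontr)
    fix a b assume ab: "frechet_derivative x (at z) a = frechet_derivative x (at z) b" "a \<noteq> b"
    then have "frechet_derivative x (at z) (a - b) = 0"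
      by (simp add: fd[OF that] vec_eq_iff algebra_simps)
    then show False using pos'[OF that, of "a - b"] ab(2) by (simp add: pdot_zero)
  qed
  have S: "spacelike_surface \<epsilon> D x"
    unfolding spacelike_surface_def smooth_on_def
    using D(1) Ck_on_real_part[of D F, OF D(1) holF, folded x_def[abs_def]] inj pos' by blast
  have "du (du x) z + dv (dv x) z = 0" if "z \<in> D" for z
  proof -
    have hP: "(\<lambda>z. \<i> * P z $ i) holomorphic_on D" for i by (intro holomorphic_intros hol)
    have "du (du x) z = (\<chi> i. Re (deriv (\<lambda>z. P z $ i) z))"
      using du_dv_cong_open(1)[OF D(1) d(1) that]
        real_part_derivatives(2)[of D "\<lambda>i z. P z $ i", OF D(1) hol that] by simp
    moreover have "dv (dv x) z = (\<chi> i. Re (\<i> * (\<i> * deriv (\<lambda>z. P z $ i) z)))"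
    proof -
      have "deriv (\<lambda>z. \<i> * P z $ i) z = \<i> * deriv (\<lambda>z. P z $ i) z" for i
        using hol[of i] D(1) that
        by (intro deriv_cmult) (auto simp: holomorphic_on_imp_differentiable_at)
      then show ?thesis
        using du_dv_cong_open(2)[OF D(1) d(2) that]
          real_part_derivatives(3)[of D "\<lambda>i z. \<i> * P z $ i", OF D(1) hP that] by simp
    qed
    ultimately show ?thesis by (simp add: vec_eq_iff)
  qed
  then have "maximal_surface \<epsilon> D x"
    unfolding maximal_surface_def using S maximal_iff_harmonic[OF S iso] by blast
  then show ?thesis using that iso Phi by blast
qed

section \<open>Effect of motions on the derivatives of a surface\<close>

lemma du_dv_affine:
  fixes x :: "complex \<Rightarrow> real ^ 'n" and A :: "real ^ 'n ^ 'm"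
  assumes "x differentiable (at t)"
  shows "((\<lambda>z. A *v x z + b) has_derivative (\<lambda>h. A *v (Re h *\<^sub>R du x t + Im h *\<^sub>R dv x t))) (at t)"
    "du (\<lambda>z. A *v x z + b) t = A *v du x t" "dv (\<lambda>z. A *v x z + b) t = A *v dv x t"
proof -
  show D: "((\<lambda>z. A *v x z + b) has_derivative (\<lambda>h. A *v (Re h *\<^sub>R du x t + Im h *\<^sub>R dv x t))) (at t)"
    using bounded_linear.has_derivative[OF matrix_vector_mul_bounded_linear
        has_derivative_du_dv[OF assms], of A]
    by (auto intro: has_derivative_add_const)
  show "du (\<lambda>z. A *v x z + b) t = A *v du x t" "dv (\<lambda>z. A *v x z + b) t = A *v dv x t"
    using du_dv_eqI[OF D] by simp_all
qed

lemma Re_cmv: "(\<chi> i. Re (cmv A w $ i)) = A *v (\<chi> i. Re (w $ i))"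
  and Im_cmv: "(\<chi> i. - Im (cmv A w $ i)) = A *v (\<chi> i. - Im (w $ i))"
  by (simp_all add: cmv_def matrix_vector_mult_def vec_eq_iff sum_negf)

lemma cmv_matrix_mul: "cmv (A ** B) w = cmv A (cmv B w)"
proof -
  have "(\<Sum>j\<in>UNIV. (\<Sum>k\<in>UNIV. of_real (A $ i $ k) * of_real (B $ k $ j)) * w $ j) =
      (\<Sum>k\<in>UNIV. of_real (A $ i $ k) * (\<Sum>j\<in>UNIV. of_real (B $ k $ j) * w $ j))" for i
    unfolding sum_distrib_left sum_distrib_right mult.assoc by (rule sum.swap)
  then show ?thesis by (simp add: cmv_def matrix_matrix_mult_def vec_eq_iff)
qed

text \<open>On a ball y - A x has zero derivative; its constant value is the translation.\<close>

lemma germ_motion_equivI: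
  assumes S: "smooth_on x D" "smooth_on y D'"
    and U: "open U" "0 \<in> U" "U \<subseteq> D \<inter> D'" and A: "A \<in> special_isometries \<epsilon>"
    and P: "\<And>z. z \<in> U \<Longrightarrow> Phi y z = cmv A (Phi x z)"
  shows "germ_motion_equiv \<epsilon> (D, x) (D', y)"
proof -
  obtain e where e: "e > 0" "ball 0 e \<subseteq> U" using U openE by blast
  have "((\<lambda>z. y z - (A *v x z + 0)) has_derivative (\<lambda>h. 0)) (at z within ball 0 e)" if
      "z \<in> ball 0 e" for z
  proof -
    have z: "z \<in> D" "z \<in> D'" "z \<in> U" using that e U by auto
    have d: "du y z = A *v du x z" "dv y z = A *v dv x z"
      using P[OF z(3)] by (simp_all add: du_eq_Re_Phi dv_eq_Im_Phi Re_cmv Im_cmv)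
    have "((\<lambda>z. y z - (A *v x z + 0)) has_derivative
        (\<lambda>h. (Re h *\<^sub>R du y z + Im h *\<^sub>R dv y z) - A *v (Re h *\<^sub>R du x z + Im h *\<^sub>R dv x z))) (at z)"
      by (intro has_derivative_diff has_derivative_du_dv du_dv_affine smooth_on_differentiable[OF
          S(1) z(1)]
          smooth_on_differentiable[OF S(2) z(2)])
    then have "((\<lambda>z. y z - (A *v x z + 0)) has_derivative (\<lambda>h. 0)) (at z)"
      by (simp add: d matrix_vector_right_distrib matrix_vector_mult_scaleR)
    then show ?thesis by (rule has_derivative_at_withinI)
  qed
  from has_derivative_zero_constant[OF convex_ball this]
  obtain b where "\<And>z. z \<in> ball 0 e \<Longrightarrow> y z - (A *v x z + 0) = b" by blast
  then have "\<forall>z\<in>ball 0 e. y z = A *v x z + b" by (auto simp: algebra_simps)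
  then show ?thesis unfolding germ_motion_equiv_def
    using e U A by (intro exI[of _ "ball 0 e"] exI[of _ A] exI[of _ b]) auto
qed

lemma germ_motion_equivD:
  assumes M: "germ_motion_equiv \<epsilon> (D, x) (D', y)" and S: "smooth_on x D"
  obtains U A where "open U" "0 \<in> U" "U \<subseteq> D \<inter> D'" "A \<in> special_isometries \<epsilon>"
    "\<And>z. z \<in> U \<Longrightarrow> du y z = A *v du x z" "\<And>z. z \<in> U \<Longrightarrow> dv y z = A *v dv x z"
    "\<And>z. z \<in> U \<Longrightarrow> du (du y) z = A *v du (du x) z" "\<And>z. z \<in> U \<Longrightarrow> dv (du y) z = A *v dv (du x) z"
proof -
  from M obtain U A b where U: "open U" "0 \<in> U" "U \<subseteq> D \<inter> D'" and A: "A \<in> special_isometries \<epsilon>"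
    and y: "\<And>z. z \<in> U \<Longrightarrow> y z = A *v x z + b"
    unfolding germ_motion_equiv_def by auto
  have d: "du y z = A *v du x z" "dv y z = A *v dv x z" if "z \<in> U" for z
    using du_dv_cong_open[OF U(1) y that] that U
      du_dv_affine[OF smooth_on_differentiable(1)[OF S], of z A b] by auto
  have "du y z = A *v du x z + 0" if "z \<in> U" for z using d(1)[OF that] by simp
  note dd = du_dv_cong_open[OF U(1) this]
  have "du (du y) z = A *v du (du x) z" "dv (du y) z = A *v dv (du x) z" if "z \<in> U" for z
    using dd[OF _ that] that U
      du_dv_affine[OF smooth_on_differentiable(2)[OF S], of z A 0] by auto
  then show ?thesis using that U A d by blast
qed

section \<open>Frame determinants and the second fundamental form\<close>

lemma det_vector_matrix_image:
  fixes A :: "real ^ 'n ^ 'n" and M :: "real ^ 'n ^ 'n"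
  shows "det (\<chi> i. A *v (M $ i)) = det A * det M"
proof -
  have "(\<chi> i. A *v (M $ i)) = M ** transpose A"
    by (simp add: vec_eq_iff matrix_vector_mult_def matrix_matrix_mult_def transpose_def mult.commute)
  then show ?thesis by (simp add: det_mul)
qed

lemma det_image_4:
  fixes A :: "real ^ 4 ^ 4"
  shows "det (vector [A *v a, A *v b, A *v c, A *v d] :: real ^ 4 ^ 4)
      = det A * det (vector [a, b, c, d] :: real ^ 4 ^ 4)"
proof -
  have "(vector [A *v a, A *v b, A *v c, A *v d] :: real ^ 4 ^ 4)
      = (\<chi> i. A *v ((vector [a, b, c, d] :: real ^ 4 ^ 4) $ i))"
    by (simp add: vec_eq_iff forall_4)
  then show ?thesis using det_vector_matrix_image by metis
qed

text \<open>The normal space is a line, so a normal part is one number, and the determinant with x_u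
  and x_v measures it with the orientation built into \<open>unit_normal\<close>.\<close>

lemma normal_part_det:
  fixes x :: "complex \<Rightarrow> real ^ 3"
  assumes E: "pdot sign31 (du x t) (du x t) = E" "pdot sign31 (dv x t) (dv x t) = E"
    "pdot sign31 (du x t) (dv x t) = 0" "E > 0"
  shows "unit_normal x t \<noteq> 0"
    "normal_part sign31 x t w = (det (vector [du x t, dv x t, w] :: real ^ 3 ^ 3) / E) *\<^sub>R
        unit_normal x t"
proof -
  let ?a = "du x t" and ?b = "dv x t"
  \<comment> \<open>The Lorentz cross product of the tangent vectors.\<close>
  define c :: "real ^ 3" where
    "c = vector [?a$2 * ?b$3 - ?a$3 * ?b$2, ?a$3 * ?b$1 - ?a$1 * ?b$3, - (?a$1 * ?b$2 - ?a$2 * ?b$1)]"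
  have id: "vec_of_real v = v" for v :: "real ^ 3" by (simp add: vec_of_real_def)
  have cdet: "pdot sign31 c v = det (vector [?a, ?b, v] :: real ^ 3 ^ 3)" for v
    unfolding c_def pdot_sign31 det_3 vector_3 by (simp add: algebra_simps)
  have cab: "pdot sign31 c ?a = 0" "pdot sign31 c ?b = 0"
    unfolding c_def pdot_sign31 vector_3 by (simp_all add: algebra_simps)
  \<comment> \<open>Expansion of v in the frame x_u, x_v, c, cleared of the Gram determinant; the
    minus sign comes from c being time-like.\<close>
  have "(pdot sign31 ?a ?a * pdot sign31 ?b ?b - (pdot sign31 ?a ?b)\<^sup>2) *s v =
      (pdot sign31 ?b ?b * pdot sign31 v ?a - pdot sign31 ?a ?b * pdot sign31 v ?b) *s ?a +
      (pdot sign31 ?a ?a * pdot sign31 v ?b - pdot sign31 ?a ?b * pdot sign31 v ?a) *s ?b -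
      pdot sign31 c v *s c" for v
    unfolding c_def pdot_sign31 vector_3 vec_eq_iff forall_3
    by (simp add: algebra_simps power2_eq_square)
  then have dec: "(E * E) *s v = (E * pdot sign31 v ?a) *s ?a
      + (E * pdot sign31 v ?b) *s ?b - pdot sign31 c v *s c" for v
    unfolding E by simp
  have cc: "pdot sign31 c c = - (E * E)"
  proof -
    have "pdot sign31 c c = - (pdot sign31 ?a ?a * pdot sign31 ?b ?b - (pdot sign31 ?a ?b)\<^sup>2)"
      unfolding c_def pdot_sign31 vector_3 by (simp add: algebra_simps power2_eq_square)
    then show ?thesis by (simp add: E)
  qed
  \<comment> \<open>The sign is forced: the determinant of (x_u, x_v, n) is c . n, and c . c = -E^2
    is negative.\<close>
  define n where "n = (- 1 / E) *s c"
  have nn: "pdot sign31 n n = -1" and cn: "pdot sign31 c n = E"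
    unfolding n_def pdot_left pdot_right cc using E(4) by (simp_all add: field_simps)
  have nab: "pdot sign31 n ?a = 0" "pdot sign31 n ?b = 0"
    unfolding n_def pdot_left using cab by simp_all
  have un: "unit_normal x t = n"
    unfolding unit_normal_def
  proof (rule the_equality)
    show "n \<in> normal_space sign31 x t \<and> pdot sign31 n n = - 1
        \<and> 0 < det (vector [?a, ?b, n] :: real ^ 3 ^ 3)"
      using nab nn cn E(4) by (simp add: normal_space_iff id flip: cdet)
  next
    fix m assume m: "m \<in> normal_space sign31 x t \<and> pdot sign31 m m = - 1
        \<and> 0 < det (vector [?a, ?b, m] :: real ^ 3 ^ 3)"
    define k where "k = pdot sign31 c m / E"
    have "(E * E) *s m = - pdot sign31 c m *s c"
      using dec[of m] m by (simp add: normal_space_iff id vec_eq_iff)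
    then have mk: "m = k *s n" using E(4) by (simp add: k_def n_def vec_eq_iff field_simps)
    then have "k\<^sup>2 = 1" using m nn by (simp add: pdot_left pdot_right power2_eq_square)
    moreover have "k > 0" using m E(4) by (simp add: k_def cdet)
    ultimately have "k = 1" by (auto simp: power2_eq_1_iff)
    then show "m = n" using mk by simp
  qed
  show "unit_normal x t \<noteq> 0" using nn by (auto simp: un pdot_zero)
  have "normal_part sign31 x t w = w - (pdot sign31 w ?a / E) *s ?a - (pdot sign31 w ?b / E) *s ?b"
    using normal_part_formula[OF E(1,2,3), of w] E(4) by (simp add: id)
  also have "\<dots> = (pdot sign31 c w / E) *s n"
  proof -
    have "w $ i = (E * pdot sign31 w ?a * ?a $ i
        + E * pdot sign31 w ?b * ?b $ i - pdot sign31 c w * c $ i) / (E * E)" for i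
      using arg_cong[OF dec[of w], of "\<lambda>v. v $ i"] E(4) by (simp add: eq_divide_eq mult_ac)
    then show ?thesis using E(4) by (simp add: n_def vec_eq_iff diff_divide_distrib add_divide_distrib)
  qed
  finally show "normal_part sign31 x t w = (det (vector [?a, ?b, w] :: real ^ 3 ^ 3) / E) *\<^sub>R
      unit_normal x t"
    by (simp add: un cdet scalar_mult_eq_scaleR)
qed

text \<open>Harmonicity gives N = -L, so only L = 1 and M = 0 remain, and each is a determinant
  condition.\<close>

lemma canonical31_iff_det:
  assumes M: "maximal_surface sign31 D x" and iso: "isothermal sign31 D x"
  shows "canonical31 D x \<longleftrightarrow>
     (\<forall>t\<in>D. det (vector [du x t, dv x t, du (du x) t] :: real ^ 3 ^ 3) = pdot sign31 (du x t) (du x t) \<and>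
            det (vector [du x t, dv x t, dv (du x) t] :: real ^ 3 ^ 3) = 0)"
proof -
  have "second_form_coeffs x t 1 0 (- 1) \<longleftrightarrow>
      det (vector [du x t, dv x t, du (du x) t] :: real ^ 3 ^ 3) = pdot sign31 (du x t) (du x t) \<and>
      det (vector [du x t, dv x t, dv (du x) t] :: real ^ 3 ^ 3) = 0" if t: "t \<in> D" for t
  proof -
    have S: "spacelike_surface sign31 D x" using M by (simp add: maximal_surface_def)
    define E where "E = pdot sign31 (du x t) (du x t)"
    have E: "pdot sign31 (du x t) (du x t) = E" "pdot sign31 (dv x t) (dv x t) = E"
      "pdot sign31 (du x t) (dv x t) = 0" "E > 0"
      using iso t spacelike_pos[OF S t] by (auto simp: isothermal_def E_def)
    have "du (du x) t + dv (dv x) t = 0"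
      using maximal_iff_harmonic[OF S iso t] M t by (simp add: maximal_surface_def)
    then have "dv (dv x) t = - du (du x) t" by (simp add: eq_neg_iff_add_eq_0 add.commute)
    then have v: "det (vector [du x t, dv x t, dv (dv x) t] :: real ^ 3 ^ 3) =
        - det (vector [du x t, dv x t, du (du x) t] :: real ^ 3 ^ 3)"
      by (simp add: det_3)
    have c: "normal_part sign31 x t w = k *\<^sub>R unit_normal x t \<longleftrightarrow>
        det (vector [du x t, dv x t, w] :: real ^ 3 ^ 3) = k * E" for w k
      using normal_part_det[OF E] E(4) by (simp add: field_simps)
    have "unit_normal x t = 1 *\<^sub>R unit_normal x t" "0 = 0 *\<^sub>R unit_normal x t"
      "- unit_normal x t = (-1) *\<^sub>R unit_normal x t" by simp_all
    then show ?thesis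
      unfolding second_form_coeffs_def c v E(1) by auto
  qed
  then show ?thesis using iso by (auto simp: canonical31_def)
qed

lemma canonical42_iff:
  assumes "maximal_surface sign42 D x" "isothermal sign42 D x"
  shows "canonical42 D x \<longleftrightarrow> (\<forall>t\<in>D. pdot sign42 (Phi_deriv x t) (Phi_deriv x t) = -1)"
  using Phi_deriv_normal_sq_eq[OF assms] assms(2) by (simp add: canonical42_def)

lemma norm_power2_eq_1_iff: "(norm z)\<^sup>2 = 1 \<longleftrightarrow> norm z = 1"
  by (simp add: abs_square_eq_1)

section \<open>Surfaces with a Weierstrass representation\<close>

lemma weier31_has_field_derivative:
  assumes "(f has_field_derivative f') (at t)" "(g has_field_derivative a) (at t)"
  shows "((\<lambda>z. weier31 (f z) (g z) $ i) has_field_derivative weier31_deriv (f t) (g t) f' a $ i) (at t)"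
proof -
  have "\<forall>i. ((\<lambda>z. weier31 (f z) (g z) $ i) has_field_derivative weier31_deriv (f t) (g t) f' a $
      i) (at t)"
    unfolding forall_3 weier31_def weier31_deriv_def vector_3
    by (auto intro!: derivative_eq_intros assms simp: field_simps)
  then show ?thesis ..
qed

lemma weier42_has_field_derivative:
  assumes "(f has_field_derivative f') (at t)" "(g has_field_derivative a) (at t)"
      "(h has_field_derivative b) (at t)"
  shows "((\<lambda>z. weier42 (f z) (g z) (h z) $ i) has_field_derivative
           weier42_deriv (f t) (g t) (h t) f' a b $ i) (at t)"
proof -
  have "\<forall>i. ((\<lambda>z. weier42 (f z) (g z) (h z) $ i) has_field_derivative
           weier42_deriv (f t) (g t) (h t) f' a b $ i) (at t)"
    unfolding forall_4 weier42_def weier42_deriv_def vector_4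
    by (auto intro!: derivative_eq_intros assms simp: field_simps)
  then show ?thesis ..
qed

lemma Phi_deriv_eqI:
  assumes "maximal_surface \<epsilon> D x" "isothermal \<epsilon> D x"
    and U: "open U" "U \<subseteq> D" "t \<in> U" and P: "\<And>z. z \<in> U \<Longrightarrow> Phi x z = P z"
    and d: "\<And>i. ((\<lambda>z. P z $ i) has_field_derivative w $ i) (at t)"
  shows "Phi_deriv x t = w"
proof -
  have "((\<lambda>z. Phi x z $ i) has_field_derivative w $ i) (at t)" for i
    by (rule has_field_derivative_transform_within_open[OF d U(1,3)]) (simp add: P)
  then have "Phi_deriv x t $ i = w $ i" for i
    using Phi_deriv_eq(1)[OF assms(1,2)] U DERIV_unique by blast
  then show ?thesis by (simp add: vec_eq_iff)
qed

lemma Phi_deriv_weier31: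
  assumes "maximal_surface \<epsilon> D x" "isothermal \<epsilon> D x"
    and U: "open U" "U \<subseteq> D" "t \<in> U" and P: "\<And>z. z \<in> U \<Longrightarrow> Phi x z = weier31 (f z) (g z)"
    and h: "f holomorphic_on U" "g holomorphic_on U"
  shows "Phi_deriv x t = weier31_deriv (f t) (g t) (deriv f t) (deriv g t)"
  by (rule Phi_deriv_eqI[OF assms(1,2) U P])
     (use weier31_has_field_derivative holomorphic_derivI[OF h(1) U(1,3)] holomorphic_derivI[OF
         h(2) U(1,3)] in auto)

lemma Phi_deriv_weier42:
  assumes "maximal_surface \<epsilon> D x" "isothermal \<epsilon> D x"
    and U: "open U" "U \<subseteq> D" "t \<in> U" and P: "\<And>z. z \<in> U \<Longrightarrow> Phi x z = weier42 (f z) (g1 z) (g2 z)"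
    and h: "f holomorphic_on U" "g1 holomorphic_on U" "g2 holomorphic_on U"
  shows "Phi_deriv x t = weier42_deriv (f t) (g1 t) (g2 t) (deriv f t) (deriv g1 t) (deriv g2 t)"
  by (rule Phi_deriv_eqI[OF assms(1,2) U P])
     (use weier42_has_field_derivative holomorphic_derivI[OF h(1) U(1,3)] holomorphic_derivI[OF
         h(2) U(1,3)]
        holomorphic_derivI[OF h(3) U(1,3)] in auto)

text \<open>The complex frame determinant equals E f g', and the positive number E cancels.\<close>

lemma weier31_det_conditions:
  assumes S: "maximal_surface sign31 D x" "isothermal sign31 D x"
    and U: "open U" "U \<subseteq> D" "t \<in> U" and P: "\<And>z. z \<in> U \<Longrightarrow> Phi x z = weier31 (f z) (g z)"
    and h: "f holomorphic_on U" "g holomorphic_on U"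
  shows "4 * pdot sign31 (du x t) (du x t) = (cmod (f t))\<^sup>2 * ((cmod (g t))\<^sup>2 - 1)\<^sup>2"
    "det (vector [du x t, dv x t, du (du x) t] :: real ^ 3 ^ 3) = pdot sign31 (du x t) (du x t) \<and>
     det (vector [du x t, dv x t, dv (du x) t] :: real ^ 3 ^ 3) = 0 \<longleftrightarrow> f t * deriv g t = 1"
proof -
  have t: "t \<in> D" using U by auto
  have sp: "spacelike_surface sign31 D x" using S by (simp add: maximal_surface_def)
  show e: "4 * pdot sign31 (du x t) (du x t) = (cmod (f t))\<^sup>2 * ((cmod (g t))\<^sup>2 - 1)\<^sup>2"
    using energy_weier31[of "f t" "g t"] by (simp add: du_eq_Re_Phi P[OF U(3)])
  let ?E = "pdot sign31 (du x t) (du x t)"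
  let ?d = "det (vector [du x t, dv x t, du (du x) t] :: real ^ 3 ^ 3)"
  let ?d' = "det (vector [du x t, dv x t, dv (du x) t] :: real ^ 3 ^ 3)"
  have "4 * (complex_of_real ?d - \<i> * of_real ?d') = of_real (4 * ?E) * (f t * deriv g t)"
    unfolding e using det_frame_weier31[of "f t" "g t" "deriv f t" "deriv g t"]
    by (simp add: Phi_deriv_eq(2,3)[OF S t] Phi_deriv_weier31[OF S U P h] du_eq_Re_Phi[of x t]
        dv_eq_Im_Phi[of x t] P[OF U(3)])
  then have "4 * (complex_of_real ?d - \<i> * of_real ?d') = 4 * (of_real ?E * (f t * deriv g t))"
    by (simp only: of_real_mult of_real_numeral mult.assoc)
  then have d: "complex_of_real ?d - \<i> * of_real ?d' = of_real ?E * (f t * deriv g t)"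
    by (simp only: mult_cancel_left) simp
  have "?E > 0" using spacelike_pos[OF sp t] .
  then have "f t * deriv g t = 1 \<longleftrightarrow> of_real ?E * (f t * deriv g t) = of_real ?E" by simp
  also have "\<dots> \<longleftrightarrow> ?d = ?E \<and> ?d' = 0" unfolding d[symmetric] by (auto simp: complex_eq_iff)
  finally show "?d = ?E \<and> ?d' = 0 \<longleftrightarrow> f t * deriv g t = 1" ..
qed

lemma represented31_iff:
  "represented31 S g \<longleftrightarrow> (\<exists>U. open U \<and> 0 \<in> U \<and> U \<subseteq> fst S \<and>
     (\<forall>t\<in>U. Phi (snd S) t = weier31 (1 / deriv g t) (g t)))"
  by (simp add: represented31_def weier31_def mult.commute)

lemma represented42_iff:
  "represented42 S g1 g2 \<longleftrightarrow> (\<exists>U r. open U \<and> 0 \<in> U \<and> U \<subseteq> fst S \<and>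
     g1 holomorphic_on U \<and> g2 holomorphic_on U \<and> r holomorphic_on U \<and>
     (\<forall>t\<in>U. deriv g1 t * deriv g2 t \<noteq> 0 \<and> ((cmod (g1 t))\<^sup>2 - 1) * ((cmod (g2 t))\<^sup>2 - 1) > 0 \<and>
        (r t)\<^sup>2 = deriv g1 t * deriv g2 t \<and> Phi (snd S) t = weier42 (1 / r t) (g1 t) (g2 t)))"
  by (simp add: represented42_def weier42_def mult.commute)

lemma surfaces31D:
  assumes "(D, x) \<in> surfaces31"
  shows "0 \<in> D" "open D" "smooth_on x D" "maximal_surface sign31 D x" "isothermal sign31 D x"
    "canonical31 D x" "general_type sign31 D x"
  using assms by (auto simp: surfaces31_def canonical31_def maximal_surface_def spacelike_surface_def)

lemma surfaces42D:
  assumes "(D, x) \<in> surfaces42"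
  shows "0 \<in> D" "open D" "smooth_on x D" "maximal_surface sign42 D x" "isothermal sign42 D x"
    "canonical42 D x"
  using assms by (auto simp: surfaces42_def canonical42_def maximal_surface_def spacelike_surface_def)

lemma surfaces42_iff:
  "(D, x) \<in> surfaces42 \<longleftrightarrow> 0 \<in> D \<and> maximal_surface sign42 D x \<and> isothermal sign42 D x \<and>
     (\<forall>t\<in>D. pdot sign42 (Phi_deriv x t) (Phi_deriv x t) = -1)"
  using canonical42_iff[of D x] by (auto simp: surfaces42_def general_type_def canonical42_def)

section \<open>Surfaces with prescribed Gauss maps\<close>

lemma exists_surface31:
  assumes U: "open U" "0 \<in> U" and g: "g holomorphic_on U"
    and nz: "\<And>z. z \<in> U \<Longrightarrow> deriv g z \<noteq> 0" and ne: "\<And>z. z \<in> U \<Longrightarrow> cmod (g z) \<noteq> 1"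
  obtains S where "S \<in> surfaces31" "represented31 S g"
proof -
  obtain e where e: "e > 0" "ball 0 e \<subseteq> U" using U openE by blast
  let ?D = "ball (0::complex) e"
  have hg: "g holomorphic_on ?D" "deriv g holomorphic_on ?D"
    using g e(2) holomorphic_on_subset holomorphic_deriv by blast+
  define f where "f z = 1 / deriv g z" for z
  have hf: "f holomorphic_on ?D" unfolding f_def using nz e(2) by (intro holomorphic_intros hg) auto
  have hol: "(\<lambda>z. weier31 (f z) (g z) $ i) holomorphic_on ?D" for i
    unfolding holomorphic_on_open[OF open_ball]
    using weier31_has_field_derivative holomorphic_derivI[OF hf open_ball] holomorphic_derivI[OF
        hg(1) open_ball] by blast
  have "4 * pdot sign31 (\<chi> i. Re (weier31 (f z) (g z) $ i)) (\<chi> i. Re (weier31 (f z) (g z) $ i)) >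
      0" if "z \<in> ?D" for z
  proof -
    have "(cmod (g z))\<^sup>2 \<noteq> 1" using ne[of z] that e(2) by (auto simp: norm_power2_eq_1_iff)
    moreover have "f z \<noteq> 0" using nz[of z] that e(2) by (auto simp: f_def)
    ultimately show ?thesis unfolding energy_weier31 by simp
  qed
  then have pos: "pdot sign31 (\<chi> i. Re (weier31 (f z) (g z) $ i)) (\<chi> i. Re (weier31 (f z) (g z) $
      i)) > 0" if "z \<in> ?D" for z
    using that by (metis zero_less_mult_pos zero_less_numeral)
  obtain x where x: "maximal_surface sign31 ?D x" "isothermal sign31 ?D x" "\<And>z. z \<in> ?D \<Longrightarrow> Phi x z
      = weier31 (f z) (g z)"
    using exists_maximal_surface[OF open_ball convex_ball hol pdot_weier31 pos] by blast
  have fg: "f z * deriv g z = 1" if "z \<in> ?D" for z using nz[of z] that e(2) by (auto simp: f_def)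
  have "canonical31 ?D x"
    unfolding canonical31_iff_det[OF x(1,2)]
    using weier31_det_conditions(2)[OF x(1,2) open_ball subset_refl _ x(3) hf hg(1)] fg by blast
  moreover have "general_type sign31 ?D x"
    unfolding general_type_def
    using Phi_deriv_normal_sq_eq[OF x(1,2)] Phi_deriv_weier31[OF x(1,2) open_ball subset_refl _
        x(3) hf hg(1)] fg
    by (simp add: pdot_weier31_deriv)
  ultimately have "(?D, x) \<in> surfaces31" using x e by (simp add: surfaces31_def)
  moreover have "represented31 (?D, x) g"
    unfolding represented31_iff using x(3) e by (auto simp: f_def intro!: exI[of _ ?D])
  ultimately show ?thesis using that by blast
qed

text \<open>Shrinking to a ball serves twice: contractibility gives a holomorphic root of g1' g2',
  convexity a primitive of the Weierstrass vector.\<close>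

lemma exists_surface42:
  assumes U: "open U" "0 \<in> U" and g: "g1 holomorphic_on U" "g2 holomorphic_on U"
    and nz: "\<And>z. z \<in> U \<Longrightarrow> deriv g1 z * deriv g2 z \<noteq> 0"
    and ne: "\<And>z. z \<in> U \<Longrightarrow> ((cmod (g1 z))\<^sup>2 - 1) * ((cmod (g2 z))\<^sup>2 - 1) > 0"
  obtains S where "S \<in> surfaces42" "represented42 S g1 g2"
proof -
  obtain e where e: "e > 0" "ball 0 e \<subseteq> U" using U openE by blast
  let ?D = "ball (0::complex) e"
  have hg: "g1 holomorphic_on ?D" "g2 holomorphic_on ?D" "deriv g1 holomorphic_on ?D"
      "deriv g2 holomorphic_on ?D"
    using g e(2) holomorphic_on_subset holomorphic_deriv by blast+
  have nzD: "deriv g1 z * deriv g2 z \<noteq> 0" if "z \<in> ?D" for z using nz e(2) that by blast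
  have "(\<lambda>z. deriv g1 z * deriv g2 z) holomorphic_on ?D" by (intro holomorphic_intros hg)
  then obtain r where r: "r holomorphic_on ?D" "\<And>z. z \<in> ?D \<Longrightarrow> deriv g1 z * deriv g2 z = (r z)\<^sup>2"
    using contractible_imp_holomorphic_sqrt[of "\<lambda>z. deriv g1 z * deriv g2 z" ?D]
      convex_imp_contractible[OF convex_ball] nzD by blast
  have rnz: "r z \<noteq> 0" if "z \<in> ?D" for z using r(2)[OF that] nzD[OF that] by auto
  define f where "f z = 1 / r z" for z
  have hf: "f holomorphic_on ?D" unfolding f_def using rnz by (intro holomorphic_intros r)
  have hol: "(\<lambda>z. weier42 (f z) (g1 z) (g2 z) $ i) holomorphic_on ?D" for i
    unfolding holomorphic_on_open[OF open_ball]
    using weier42_has_field_derivative holomorphic_derivI[OF hf open_ball] holomorphic_derivI[OF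
        hg(1) open_ball]
     holomorphic_derivI[OF hg(2) open_ball] by blast
  have "8 * pdot sign42 (\<chi> i. Re (weier42 (f z) (g1 z) (g2 z) $ i)) (\<chi> i. Re (weier42 (f z) (g1 z)
      (g2 z) $ i)) > 0" if "z \<in> ?D" for z
  proof -
    have "f z \<noteq> 0" using rnz[OF that] by (auto simp: f_def)
    then have "2 * (cmod (f z))\<^sup>2 > 0" by simp
    moreover have "((cmod (g1 z))\<^sup>2 - 1) * ((cmod (g2 z))\<^sup>2 - 1) > 0" using ne that e(2) by blast
    ultimately show ?thesis unfolding energy_weier42 by (rule mult_pos_pos)
  qed
  then have pos: "pdot sign42 (\<chi> i. Re (weier42 (f z) (g1 z) (g2 z) $ i)) (\<chi> i. Re (weier42 (f z)
      (g1 z) (g2 z) $ i)) > 0" if "z \<in> ?D" for z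
    using that by (metis zero_less_mult_pos zero_less_numeral)
  obtain x where x: "maximal_surface sign42 ?D x" "isothermal sign42 ?D x" "\<And>z. z \<in> ?D \<Longrightarrow> Phi x z
      = weier42 (f z) (g1 z) (g2 z)"
    using exists_maximal_surface[OF open_ball convex_ball hol pdot_weier42 pos] by blast
  have fg: "(f z)\<^sup>2 * (deriv g1 z * deriv g2 z) = 1" if "z \<in> ?D" for z
    using rnz[OF that] by (simp add: r(2)[OF that] f_def power_divide)
  have "(?D, x) \<in> surfaces42"
    unfolding surfaces42_iff using x e Phi_deriv_weier42[OF x(1,2) open_ball subset_refl _ x(3) hf
        hg(1,2)] fg
    by (simp add: pdot_weier42_deriv)
  moreover have "represented42 (?D, x) g1 g2"
    unfolding represented42_iff using x(3) e nz ne r hg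
      by (auto simp: f_def intro!: exI[of _ ?D] exI[of _ r])
  ultimately show ?thesis using that by blast
qed

section \<open>Replacing a surface by a moved copy\<close>

lemma pdot_cmv:
  assumes "A \<in> special_isometries \<epsilon>"
  shows "pdot \<epsilon> (cmv A w) (cmv A w) = pdot \<epsilon> w w"
  using assms unfolding pdot_Re_Im[of \<epsilon> "cmv A w"] pdot_Re_Im[of \<epsilon> w] Re_cmv Im_cmv
  by (simp add: special_isometries_def)

text \<open>The copy is rebuilt by integrating \<open>cmv A (Phi x z)\<close> instead of
  transforming x, so smoothness and maximality come from
  \<open>exists_maximal_surface\<close>.\<close>

lemma move_surface:
  assumes S: "maximal_surface \<epsilon> D x" "isothermal \<epsilon> D x" "0 \<in> D" and A: "A \<in> special_isometries \<epsilon>"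
  obtains V y where "V \<subseteq> D" "0 \<in> V" "maximal_surface \<epsilon> V y" "isothermal \<epsilon> V y"
    "germ_motion_equiv \<epsilon> (D, x) (V, y)"
    "\<And>z. z \<in> V \<Longrightarrow> Phi y z = cmv A (Phi x z)" "\<And>z. z \<in> V \<Longrightarrow> Phi_deriv y z = cmv A (Phi_deriv x z)"
proof -
  have sp: "spacelike_surface \<epsilon> D x" and D: "open D" and sm: "smooth_on x D"
    using S by (auto simp: maximal_surface_def spacelike_surface_def)
  obtain e where e: "e > 0" "ball 0 e \<subseteq> D" using D S(3) openE by blast
  let ?V = "ball (0::complex) e"
  have hol: "(\<lambda>z. cmv A (Phi x z) $ i) holomorphic_on ?V" for i
    unfolding cmv_def vec_lambda_beta
    by (intro holomorphic_intros holomorphic_on_subset[OF Phi_holomorphic[OF S(1,2)] e(2)])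
  have null: "pdot \<epsilon> (cmv A (Phi x z)) (cmv A (Phi x z)) = 0" if "z \<in> ?V" for z
    using S(2) e(2) that by (auto simp: pdot_cmv[OF A] isothermal_iff_Phi_null)
  have pos: "pdot \<epsilon> (\<chi> i. Re (cmv A (Phi x z) $ i)) (\<chi> i. Re (cmv A (Phi x z) $ i)) > 0" if
      "z \<in> ?V" for z
    using spacelike_pos[OF sp, of z] e(2) that A
    by (auto simp: Re_cmv special_isometries_def du_eq_Re_Phi[symmetric])
  obtain y where y: "maximal_surface \<epsilon> ?V y" "isothermal \<epsilon> ?V y" "\<And>z. z \<in> ?V \<Longrightarrow> Phi y z
      = cmv A (Phi x z)"
    using exists_maximal_surface[OF open_ball convex_ball hol null pos] by blast
  have "Phi_deriv y z = cmv A (Phi_deriv x z)" if z: "z \<in> ?V" for z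
  proof (rule Phi_deriv_eqI[OF y(1,2) open_ball subset_refl z y(3)])
    show "((\<lambda>z. cmv A (Phi x z) $ i) has_field_derivative cmv A (Phi_deriv x z) $ i) (at z)" for i
      unfolding cmv_def vec_lambda_beta
      using z e(2) by (intro DERIV_sum DERIV_cmult Phi_deriv_eq(1)[OF S(1,2)]) auto
  qed
  moreover have "germ_motion_equiv \<epsilon> (D, x) (?V, y)"
    by (rule germ_motion_equivI[OF sm _ open_ball _ _ A y(3)])
       (use y e in \<open>auto simp: maximal_surface_def spacelike_surface_def\<close>)
  ultimately show ?thesis using that[of ?V y] e y by auto
qed

text \<open>Determinant one preserves the frame determinants of \<open>canonical31_iff_det\<close>,
  and thus the choice of the unit normal.\<close>

lemma surfaces31_move:
  assumes S: "(D, x) \<in> surfaces31" and A: "A \<in> special_isometries sign31"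
  obtains V y where "(V, y) \<in> surfaces31" "germ_motion_equiv sign31 (D, x) (V, y)" "V \<subseteq> D"
    "\<And>z. z \<in> V \<Longrightarrow> Phi y z = cmv A (Phi x z)"
proof -
  note S' = surfaces31D[OF S]
  obtain V y where V: "V \<subseteq> D" "0 \<in> V" and y: "maximal_surface sign31 V y" "isothermal sign31 V y"
    and m: "germ_motion_equiv sign31 (D, x) (V, y)"
    and P: "\<And>z. z \<in> V \<Longrightarrow> Phi y z = cmv A (Phi x z)"
    and P': "\<And>z. z \<in> V \<Longrightarrow> Phi_deriv y z = cmv A (Phi_deriv x z)"
    using move_surface[OF S'(4,5,1) A] by metis
  have d: "du y z = A *v du x z" "dv y z = A *v dv x z" "du (du y) z = A *v du (du x) z"
    "dv (du y) z = A *v dv (du x) z" if "z \<in> V" for z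
    using that V by (auto simp: P[OF that] P'[OF that] Re_cmv Im_cmv du_eq_Re_Phi[of x]
        du_eq_Re_Phi[of y z]
        dv_eq_Im_Phi[of x] dv_eq_Im_Phi[of y z] Phi_deriv_eq(2,3)[OF y that] Phi_deriv_eq(2,3)[OF
            S'(4,5)])
  have dt: "det (vector [A *v a, A *v b, A *v c] :: real ^ 3 ^ 3)
      = det (vector [a, b, c] :: real ^ 3 ^ 3)" for a b c
  proof -
    have "(vector [A *v a, A *v b, A *v c] :: real ^ 3 ^ 3)
        = (\<chi> i. A *v ((vector [a, b, c] :: real ^ 3 ^ 3) $ i))"
      by (simp add: vec_eq_iff forall_3)
    then show ?thesis using det_vector_matrix_image[of A] A by (simp add: special_isometries_def)
  qed
  have "canonical31 V y"
    using canonical31_iff_det[OF S'(4,5)] S'(6) V A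
    unfolding canonical31_iff_det[OF y] by (auto simp: d dt special_isometries_def)
  moreover have "general_type sign31 V y"
    using S'(7) V unfolding general_type_def
    by (auto simp: Phi_deriv_normal_sq_eq[OF y] Phi_deriv_normal_sq_eq[OF S'(4,5)] P' pdot_cmv[OF A])
  ultimately have "(V, y) \<in> surfaces31" using V y by (simp add: surfaces31_def)
  then show ?thesis using that m V P by blast
qed

lemma surfaces42_move:
  assumes S: "(D, x) \<in> surfaces42" and A: "A \<in> special_isometries sign42"
  obtains V y where "(V, y) \<in> surfaces42" "germ_motion_equiv sign42 (D, x) (V, y)" "V \<subseteq> D"
    "\<And>z. z \<in> V \<Longrightarrow> Phi y z = cmv A (Phi x z)"
proof -
  note S' = surfaces42D[OF S]
  obtain V y where V: "V \<subseteq> D" "0 \<in> V" and y: "maximal_surface sign42 V y" "isothermal sign42 V y"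
    and m: "germ_motion_equiv sign42 (D, x) (V, y)"
    and P: "\<And>z. z \<in> V \<Longrightarrow> Phi y z = cmv A (Phi x z)"
    and P': "\<And>z. z \<in> V \<Longrightarrow> Phi_deriv y z = cmv A (Phi_deriv x z)"
    using move_surface[OF S'(4,5,1) A] by metis
  have "(V, y) \<in> surfaces42"
    using S V y P' by (auto simp: surfaces42_iff pdot_cmv[OF A])
  then show ?thesis using that m V P by blast
qed

section \<open>Representing a surface by Gauss maps, possibly after a motion\<close>

lemma weier31_minus: "weier31 f g $ 1 - \<i> * weier31 f g $ 2 = f * g\<^sup>2"
  by (simp add: weier31_def field_simps)

lemma weier31_of_null:
  assumes "pdot sign31 P P = 0" "P $ 1 + \<i> * P $ 2 \<noteq> 0"
  shows "P = weier31 (P $ 1 + \<i> * P $ 2) (P $ 3 / (P $ 1 + \<i> * P $ 2))"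
proof -
  define f where "f = P $ 1 + \<i> * P $ 2"
  have f: "f \<noteq> 0" using assms(2) by (simp add: f_def)
  have "(P $ 3)\<^sup>2 = f * (P $ 1 - \<i> * P $ 2)"
    using assms(1) by (simp add: pdot_sign31 f_def algebra_simps power2_eq_square)
  then have g: "f * (P $ 3 / f)\<^sup>2 = P $ 1 - \<i> * P $ 2"
    using f by (simp add: power_divide) (simp add: power2_eq_square)
  have "weier31 f (P $ 3 / f) = vector [(f * (P $ 3 / f)\<^sup>2
      + f) / 2, \<i> * (f * (P $ 3 / f)\<^sup>2 - f) / 2, P $ 3]"
    using f by (simp add: weier31_def algebra_simps)
  also have "\<dots> = P"
    unfolding g by (simp add: f_def vec_eq_iff forall_3)
  finally show ?thesis by (simp add: f_def)
qed

text \<open>A null vector with nonzero f corresponds to a matrix of rank one; f is its upper left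
  entry, the pivot from which the row (1, g1) and the column (1, g2) are read off.\<close>

lemma weier42_of_null:
  assumes "pdot sign42 P P = 0" "P $ 1 + \<i> * P $ 2 \<noteq> 0"
  shows "P = weier42 (P $ 1 + \<i> * P $ 2) ((P $ 3 - \<i> * P $ 4) / (P $ 1 + \<i> * P $ 2))
               ((P $ 3 + \<i> * P $ 4) / (P $ 1 + \<i> * P $ 2))"
proof -
  define f where "f = P $ 1 + \<i> * P $ 2"
  define g h where "g = (P $ 3 - \<i> * P $ 4) / f" and "h = (P $ 3 + \<i> * P $ 4) / f"
  have f: "f \<noteq> 0" using assms(2) by (simp add: f_def)
  have fg: "f * g = P $ 3 - \<i> * P $ 4" "f * h = P $ 3 + \<i> * P $ 4" using f
    by (simp_all add: g_def h_def)
  have "(P $ 3 - \<i> * P $ 4) * (P $ 3 + \<i> * P $ 4) = f * (P $ 1 - \<i> * P $ 2)"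
    using assms(1) by (simp add: pdot_sign42 f_def algebra_simps power2_eq_square)
  then have "f * (f * g * h) = f * (P $ 1 - \<i> * P $ 2)"
    by (metis fg mult.assoc mult.commute)
  then have gh: "f * g * h = P $ 1 - \<i> * P $ 2" using f by simp
  have "weier42 f g h = vector [(f * g * h + f) / 2, \<i> * (f * g * h - f) / 2, (f * g
      + f * h) / 2, \<i> * (f * g - f * h) / 2]"
    by (simp add: weier42_def algebra_simps)
  also have "\<dots> = P"
    unfolding gh unfolding fg by (simp add: f_def vec_eq_iff forall_4)
  finally show ?thesis by (simp add: f_def g_def h_def)
qed

text \<open>These motions exchange \<open>\<Phi>\<^sub>1 + \<i>\<Phi>\<^sub>2\<close> and \<open>\<Phi>\<^sub>1 - \<i>\<Phi>\<^sub>2\<close> up to sign, hence move a pole of the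
  Gauss maps \<open>g\<close> away from \<open>0\<close>.\<close>

definition flip31 :: "real ^ 3 ^ 3" where
  "flip31 = vector [vector [-1, 0, 0], vector [0, 1, 0], vector [0, 0, -1]]"

definition flip42 :: "real ^ 4 ^ 4" where
  "flip42 = vector [vector [1, 0, 0, 0], vector [0, -1, 0, 0], vector [0, 0, 1, 0], vector [0, 0,
      0, -1]]"

lemma flip31_special: "flip31 \<in> special_isometries sign31"
  by (simp add: special_isometries_def flip31_def det_3 pdot_sign31 matrix_vector_mult_def sum_3)

lemma flip42_special: "flip42 \<in> special_isometries sign42"
  by (simp add: special_isometries_def flip42_def det_4 pdot_sign42 matrix_vector_mult_def sum_4)

lemma cmv_flip31: "cmv flip31 P = vector [- P $ 1, P $ 2, - P $ 3]"
  by (simp add: cmv_def flip31_def vec_eq_iff forall_3 sum_3)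

lemma cmv_flip42: "cmv flip42 P = vector [P $ 1, - P $ 2, P $ 3, - P $ 4]"
  by (simp add: cmv_def flip42_def vec_eq_iff forall_4 sum_4)

text \<open>Since P1 - i P2 = f g^2, the hypothesis \<open>lt\<close> says that f 0 is nonzero and
  |g 0| < 1.\<close>

lemma represented31_direct:
  assumes S: "(D, x) \<in> surfaces31"
    and lt: "cmod (Phi x 0 $ 1 - \<i> * Phi x 0 $ 2) < cmod (Phi x 0 $ 1 + \<i> * Phi x 0 $ 2)"
  obtains U g where "open U" "0 \<in> U" "g holomorphic_on U" "\<And>z. z \<in> U \<Longrightarrow> deriv g z \<noteq> 0"
    "\<And>z. z \<in> U \<Longrightarrow> cmod (g z) < 1" "represented31 (D, x) g"
proof -
  note S' = surfaces31D[OF S]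
  define f where "f z = Phi x z $ 1 + \<i> * Phi x z $ 2" for z
  define g where "g z = Phi x z $ 3 / f z" for z
  have hf: "f holomorphic_on D" unfolding f_def
    by (intro holomorphic_intros Phi_holomorphic[OF S'(4,5)])
  define U0 where "U0 = {z \<in> D. f z \<noteq> 0}"
  have U0: "open U0" "U0 \<subseteq> D"
    using open_nonzero_set[OF S'(2) holomorphic_on_imp_continuous_on[OF hf]] by (auto simp: U0_def)
  have f0: "f 0 \<noteq> 0" using lt by (auto simp: f_def)
  have hg: "g holomorphic_on U0" unfolding g_def
    by (intro holomorphic_intros holomorphic_on_subset[OF hf U0(2)] holomorphic_on_subset[OF
        Phi_holomorphic[OF S'(4,5)] U0(2)])
       (simp add: U0_def)
  have null: "pdot sign31 (Phi x z) (Phi x z) = 0" if "z \<in> D" for z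
    using S'(5) that by (simp add: isothermal_iff_Phi_null)
  have P: "Phi x z = weier31 (f z) (g z)" if "z \<in> U0" for z
    using weier31_of_null[OF null, of z] that by (simp add: U0_def f_def g_def)
  define U where "U = U0 \<inter> g -` ball 0 1"
  have "open U" unfolding U_def
    by (intro continuous_open_preimage holomorphic_on_imp_continuous_on[OF hg] U0 open_ball)
  have sub: "U \<subseteq> U0" by (auto simp: U_def)
  have z0: "0 \<in> U0" using f0 S'(1) by (simp add: U0_def)
  have "f 0 * (g 0)\<^sup>2 = Phi x 0 $ 1 - \<i> * Phi x 0 $ 2"
    using arg_cong[OF P[OF z0], of "\<lambda>v. v $ 1 - \<i> * v $ 2"] by (simp add: weier31_def field_simps)
  then have "cmod (f 0) * (cmod (g 0))\<^sup>2 < cmod (f 0)"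
    using lt by (metis f_def norm_mult norm_power)
  then have "(cmod (g 0))\<^sup>2 < 1" using f0 by simp
  then have "cmod (g 0) < 1" by (simp add: power_less_one_iff abs_square_less_1)
  then have "0 \<in> U" using z0 by (simp add: U_def)
  have fg: "f z * deriv g z = 1" if "z \<in> U0" for z
    using weier31_det_conditions(2)[OF S'(4,5) U0 that P holomorphic_on_subset[OF hf U0(2)] hg]
      S'(6) that U0(2) unfolding canonical31_iff_det[OF S'(4,5)] by blast
  have "represented31 (D, x) g"
    unfolding represented31_iff
  proof (intro exI[of _ U] conjI ballI)
    fix t assume "t \<in> U"
    then have e: "f t * deriv g t = 1" using fg sub by blast
    then have "deriv g t \<noteq> 0" by auto
    then have "f t = 1 / deriv g t" using e by (simp add: nonzero_eq_divide_eq)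
    then show "Phi (snd (D, x)) t = weier31 (1 / deriv g t) (g t)" using P \<open>t \<in> U\<close> sub by auto
  qed (use \<open>open U\<close> \<open>0 \<in> U\<close> sub U0 in auto)
  moreover have "deriv g z \<noteq> 0" if "z \<in> U" for z using fg[of z] sub that by auto
  ultimately show ?thesis
    using that[of U g] \<open>open U\<close> \<open>0 \<in> U\<close> holomorphic_on_subset[OF hg sub] by (auto simp: U_def)
qed

text \<open>The motion \<open>flip31\<close> replaces g by 1 / g, exchanging the inside and the
  outside of the circle. The borderline case |g 0| = 1, or f and f g^2 both zero, contradicts
  positivity of the metric.\<close>

lemma represented31_up_to_motion:
  assumes S: "(D, x) \<in> surfaces31"
  obtains S' U g where "S' \<in> surfaces31" "germ_motion_equiv sign31 (D, x) S'"
    "open U" "0 \<in> U" "g holomorphic_on U" "\<And>z. z \<in> U \<Longrightarrow> deriv g z \<noteq> 0"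
    "\<And>z. z \<in> U \<Longrightarrow> cmod (g z) < 1" "represented31 S' g"
proof -
  note S' = surfaces31D[OF S]
  let ?f = "Phi x 0 $ 1 + \<i> * Phi x 0 $ 2" and ?k = "Phi x 0 $ 1 - \<i> * Phi x 0 $ 2"
  have null: "pdot sign31 (Phi x 0) (Phi x 0) = 0" using S'(1,5) by (simp add: isothermal_iff_Phi_null)
  have pos: "pdot sign31 (du x 0) (du x 0) > 0"
    using S'(4) S'(1) spacelike_pos by (auto simp: maximal_surface_def)
  consider "cmod ?k < cmod ?f" | "cmod ?f < cmod ?k" | "cmod ?f = cmod ?k" by linarith
  then show ?thesis
  proof cases
    case 1
    from represented31_direct[OF S 1] show ?thesis
      using that S germ_motion_equiv_refl[OF S'(2,1)] by metis
  next
    case 2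
    obtain V y where y: "(V, y) \<in> surfaces31" "germ_motion_equiv sign31 (D, x) (V, y)"
      "\<And>z. z \<in> V \<Longrightarrow> Phi y z = cmv flip31 (Phi x z)"
      using surfaces31_move[OF S flip31_special] by metis
    have "Phi y 0 = vector [- Phi x 0 $ 1, Phi x 0 $ 2, - Phi x 0 $ 3]"
      using y(3) surfaces31D(1)[OF y(1)] by (simp add: cmv_flip31)
    then have "Phi y 0 $ 1 - \<i> * Phi y 0 $ 2 = - ?f" "Phi y 0 $ 1 + \<i> * Phi y 0 $ 2 = - ?k" by simp_all
    with 2 have "cmod (Phi y 0 $ 1 - \<i> * Phi y 0 $ 2) < cmod (Phi y 0 $ 1 + \<i> * Phi y 0 $ 2)"
      by (simp only: norm_minus_cancel)
    from represented31_direct[OF y(1) this] show ?thesis using that y by metis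
  next
    case 3
    have "?f \<noteq> 0"
    proof
      assume "?f = 0"
      with 3 have "?k = 0" by simp
      have "Phi x 0 $ 1 = (?f + ?k) / 2" "Phi x 0 $ 2 = - \<i> * (?f - ?k) / 2" by simp_all
      with \<open>?f = 0\<close> \<open>?k = 0\<close> have "Phi x 0 $ 1 = 0" "Phi x 0 $ 2 = 0" by simp_all
      moreover from this null have "Phi x 0 $ 3 = 0" by (simp add: pdot_sign31)
      ultimately show False using pos by (simp add: pdot_sign31 du_eq_Re_Phi)
    qed
    define g where "g = Phi x 0 $ 3 / ?f"
    have P: "Phi x 0 = weier31 ?f g" using weier31_of_null[OF null \<open>?f \<noteq> 0\<close>] by (simp add: g_def)
    have "?f * g\<^sup>2 = ?k"
      using arg_cong[OF P, of "\<lambda>v. v $ 1 - \<i> * v $ 2"] unfolding weier31_minus by (rule sym)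
    then have "cmod ?f * (cmod g)\<^sup>2 = cmod ?f" using 3 by (metis norm_mult norm_power)
    then have "(cmod g)\<^sup>2 = 1" using \<open>?f \<noteq> 0\<close> by simp
    then have "4 * pdot sign31 (du x 0) (du x 0) = 0"
      using energy_weier31[of ?f g] by (simp add: du_eq_Re_Phi P[symmetric])
    then show ?thesis using pos by simp
  qed
qed

lemma represented42_direct:
  assumes S: "(D, x) \<in> surfaces42" and f0: "Phi x 0 $ 1 + \<i> * Phi x 0 $ 2 \<noteq> 0"
  obtains g1 g2 where "represented42 (D, x) g1 g2"
proof -
  note S' = surfaces42D[OF S]
  have sp: "spacelike_surface sign42 D x" using S'(4) by (simp add: maximal_surface_def)
  define f where "f z = Phi x z $ 1 + \<i> * Phi x z $ 2" for z
  define g where "g z = (Phi x z $ 3 - \<i> * Phi x z $ 4) / f z" for z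
  define h where "h z = (Phi x z $ 3 + \<i> * Phi x z $ 4) / f z" for z
  have hf: "f holomorphic_on D" unfolding f_def
    by (intro holomorphic_intros Phi_holomorphic[OF S'(4,5)])
  define U where "U = {z \<in> D. f z \<noteq> 0}"
  have U: "open U" "U \<subseteq> D"
    using open_nonzero_set[OF S'(2) holomorphic_on_imp_continuous_on[OF hf]] by (auto simp: U_def)
  have z0: "0 \<in> U" using f0 S'(1) by (simp add: U_def f_def)
  have hfU: "f holomorphic_on U" using hf U(2) holomorphic_on_subset by blast
  have hg: "g holomorphic_on U" "h holomorphic_on U" unfolding g_def h_def
    by (intro holomorphic_intros hfU holomorphic_on_subset[OF Phi_holomorphic[OF S'(4,5)] U(2)];
        simp add: U_def)+
  have null: "pdot sign42 (Phi x z) (Phi x z) = 0" if "z \<in> D" for z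
    using S'(5) that by (simp add: isothermal_iff_Phi_null)
  have P: "Phi x z = weier42 (f z) (g z) (h z)" if "z \<in> U" for z
    using weier42_of_null[OF null, of z] that by (simp add: U_def f_def g_def h_def)
  have fg: "(f z)\<^sup>2 * (deriv g z * deriv h z) = 1" if "z \<in> U" for z
  proof -
    have "pdot sign42 (Phi_deriv x z) (Phi_deriv x z) = -1" using S that U(2)
      by (auto simp: surfaces42_iff)
    then have "- ((f z)\<^sup>2 * (deriv g z * deriv h z)) = -1"
      by (simp only: Phi_deriv_weier42[OF S'(4,5) U that P hfU hg] pdot_weier42_deriv)
    then show ?thesis by (simp only: neg_equal_iff_equal)
  qed
  have pos: "((cmod (g z))\<^sup>2 - 1) * ((cmod (h z))\<^sup>2 - 1) > 0" if "z \<in> U" for z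
  proof -
    have "pdot sign42 (du x z) (du x z) > 0" using spacelike_pos[OF sp] that U(2) by blast
    then have "2 * (cmod (f z))\<^sup>2 * (((cmod (g z))\<^sup>2 - 1) * ((cmod (h z))\<^sup>2 - 1)) > 0"
      using energy_weier42[of "f z" "g z" "h z"] by (simp add: du_eq_Re_Phi P[OF that])
    moreover have "2 * (cmod (f z))\<^sup>2 > 0" using that by (simp add: U_def)
    ultimately show ?thesis by (rule zero_less_mult_pos)
  qed
  have "represented42 (D, x) g h"
    unfolding represented42_iff
  proof (intro exI[of _ U] exI[of _ "\<lambda>z. 1 / f z"] conjI ballI)
    \<comment> \<open>By \<open>fg\<close> the function 1 / f is a branch of the root of g'
      h'.\<close>
    show "(\<lambda>z. 1 / f z) holomorphic_on U" by (intro holomorphic_intros hfU) (simp add: U_def)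
    fix t assume t: "t \<in> U"
    then have ft: "f t \<noteq> 0" by (simp add: U_def)
    show "deriv g t * deriv h t \<noteq> 0" using fg[OF t] by auto
    show "(1 / f t)\<^sup>2 = deriv g t * deriv h t"
      using fg[OF t] ft by (simp add: power_divide divide_eq_eq mult.commute)
    show "Phi (snd (D, x)) t = weier42 (1 / (1 / f t)) (g t) (h t)" using P[OF t] by simp
  qed (use U z0 hg pos in auto)
  then show ?thesis by (rule that)
qed

text \<open>If P1 + i P2 and P1 - i P2 both vanished at 0, x_u would have no positive components; so
  one of them can serve as f, after \<open>flip42\<close> if necessary.\<close>

lemma represented42_up_to_motion:
  assumes S: "(D, x) \<in> surfaces42"
  obtains S' g1 g2 where "S' \<in> surfaces42" "germ_motion_equiv sign42 (D, x) S'" "represented42 S' g1 g2"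
proof (cases "Phi x 0 $ 1 + \<i> * Phi x 0 $ 2 = 0")
  case False
  from represented42_direct[OF S False] show ?thesis
    using that S germ_motion_equiv_refl surfaces42D(1,2)[OF S] by metis
next
  case True
  note S' = surfaces42D[OF S]
  have pos: "pdot sign42 (du x 0) (du x 0) > 0"
    using S'(4) S'(1) spacelike_pos by (auto simp: maximal_surface_def)
  have "Phi x 0 $ 1 - \<i> * Phi x 0 $ 2 \<noteq> 0"
  proof
    assume k: "Phi x 0 $ 1 - \<i> * Phi x 0 $ 2 = 0"
    have "Phi x 0 $ 1 = ((Phi x 0 $ 1 + \<i> * Phi x 0 $ 2) + (Phi x 0 $ 1 - \<i> * Phi x 0 $ 2)) / 2"
      "Phi x 0 $ 2 = - \<i> * ((Phi x 0 $ 1 + \<i> * Phi x 0 $ 2) - (Phi x 0 $ 1 - \<i> * Phi x 0 $ 2)) / 2"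
      by simp_all
    then have "Phi x 0 $ 1 = 0" "Phi x 0 $ 2 = 0" unfolding k True by simp_all
    then have "pdot sign42 (du x 0) (du x 0) \<le> 0" by (simp add: pdot_sign42 du_eq_Re_Phi)
    with pos show False by simp
  qed
  moreover obtain V y where y: "(V, y) \<in> surfaces42" "germ_motion_equiv sign42 (D, x) (V, y)"
    "\<And>z. z \<in> V \<Longrightarrow> Phi y z = cmv flip42 (Phi x z)"
    using surfaces42_move[OF S flip42_special] by metis
  have "Phi y 0 = vector [Phi x 0 $ 1, - Phi x 0 $ 2, Phi x 0 $ 3, - Phi x 0 $ 4]"
    using y(3) surfaces42D(1)[OF y(1)] by (simp add: cmv_flip42)
  ultimately have "Phi y 0 $ 1 + \<i> * Phi y 0 $ 2 \<noteq> 0" by simp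
  from represented42_direct[OF y(1) this] show ?thesis using that y by metis
qed

lemma det_scaleR: "det (c *\<^sub>R (B :: real ^ 'n ^ 'n)) = c ^ CARD('n) * det B"
proof -
  have "c *\<^sub>R B = (\<chi> i. c *s B $ i)" by (simp add: vec_eq_iff)
  then show ?thesis using det_rows_mul[of "\<lambda>_. c" "\<lambda>i. B $ i"] by simp
qed

section \<open>Motions and the metrics of the factors\<close>

text \<open>Division by d corrects both the factor d^2 of the product and the factor d^3 of the
  determinant, whatever the sign of d.\<close>

lemma congr_mult_special:
  assumes "(cmod p)\<^sup>2 - (cmod q)\<^sup>2 = d" "d \<noteq> 0"
  shows "(1 / d) *\<^sub>R congr_mult p q \<in> special_isometries sign31"
proof -
  let ?A = "(1 / d) *\<^sub>R congr_mult p q"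
  have "det ?A = (1 / d) ^ 3 * det (congr_mult p q)"
    by (simp add: det_scaleR)
  moreover have "?A *v a = (1 / d) *s (congr_mult p q *v a)" for a
    by (simp add: scalar_mult_eq_scaleR scaleR_matrix_vector_assoc)
  ultimately show ?thesis
    using assms by (simp add: special_isometries_def det_congr_mult pdot_left pdot_right
        pdot_congr_mult power_divide power2_eq_square power3_eq_cube)
qed

text \<open>Conjugation by the transposition \<open>flip4\<close> turns multiplication on the right
  into multiplication on the left, so the two pairs act independently on g1 and g2.\<close>

lemma right_mult_special:
  assumes d: "((cmod p)\<^sup>2 - (cmod q)\<^sup>2) * ((cmod p')\<^sup>2 - (cmod q')\<^sup>2) = d" "c\<^sup>2 * d = 1"
  shows "c *\<^sub>R (right_mult p q ** flip4 ** right_mult p' q' ** flip4) \<in> special_isometries sign42"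
proof -
  let ?B = "right_mult p q ** flip4 ** right_mult p' q' ** flip4"
  have "det (c *\<^sub>R ?B) = c ^ 4 * det ?B"
    by (simp add: det_scaleR)
  also have "\<dots> = (c\<^sup>2 * d)\<^sup>2"
    unfolding d(1)[symmetric] by (simp add: det_mul det_right_mult det_flip4 power_mult_distrib
        flip: power_mult)
  finally have "det (c *\<^sub>R ?B) = 1" using d(2) by simp
  moreover have "pdot sign42 (c *\<^sub>R ?B *v a) (c *\<^sub>R ?B *v b) = pdot sign42 a b" for a b
  proof -
    have "c *\<^sub>R ?B *v a = c *s (right_mult p q *v (flip4 *v (right_mult p' q' *v (flip4 *v a))))" for a
      by (simp add: scalar_mult_eq_scaleR matrix_vector_mul_assoc matrix_mul_assoc flip:
          scaleR_matrix_vector_assoc)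
    then have "pdot sign42 (c *\<^sub>R ?B *v a) (c *\<^sub>R ?B *v b) = (c\<^sup>2 * d) * pdot sign42 a b"
      unfolding d(1)[symmetric]
      by (simp add: pdot_left pdot_right pdot_right_mult pdot_flip4 power2_eq_square)
    then show ?thesis using d(2) by simp
  qed
  ultimately show ?thesis unfolding special_isometries_def by blast
qed

lemma cmv_scaleR: "cmv (c *\<^sub>R A) w = of_real c *s cmv A w"
  by (simp add: cmv_def vec_eq_iff sum_distrib_left mult.assoc)

lemma scale_weier31: "c *s weier31 f g = weier31 (c * f) g"
  by (simp add: weier31_def vec_eq_iff forall_3)

lemma scale_weier42: "c *s weier42 f g h = weier42 (c * f) g h"
  by (simp add: weier42_def vec_eq_iff forall_4)

text \<open>Equality of the metric coefficients \<open>(|g|\<^sup>2 - 1)\<^sup>2 / |g'|\<^sup>2\<close> of the surfaces in \<open>\<real>\<^sup>3\<^sub>1\<close> given by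
  \<open>g\<close> and \<open>h\<close>, with the denominators cleared.\<close>

definition same_metric :: "(complex \<Rightarrow> complex) \<Rightarrow> (complex \<Rightarrow> complex) \<Rightarrow> complex \<Rightarrow> bool" where
  "same_metric g h z \<longleftrightarrow>
     (cmod (deriv g z))\<^sup>2 * ((cmod (h z))\<^sup>2 - 1)\<^sup>2 = (cmod (deriv h z))\<^sup>2 * ((cmod (g z))\<^sup>2 - 1)\<^sup>2"

lemma surface31_energy:
  assumes S: "(D, x) \<in> surfaces31" and U: "open U" "U \<subseteq> D" "t \<in> U" and g: "g holomorphic_on U"
    and P: "\<And>z. z \<in> U \<Longrightarrow> Phi x z = weier31 (1 / deriv g z) (g z)"
  shows "4 * pdot sign31 (du x t) (du x t) = ((cmod (g t))\<^sup>2 - 1)\<^sup>2 / (cmod (deriv g t))\<^sup>2"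
    "deriv g t \<noteq> 0" "cmod (g t) \<noteq> 1"
proof -
  show e: "4 * pdot sign31 (du x t) (du x t) = ((cmod (g t))\<^sup>2 - 1)\<^sup>2 / (cmod (deriv g t))\<^sup>2"
    using energy_weier31[of "1 / deriv g t" "g t"]
    by (simp add: du_eq_Re_Phi P[OF U(3)] norm_divide power_divide)
  have "4 * pdot sign31 (du x t) (du x t) > 0"
    using spacelike_pos[of sign31 D x t] surfaces31D(4)[OF S] U by (auto simp: maximal_surface_def)
  then show "deriv g t \<noteq> 0" "cmod (g t) \<noteq> 1" unfolding e by auto
qed

lemma germ_motion_equiv31_imp_same_metric:
  assumes S: "S \<in> surfaces31" "S' \<in> surfaces31" and m: "germ_motion_equiv sign31 S S'"
    and r: "represented31 S g" "represented31 S' h"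
    and hol: "open W" "0 \<in> W" "g holomorphic_on W" "h holomorphic_on W"
  obtains U where "open U" "0 \<in> U" "U \<subseteq> W" "\<And>z. z \<in> U \<Longrightarrow> same_metric g h z"
proof -
  obtain D x D' y where xy: "S = (D, x)" "S' = (D', y)" by fastforce
  note Sx = S(1)[unfolded xy] and Sy = S(2)[unfolded xy]
  obtain V where V: "open V" "0 \<in> V" "V \<subseteq> D" "\<And>z. z \<in> V \<Longrightarrow> Phi x z = weier31 (1 / deriv g z) (g z)"
    using r(1) unfolding represented31_iff xy by auto
  obtain V' where V': "open V'" "0 \<in> V'" "V' \<subseteq> D'" "\<And>z. z \<in> V' \<Longrightarrow> Phi y z
      = weier31 (1 / deriv h z) (h z)"
    using r(2) unfolding represented31_iff xy by auto
  obtain U A where U: "open U" "0 \<in> U" "U \<subseteq> D \<inter> D'" and A: "A \<in> special_isometries sign31"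
    and d: "\<And>z. z \<in> U \<Longrightarrow> du y z = A *v du x z"
    using germ_motion_equivD[OF m[unfolded xy] surfaces31D(3)[OF Sx]] by metis
  let ?U = "U \<inter> V \<inter> V' \<inter> W"
  have o: "open ?U" "0 \<in> ?U" "?U \<subseteq> D" "?U \<subseteq> D'" using U V V' hol by auto
  have hol': "g holomorphic_on ?U" "h holomorphic_on ?U" using hol(3,4)
    by (auto elim: holomorphic_on_subset)
  have "same_metric g h z" if z: "z \<in> ?U" for z
  proof -
    note e1 = surface31_energy[OF Sx o(1,3) z hol'(1), OF V(4)] and e2
        = surface31_energy[OF Sy o(1,4) z hol'(2), OF V'(4)]
    have "pdot sign31 (du y z) (du y z) = pdot sign31 (du x z) (du x z)"
      using d[of z] z A by (simp add: special_isometries_def)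
    then have "((cmod (g z))\<^sup>2 - 1)\<^sup>2 / (cmod (deriv g z))\<^sup>2 = ((cmod (h z))\<^sup>2 - 1)\<^sup>2 / (cmod (deriv h z))\<^sup>2"
      using e1(1) e2(1) by simp
    then show ?thesis using e1(2) e2(2) by (simp add: same_metric_def frac_eq_eq mult.commute)
  qed
  then show ?thesis using that o by blast
qed

text \<open>The derivative rule h' = d g' / (p + cnj q g)^2 matches the change of the factor f under
  \<open>congr_mult p q\<close>, so f = 1 / g' becomes 1 / h' after division by d.\<close>

lemma same_metric_imp_germ_motion_equiv31:
  assumes S: "S \<in> surfaces31" "S' \<in> surfaces31"
    and r: "represented31 S g" "represented31 S' h"
    and hol: "open W" "0 \<in> W" "g holomorphic_on W" "h holomorphic_on W"
    and eq: "\<And>z. z \<in> W \<Longrightarrow> same_metric g h z"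
  shows "germ_motion_equiv sign31 S S'"
proof -
  obtain D x D' y where xy: "S = (D, x)" "S' = (D', y)" by fastforce
  note Sx = S(1)[unfolded xy] and Sy = S(2)[unfolded xy]
  obtain V where V: "open V" "0 \<in> V" "V \<subseteq> D" "\<And>z. z \<in> V \<Longrightarrow> Phi x z = weier31 (1 / deriv g z) (g z)"
    using r(1) unfolding represented31_iff xy by auto
  obtain V' where V': "open V'" "0 \<in> V'" "V' \<subseteq> D'" "\<And>z. z \<in> V' \<Longrightarrow> Phi y z
      = weier31 (1 / deriv h z) (h z)"
    using r(2) unfolding represented31_iff xy by auto
  let ?U = "V \<inter> V' \<inter> W"
  have o: "open ?U" "0 \<in> ?U" "?U \<subseteq> D" "?U \<subseteq> D'" using V V' hol by auto
  have hol': "g holomorphic_on ?U" "h holomorphic_on ?U" using hol(3,4)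
    by (auto elim: holomorphic_on_subset)
  note e1 = surface31_energy[OF Sx o(1,3) _ hol'(1), OF _ V(4)] and e2
      = surface31_energy[OF Sy o(1,4) _ hol'(2), OF _ V'(4)]
  have nz: "deriv g 0 \<noteq> 0" "cmod (g 0) \<noteq> 1" "deriv h 0 \<noteq> 0" "cmod (h 0) \<noteq> 1"
    using e1(2,3)[OF o(2)] e2(2,3)[OF o(2)] by auto
  define d where "d = ((cmod (g 0))\<^sup>2 - 1) * ((cmod (h 0))\<^sup>2 - 1)"
  have d: "d \<noteq> 0" using nz by (simp add: d_def norm_power2_eq_1_iff)
  have eq': "(cmod (deriv g z))\<^sup>2 * ((cmod (h z))\<^sup>2 - 1)\<^sup>2 =
      (cmod (deriv h z))\<^sup>2 * ((cmod (g z))\<^sup>2 - 1)\<^sup>2" if "z \<in> ?U" for z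
    using eq[of z] that by (simp add: same_metric_def)
  obtain p q T where T: "open T" "0 \<in> T" "T \<subseteq> ?U" and pq0: "(cmod p)\<^sup>2 - (cmod q)\<^sup>2
      = ((cmod (g 0))\<^sup>2 - 1) * ((cmod (h 0))\<^sup>2 - 1)"
    and pz: "\<And>z. z \<in> T \<Longrightarrow> p + cnj q * g z \<noteq> 0"
    and hz: "\<And>z. z \<in> T \<Longrightarrow> h z = (q + cnj p * g z) / (p + cnj q * g z)"
    by (rule moebius_of_equal_metric[OF o(1,2) hol' nz(1,3,2,4) eq'], assumption) (rule that)
  note pq = pq0[folded d_def]
  have "Phi y z = cmv ((1 / d) *\<^sub>R congr_mult p q) (Phi x z)" if z: "z \<in> T" for z
  proof -
    have zU: "z \<in> V" "z \<in> V'" "z \<in> ?U" using z T(3) by auto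
    have "deriv h z = of_real d * deriv g z / (p + cnj q * g z)\<^sup>2"
      using deriv_moebius[OF T(1) holomorphic_on_subset[OF hol'(1) T(3)] z pz hz] by (simp add: pq)
    then have dh: "1 / deriv h z = of_real (1 / d) * (1 / deriv g z * (p + cnj q * g z)\<^sup>2)" by simp
    show ?thesis
      unfolding V(4)[OF zU(1)] V'(4)[OF zU(2)] cmv_scaleR cmv_congr_mult[OF pz[OF z]]
          scale_weier31 dh hz[OF z, symmetric] ..
  qed
  then show ?thesis unfolding xy
    using T o by (intro germ_motion_equivI[OF surfaces31D(3)[OF Sx] surfaces31D(3)[OF Sy] T(1,2) _
        congr_mult_special[OF pq d]]) auto
qed

lemma surface42_invariants:
  assumes S: "(D, x) \<in> surfaces42" and U: "open U" "U \<subseteq> D" "t \<in> U"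
    and hol: "g1 holomorphic_on U" "g2 holomorphic_on U" "r holomorphic_on U"
    and nz: "\<And>z. z \<in> U \<Longrightarrow> deriv g1 z * deriv g2 z \<noteq> 0"
    and r: "\<And>z. z \<in> U \<Longrightarrow> (r z)\<^sup>2 = deriv g1 z * deriv g2 z"
    and P: "\<And>z. z \<in> U \<Longrightarrow> Phi x z = weier42 (1 / r z) (g1 z) (g2 z)"
  defines "X \<equiv> ((cmod (g1 t))\<^sup>2 - 1)\<^sup>2 / (cmod (deriv g1 t))\<^sup>2"
    and "Y \<equiv> ((cmod (g2 t))\<^sup>2 - 1)\<^sup>2 / (cmod (deriv g2 t))\<^sup>2"
  shows "(4 * pdot sign42 (du x t) (du x t))\<^sup>2 = X * Y"
    "16 * det (vector [du x t, dv x t, du (du x) t, dv (du x) t] :: real ^ 4 ^ 4) = X - Y"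
proof -
  note S' = surfaces42D[OF S]
  have t: "t \<in> D" using U by auto
  have a: "deriv g1 t \<noteq> 0" "deriv g2 t \<noteq> 0" using nz[OF U(3)] by auto
  have rnz: "r z \<noteq> 0" if "z \<in> U" for z using r[OF that] nz[OF that] by auto
  have hf: "(\<lambda>z. 1 / r z) holomorphic_on U" using rnz by (intro holomorphic_intros hol)
  have r2: "((cmod (r t))\<^sup>2)\<^sup>2 = (cmod (deriv g1 t))\<^sup>2 * (cmod (deriv g2 t))\<^sup>2"
    using arg_cong[OF r[OF U(3)], of cmod] by (simp add: norm_mult norm_power power_mult_distrib)
  have "4 * pdot sign42 (du x t) (du x t) =
      (((cmod (g1 t))\<^sup>2 - 1) * ((cmod (g2 t))\<^sup>2 - 1)) / (cmod (r t))\<^sup>2"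
    using energy_weier42[of "1 / r t" "g1 t" "g2 t"]
    by (simp add: du_eq_Re_Phi P[OF U(3)] norm_divide power_divide)
  then show "(4 * pdot sign42 (du x t) (du x t))\<^sup>2 = X * Y"
    by (simp only: X_def Y_def power_divide power_mult_distrib r2 times_divide_times_eq)
  have "16 * det (vector [du x t, dv x t, du (du x) t, dv (du x) t] :: real ^ 4 ^ 4) =
      (cmod (1 / r t)) ^ 4 * ((cmod (deriv g2 t))\<^sup>2 * ((cmod (g1 t))\<^sup>2 - 1)\<^sup>2 -
         (cmod (deriv g1 t))\<^sup>2 * ((cmod (g2 t))\<^sup>2 - 1)\<^sup>2)"
    using det_frame_weier42[of "1 / r t" "g1 t" "g2 t" "deriv (\<lambda>z. 1 / r z) t" "deriv g1 t"
        "deriv g2 t"]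
    by (simp only: Phi_deriv_eq(2,3)[OF S'(4,5) t] Phi_deriv_weier42[OF S'(4,5) U P hf hol(1,2)]
        du_eq_Re_Phi[of x t] dv_eq_Im_Phi[of x t] P[OF U(3)])
  also have "(cmod (1 / r t)) ^ 4 = 1 / ((cmod (deriv g1 t))\<^sup>2 * (cmod (deriv g2 t))\<^sup>2)"
    unfolding r2[symmetric] by (simp add: norm_divide power_divide flip: power_mult)
  finally show "16 * det (vector [du x t, dv x t, du (du x) t, dv (du x) t] :: real ^ 4 ^ 4) = X - Y"
    using a by (simp add: X_def Y_def field_simps)
qed

text \<open>X and -Y have prescribed sum and product, and only one of these two roots is
  positive.\<close>

lemma eq_of_prod_eq_diff_eq:
  fixes X Y X' Y' :: real
  assumes "X > 0" "Y > 0" "X' > 0" "Y' > 0" and p: "X * Y = X' * Y'" and d: "X - Y = X' - Y'"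
  shows "X = X'" "Y = Y'"
proof -
  have "X = X' + (Y - Y')" using d by simp
  with p have "(Y - Y') * (X' + Y) = 0" by (simp add: algebra_simps)
  moreover have "X' + Y > 0" using assms by simp
  ultimately show "Y = Y'" by simp
  with d show "X = X'" by simp
qed

lemma germ_motion_equiv42_imp_same_metric:
  assumes S: "S \<in> surfaces42" "S' \<in> surfaces42" and m: "germ_motion_equiv sign42 S S'"
    and r: "represented42 S g1 g2" "represented42 S' h1 h2"
  obtains U where "open U" "0 \<in> U" "\<And>z. z \<in> U \<Longrightarrow> same_metric g1 h1 z" "\<And>z. z \<in> U \<Longrightarrow> same_metric g2 h2 z"
proof -
  obtain D x D' y where xy: "S = (D, x)" "S' = (D', y)" by fastforce
  note Sx = S(1)[unfolded xy] and Sy = S(2)[unfolded xy]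
  obtain V r where V: "open V" "0 \<in> V" "V \<subseteq> D" "g1 holomorphic_on V" "g2 holomorphic_on V"
      "r holomorphic_on V"
    and Vz: "\<And>z. z \<in> V \<Longrightarrow> deriv g1 z * deriv g2 z \<noteq> 0"
      "\<And>z. z \<in> V \<Longrightarrow> ((cmod (g1 z))\<^sup>2 - 1) * ((cmod (g2 z))\<^sup>2 - 1) > 0"
      "\<And>z. z \<in> V \<Longrightarrow> (r z)\<^sup>2 = deriv g1 z * deriv g2 z"
      "\<And>z. z \<in> V \<Longrightarrow> Phi x z = weier42 (1 / r z) (g1 z) (g2 z)"
    using r(1) unfolding represented42_iff xy by auto
  obtain V' r' where V': "open V'" "0 \<in> V'" "V' \<subseteq> D'" "h1 holomorphic_on V'"
      "h2 holomorphic_on V'" "r' holomorphic_on V'"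
    and Vz': "\<And>z. z \<in> V' \<Longrightarrow> deriv h1 z * deriv h2 z \<noteq> 0"
      "\<And>z. z \<in> V' \<Longrightarrow> ((cmod (h1 z))\<^sup>2 - 1) * ((cmod (h2 z))\<^sup>2 - 1) > 0"
      "\<And>z. z \<in> V' \<Longrightarrow> (r' z)\<^sup>2 = deriv h1 z * deriv h2 z"
      "\<And>z. z \<in> V' \<Longrightarrow> Phi y z = weier42 (1 / r' z) (h1 z) (h2 z)"
    using r(2) unfolding represented42_iff xy by auto
  obtain U A where U: "open U" "0 \<in> U" "U \<subseteq> D \<inter> D'" and A: "A \<in> special_isometries sign42"
    and d: "\<And>z. z \<in> U \<Longrightarrow> du y z = A *v du x z" "\<And>z. z \<in> U \<Longrightarrow> dv y z = A *v dv x z"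
      "\<And>z. z \<in> U \<Longrightarrow> du (du y) z = A *v du (du x) z" "\<And>z. z \<in> U \<Longrightarrow> dv (du y) z = A *v dv (du x) z"
    by (rule germ_motion_equivD[OF m[unfolded xy] surfaces42D(3)[OF Sx]]) (rule that)
  have "same_metric g1 h1 z \<and> same_metric g2 h2 z" if z: "z \<in> U \<inter> V \<inter> V'" for z
  proof -
    have z': "z \<in> U" "z \<in> V" "z \<in> V'" using z by auto
    note i = surface42_invariants[OF Sx V(1,3) z'(2) V(4-6) Vz(1,3,4)]
      and j = surface42_invariants[OF Sy V'(1,3) z'(3) V'(4-6) Vz'(1,3,4)]
    let ?X = "((cmod (g1 z))\<^sup>2 - 1)\<^sup>2 / (cmod (deriv g1 z))\<^sup>2" and ?Y =
        "((cmod (g2 z))\<^sup>2 - 1)\<^sup>2 / (cmod (deriv g2 z))\<^sup>2"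
    let ?X' = "((cmod (h1 z))\<^sup>2 - 1)\<^sup>2 / (cmod (deriv h1 z))\<^sup>2" and ?Y' =
        "((cmod (h2 z))\<^sup>2 - 1)\<^sup>2 / (cmod (deriv h2 z))\<^sup>2"
    have nz: "deriv g1 z \<noteq> 0" "deriv g2 z \<noteq> 0" "deriv h1 z \<noteq> 0" "deriv h2 z \<noteq> 0"
      using Vz(1)[OF z'(2)] Vz'(1)[OF z'(3)] by auto
    have n1: "(cmod (g1 z))\<^sup>2 - 1 \<noteq> 0" "(cmod (g2 z))\<^sup>2 - 1 \<noteq> 0" "(cmod (h1 z))\<^sup>2 - 1 \<noteq> 0"
        "(cmod (h2 z))\<^sup>2 - 1 \<noteq> 0"
      using Vz(2)[OF z'(2)] Vz'(2)[OF z'(3)] by (metis less_irrefl mult_zero_left mult_zero_right)+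
    have pos: "?X > 0" "?Y > 0" "?X' > 0" "?Y' > 0"
      using nz n1 by (simp_all add: zero_less_power2)
    have "pdot sign42 (du y z) (du y z) = pdot sign42 (du x z) (du x z)"
      unfolding d(1)[OF z'(1)] using A by (simp add: special_isometries_def)
    then have p: "?X * ?Y = ?X' * ?Y'" using i(1) j(1) by simp
    have "det (vector [du y z, dv y z, du (du y) z, dv (du y) z] :: real ^ 4 ^ 4) =
        det (vector [du x z, dv x z, du (du x) z, dv (du x) z] :: real ^ 4 ^ 4)"
      unfolding d(1)[OF z'(1)] d(2)[OF z'(1)] d(3)[OF z'(1)] d(4)[OF z'(1)] det_image_4
      using A by (simp add: special_isometries_def)
    then have m: "?X - ?Y = ?X' - ?Y'" using i(2) j(2) by simp
    from eq_of_prod_eq_diff_eq[OF pos p m] show ?thesis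
      using nz by (simp add: same_metric_def frac_eq_eq mult.commute)
  qed
  moreover have "open (U \<inter> V \<inter> V')" "0 \<in> U \<inter> V \<inter> V'" using U V V' by auto
  ultimately show ?thesis using that by blast
qed

text \<open>The Moebius maps for g1 and g2 give the matrix up to a real scalar; that scalar has to
  reconcile the independently chosen root branches of the two representations.\<close>

lemma same_metric_imp_germ_motion_equiv42:
  assumes S: "S \<in> surfaces42" "S' \<in> surfaces42"
    and r: "represented42 S g1 g2" "represented42 S' h1 h2"
    and W: "open W" "0 \<in> W"
    and eq: "\<And>z. z \<in> W \<Longrightarrow> same_metric g1 h1 z" "\<And>z. z \<in> W \<Longrightarrow> same_metric g2 h2 z"
  shows "germ_motion_equiv sign42 S S'"
proof -
  obtain D x D' y where xy: "S = (D, x)" "S' = (D', y)" by fastforce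
  note Sx = S(1)[unfolded xy] and Sy = S(2)[unfolded xy]
  obtain V r where V: "open V" "0 \<in> V" "V \<subseteq> D" "g1 holomorphic_on V" "g2 holomorphic_on V"
      "r holomorphic_on V"
    and Vz: "\<And>z. z \<in> V \<Longrightarrow> deriv g1 z * deriv g2 z \<noteq> 0"
      "\<And>z. z \<in> V \<Longrightarrow> ((cmod (g1 z))\<^sup>2 - 1) * ((cmod (g2 z))\<^sup>2 - 1) > 0"
      "\<And>z. z \<in> V \<Longrightarrow> (r z)\<^sup>2 = deriv g1 z * deriv g2 z"
      "\<And>z. z \<in> V \<Longrightarrow> Phi x z = weier42 (1 / r z) (g1 z) (g2 z)"
    using r(1) unfolding represented42_iff xy by auto
  obtain V' r' where V': "open V'" "0 \<in> V'" "V' \<subseteq> D'" "h1 holomorphic_on V'"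
      "h2 holomorphic_on V'" "r' holomorphic_on V'"
    and Vz': "\<And>z. z \<in> V' \<Longrightarrow> deriv h1 z * deriv h2 z \<noteq> 0"
      "\<And>z. z \<in> V' \<Longrightarrow> ((cmod (h1 z))\<^sup>2 - 1) * ((cmod (h2 z))\<^sup>2 - 1) > 0"
      "\<And>z. z \<in> V' \<Longrightarrow> (r' z)\<^sup>2 = deriv h1 z * deriv h2 z"
      "\<And>z. z \<in> V' \<Longrightarrow> Phi y z = weier42 (1 / r' z) (h1 z) (h2 z)"
    using r(2) unfolding represented42_iff xy by auto
  let ?U = "V \<inter> V' \<inter> W"
  have o: "open ?U" "0 \<in> ?U" using V V' W by auto
  have hol: "g1 holomorphic_on ?U" "h1 holomorphic_on ?U" "g2 holomorphic_on ?U" "h2 holomorphic_on ?U"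
    using V(4,5) V'(4,5) by (auto elim: holomorphic_on_subset)
  have nz: "deriv g1 0 \<noteq> 0" "deriv h1 0 \<noteq> 0" "deriv g2 0 \<noteq> 0" "deriv h2 0 \<noteq> 0"
    using Vz(1)[OF V(2)] Vz'(1)[OF V'(2)] by auto
  have ne: "cmod (g1 0) \<noteq> 1" "cmod (h1 0) \<noteq> 1" "cmod (g2 0) \<noteq> 1" "cmod (h2 0) \<noteq> 1"
    using Vz(2)[OF V(2)] Vz'(2)[OF V'(2)] by auto
  have eq': "(cmod (deriv g1 z))\<^sup>2 * ((cmod (h1 z))\<^sup>2 - 1)\<^sup>2
      = (cmod (deriv h1 z))\<^sup>2 * ((cmod (g1 z))\<^sup>2 - 1)\<^sup>2"
    "(cmod (deriv g2 z))\<^sup>2 * ((cmod (h2 z))\<^sup>2 - 1)\<^sup>2 = (cmod (deriv h2 z))\<^sup>2 * ((cmod (g2 z))\<^sup>2 - 1)\<^sup>2"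
      if "z \<in> ?U" for z
    using eq[of z] that by (simp_all add: same_metric_def)
  obtain p q T where T: "open T" "0 \<in> T" "T \<subseteq> ?U"
    and pq: "(cmod p)\<^sup>2 - (cmod q)\<^sup>2 = ((cmod (g1 0))\<^sup>2 - 1) * ((cmod (h1 0))\<^sup>2 - 1)"
    and pz: "\<And>z. z \<in> T \<Longrightarrow> p + cnj q * g1 z \<noteq> 0"
    and hz: "\<And>z. z \<in> T \<Longrightarrow> h1 z = (q + cnj p * g1 z) / (p + cnj q * g1 z)"
    by (rule moebius_of_equal_metric[OF o hol(1,2) nz(1,2) ne(1,2) eq'(1)], assumption) (rule that)
  obtain p' q' T' where T': "open T'" "0 \<in> T'" "T' \<subseteq> ?U"
    and pq': "(cmod p')\<^sup>2 - (cmod q')\<^sup>2 = ((cmod (g2 0))\<^sup>2 - 1) * ((cmod (h2 0))\<^sup>2 - 1)"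
    and pz': "\<And>z. z \<in> T' \<Longrightarrow> p' + cnj q' * g2 z \<noteq> 0"
    and hz': "\<And>z. z \<in> T' \<Longrightarrow> h2 z = (q' + cnj p' * g2 z) / (p' + cnj q' * g2 z)"
    by (rule moebius_of_equal_metric[OF o hol(3,4) nz(3,4) ne(3,4) eq'(2)], assumption) (rule that)
  define d1 d2 where "d1 = (cmod p)\<^sup>2 - (cmod q)\<^sup>2" and "d2 = (cmod p')\<^sup>2 - (cmod q')\<^sup>2"
  \<comment> \<open>Regrouped by surface instead of by factor, the product consists of two numbers
    that are positive by the side conditions.\<close>
  have "d1 * d2 = (((cmod (g1 0))\<^sup>2 - 1) * ((cmod (g2 0))\<^sup>2 - 1)) * (((cmod (h1 0))\<^sup>2 - 1) * ((cmod
      (h2 0))\<^sup>2 - 1))"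
    unfolding d1_def d2_def pq pq' by (simp only: mult_ac)
  then have d: "d1 * d2 > 0" using Vz(2)[OF V(2)] Vz'(2)[OF V'(2)] by (simp only: mult_pos_pos)
  then have d12: "d1 \<noteq> 0" "d2 \<noteq> 0" by (auto simp: zero_less_mult_iff)
  obtain e where e: "e > 0" "ball 0 e \<subseteq> T \<inter> T'"
    using open_Int[OF T(1) T'(1)] T(2) T'(2) by (meson IntI openE)
  let ?B = "ball (0::complex) e"
  have sub: "?B \<subseteq> T" "?B \<subseteq> T'" "?B \<subseteq> V" "?B \<subseteq> V'" using e(2) T(3) T'(3) by auto
  define Q where "Q z = (p + cnj q * g1 z) * (p' + cnj q' * g2 z)" for z
  \<comment> \<open>The ratio of the branches \<open>r\<close> and \<open>r'\<close> after the Moebius change; it has constant square.\<close>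
  define s where "s z = r z / (r' z * Q z)" for z
  have rnz: "r z \<noteq> 0" if "z \<in> V" for z using Vz(1,3)[OF that] by auto
  have rnz': "r' z \<noteq> 0" if "z \<in> V'" for z using Vz'(1,3)[OF that] by auto
  have Qnz: "Q z \<noteq> 0" if "z \<in> ?B" for z using pz pz' that sub by (auto simp: Q_def)
  \<comment> \<open>The scale with c^2 d1 d2 = 1 required by
    \<open>right_mult_special\<close>.\<close>
  define c where "c = 1 / sqrt (d1 * d2)"
  have c': "c\<^sup>2 = 1 / (d1 * d2)" using d by (simp add: c_def power_divide)
  then have c: "c\<^sup>2 * (d1 * d2) = 1" using d12 by simp
  have s2: "(s z)\<^sup>2 = (of_real c)\<^sup>2" if z: "z \<in> ?B" for z
  proof -
    have zT: "z \<in> T" "z \<in> T'" "z \<in> V" "z \<in> V'" using z sub by auto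
    have b1: "deriv h1 z = of_real d1 * deriv g1 z / (p + cnj q * g1 z)\<^sup>2"
      unfolding d1_def using T(3) by (intro deriv_moebius[OF T(1) holomorphic_on_subset[OF hol(1)]
          zT(1) pz hz]) auto
    have b2: "deriv h2 z = of_real d2 * deriv g2 z / (p' + cnj q' * g2 z)\<^sup>2"
      unfolding d2_def using T'(3) by (intro deriv_moebius[OF T'(1) holomorphic_on_subset[OF
          hol(3)] zT(2) pz' hz']) auto
    have "(r' z)\<^sup>2 * (Q z)\<^sup>2 = of_real (d1 * d2) * (r z)\<^sup>2"
      unfolding Vz(3)[OF zT(3)] Vz'(3)[OF zT(4)] b1 b2 Q_def using pz[OF zT(1)] pz'[OF zT(2)]
      by (simp add: power_mult_distrib)
    then have "(s z)\<^sup>2 = 1 / of_real (d1 * d2)"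
      using rnz[OF zT(3)] d12 by (simp add: s_def power_divide power_mult_distrib)
    also have "\<dots> = of_real (c\<^sup>2)"
      unfolding c' by simp
    finally show ?thesis by simp
  qed
  then have sc: "s z = of_real c \<or> s z = - of_real c" if "z \<in> ?B" for z using that
    by (simp add: power2_eq_iff)
  \<comment> \<open>A continuous function with at most two values on a connected ball is constant,
    so one sign serves the whole ball.\<close>
  have "continuous_on ?B s" unfolding s_def Q_def
    using rnz' Qnz sub V V'
    by (intro continuous_intros holomorphic_on_imp_continuous_on holomorphic_on_subset[OF V(6)]
        holomorphic_on_subset[OF V'(6)]
        holomorphic_on_subset[OF V(4)] holomorphic_on_subset[OF V(5)]) (auto simp: Q_def)
  moreover have "finite (s ` ?B)"
  proof (rule finite_subset)
    show "s ` ?B \<subseteq> {of_real c, - of_real c}" using sc by blast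
  qed simp
  ultimately have "s constant_on ?B"
    using continuous_finite_range_constant[of ?B s] by auto
  then obtain k where k: "\<And>z. z \<in> ?B \<Longrightarrow> s z = k" unfolding constant_on_def by blast
  then have "k = of_real c \<or> k = of_real (- c)" using sc[of 0] e(1) by auto
  \<comment> \<open>Only the square of the scale matters for a proper motion, so either sign can be
    put into the matrix.\<close>
  then obtain a where a: "k = of_real a" "a\<^sup>2 = c\<^sup>2" by auto
  let ?A = "a *\<^sub>R (right_mult p q ** flip4 ** right_mult p' q' ** flip4)"
  have A: "?A \<in> special_isometries sign42"
    by (rule right_mult_special[of p q p' q' "d1 * d2"]) (use a c in \<open>auto simp: d1_def d2_def\<close>)
  have "Phi y z = cmv ?A (Phi x z)" if z: "z \<in> ?B" for z
  proof -
    have zT: "z \<in> T" "z \<in> T'" "z \<in> V" "z \<in> V'" using z sub by auto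
    have "of_real a = r z / (r' z * Q z)" using k[OF z] a(1) by (simp add: s_def)
    then have "1 / r' z = of_real a * (1 / r z * Q z)"
      using rnz[OF zT(3)] rnz'[OF zT(4)] Qnz[OF z] by simp
    also have "1 / r z * Q z = 1 / r z * (p' + cnj q' * g2 z) * (p + cnj q * g1 z)"
      by (simp add: Q_def)
    finally have rr: "1 / r' z = of_real a * (1 / r z * (p' + cnj q' * g2 z) * (p + cnj q * g1 z))" .
    show ?thesis
      unfolding Vz(4)[OF zT(3)] Vz'(4)[OF zT(4)] cmv_scaleR cmv_matrix_mul cmv_flip4
          cmv_right_mult[OF pz[OF zT(1)]]
        cmv_right_mult[OF pz'[OF zT(2)]] scale_weier42 rr hz[OF zT(1), symmetric] hz'[OF zT(2),
            symmetric] ..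
  qed
  then show ?thesis unfolding xy
    using e(1) sub V(3) V'(3)
    by (intro germ_motion_equivI[OF surfaces42D(3)[OF Sx] surfaces42D(3)[OF Sy] open_ball _ _ A]) auto
qed

section \<open>Comparison of the equivalence relations and the bijection\<close>

lemma rel31_iff_same_metric:
  assumes S: "S \<in> surfaces31" "S' \<in> surfaces31" and r: "represented31 S g" "represented31 S' h"
    and W: "open W" "0 \<in> W" "g holomorphic_on W" "h holomorphic_on W"
  shows "(S, S') \<in> rel31 \<longleftrightarrow> (\<exists>U. open U \<and> 0 \<in> U \<and> (\<forall>z\<in>U. same_metric g h z))"
proof
  assume "(S, S') \<in> rel31"
  then have "germ_motion_equiv sign31 S S'" by (simp add: rel31_def)
  from germ_motion_equiv31_imp_same_metric[OF S this r W]
  show "\<exists>U. open U \<and> 0 \<in> U \<and> (\<forall>z\<in>U. same_metric g h z)" by metis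
next
  assume "\<exists>U. open U \<and> 0 \<in> U \<and> (\<forall>z\<in>U. same_metric g h z)"
  then obtain U where U: "open U" "0 \<in> U" "\<And>z. z \<in> U \<Longrightarrow> same_metric g h z" by blast
  have "germ_motion_equiv sign31 S S'"
    by (rule same_metric_imp_germ_motion_equiv31[OF S r, of "U \<inter> W"])
       (use U W in \<open>auto elim: holomorphic_on_subset\<close>)
  with S show "(S, S') \<in> rel31" by (simp add: rel31_def)
qed

lemma rel42_iff_same_metric:
  assumes S: "S \<in> surfaces42" "S' \<in> surfaces42"
    and r: "represented42 S g1 g2" "represented42 S' h1 h2"
  shows "(S, S') \<in> rel42 \<longleftrightarrow> (\<exists>U. open U \<and> 0 \<in> U \<and> (\<forall>z\<in>U. same_metric g1 h1 z)) \<and>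
                             (\<exists>U. open U \<and> 0 \<in> U \<and> (\<forall>z\<in>U. same_metric g2 h2 z))"
proof
  assume "(S, S') \<in> rel42"
  then have "germ_motion_equiv sign42 S S'" by (simp add: rel42_def)
  from germ_motion_equiv42_imp_same_metric[OF S this r]
  show "(\<exists>U. open U \<and> 0 \<in> U \<and> (\<forall>z\<in>U. same_metric g1 h1 z)) \<and>
        (\<exists>U. open U \<and> 0 \<in> U \<and> (\<forall>z\<in>U. same_metric g2 h2 z))" by metis
next
  assume "(\<exists>U. open U \<and> 0 \<in> U \<and> (\<forall>z\<in>U. same_metric g1 h1 z)) \<and>
          (\<exists>U. open U \<and> 0 \<in> U \<and> (\<forall>z\<in>U. same_metric g2 h2 z))"
  then obtain U V where U: "open U" "0 \<in> U" "\<And>z. z \<in> U \<Longrightarrow> same_metric g1 h1 z"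
    and V: "open V" "0 \<in> V" "\<And>z. z \<in> V \<Longrightarrow> same_metric g2 h2 z" by blast
  have "germ_motion_equiv sign42 S S'"
    by (rule same_metric_imp_germ_motion_equiv42[OF S r, of "U \<inter> V"]) (use U V in auto)
  with S show "(S, S') \<in> rel42" by (simp add: rel42_def)
qed

lemma represented42_holomorphic:
  assumes "represented42 S g1 g2"
  obtains U where "open U" "0 \<in> U" "g1 holomorphic_on U" "g2 holomorphic_on U"
    "\<And>z. z \<in> U \<Longrightarrow> deriv g1 z \<noteq> 0" "\<And>z. z \<in> U \<Longrightarrow> deriv g2 z \<noteq> 0"
    "\<And>z. z \<in> U \<Longrightarrow> cmod (g1 z) \<noteq> 1" "\<And>z. z \<in> U \<Longrightarrow> cmod (g2 z) \<noteq> 1"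
proof -
  obtain U where U: "open U" "0 \<in> U" "g1 holomorphic_on U" "g2 holomorphic_on U"
    and nz: "\<And>z. z \<in> U \<Longrightarrow> deriv g1 z * deriv g2 z \<noteq> 0"
    and pos: "\<And>z. z \<in> U \<Longrightarrow> ((cmod (g1 z))\<^sup>2 - 1) * ((cmod (g2 z))\<^sup>2 - 1) > 0"
    using assms unfolding represented42_iff by blast
  have "cmod (g1 z) \<noteq> 1" "cmod (g2 z) \<noteq> 1" if "z \<in> U" for z using pos[OF that] by auto
  then show ?thesis using that[of U] U nz by auto
qed

lemma represented42_imp_represented31:
  assumes "represented42 S g1 g2"
  obtains S1 S2 where "S1 \<in> surfaces31" "S2 \<in> surfaces31" "represented31 S1 g1" "represented31 S2 g2"
proof -
  obtain U where U: "open U" "0 \<in> U" "g1 holomorphic_on U" "g2 holomorphic_on U"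
    "\<And>z. z \<in> U \<Longrightarrow> deriv g1 z \<noteq> 0" "\<And>z. z \<in> U \<Longrightarrow> deriv g2 z \<noteq> 0"
    "\<And>z. z \<in> U \<Longrightarrow> cmod (g1 z) \<noteq> 1" "\<And>z. z \<in> U \<Longrightarrow> cmod (g2 z) \<noteq> 1"
    using represented42_holomorphic[OF assms] by metis
  obtain S1 where "S1 \<in> surfaces31" "represented31 S1 g1"
    by (rule exists_surface31[OF U(1,2,3) U(5) U(7)])
  moreover obtain S2 where "S2 \<in> surfaces31" "represented31 S2 g2"
    by (rule exists_surface31[OF U(1,2,4) U(6) U(8)])
  ultimately show ?thesis using that by blast
qed

text \<open>Both sides reduce to \<open>same_metric\<close> for each index. Holomorphy, which
  \<open>represented31\<close> does not assert, is inherited from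
  \<open>represented42\<close>.\<close>

lemma rel42_iff_rel31:
  assumes S: "S \<in> surfaces42" "T \<in> surfaces42" "represented42 S g1 g2" "represented42 T h1 h2"
    and S12: "S1 \<in> surfaces31" "S2 \<in> surfaces31" "represented31 S1 g1" "represented31 S2 g2"
    and T12: "T1 \<in> surfaces31" "T2 \<in> surfaces31" "represented31 T1 h1" "represented31 T2 h2"
  shows "(S, T) \<in> rel42 \<longleftrightarrow> (S1, T1) \<in> rel31 \<and> (S2, T2) \<in> rel31"
proof -
  obtain U where U: "open U" "0 \<in> U" "g1 holomorphic_on U" "g2 holomorphic_on U"
    using represented42_holomorphic[OF S(3)] by metis
  obtain V where V: "open V" "0 \<in> V" "h1 holomorphic_on V" "h2 holomorphic_on V"
    using represented42_holomorphic[OF S(4)] by metis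
  have W: "open (U \<inter> V)" "0 \<in> U \<inter> V" using U V by auto
  have hol: "g1 holomorphic_on U \<inter> V" "g2 holomorphic_on U \<inter> V" "h1 holomorphic_on U \<inter> V"
      "h2 holomorphic_on U \<inter> V"
    using U V by (auto elim: holomorphic_on_subset)
  show ?thesis
    unfolding rel42_iff_same_metric[OF S]
      rel31_iff_same_metric[OF S12(1) T12(1) S12(3) T12(3) W hol(1,3)]
      rel31_iff_same_metric[OF S12(2) T12(2) S12(4) T12(4) W hol(2,4)] ..
qed

theorem mainTheorem5:
  shows "(\<forall>c \<in> MS42. \<exists>S \<in> c. \<exists>g1 g2. represented42 S g1 g2) \<and>
    (\<forall>S \<in> surfaces42. \<forall>g1 g2. represented42 S g1 g2 \<longrightarrow>
       (\<exists>S1 \<in> surfaces31. represented31 S1 g1) \<and> (\<exists>S2 \<in> surfaces31. represented31 S2 g2)) \<and>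
    (\<exists>F :: 4 surface set \<Rightarrow> 3 surface set \<times> 3 surface set.
       (\<forall>c \<in> MS42. \<forall>S \<in> c. \<forall>g1 g2. represented42 S g1 g2 \<longrightarrow>
          (\<forall>S1 \<in> surfaces31. \<forall>S2 \<in> surfaces31.
             represented31 S1 g1 \<longrightarrow> represented31 S2 g2 \<longrightarrow>
             F c = (rel31 `` {S1}, rel31 `` {S2}))) \<and>
       bij_betw F MS42 (MS31 \<times> MS31))"
proof -
  have cls: "S \<in> surfaces42 \<and> c = rel42 `` {S}" if c: "c \<in> MS42" "S \<in> c" for c S
  proof -
    obtain T where T: "T \<in> surfaces42" "c = rel42 `` {T}"
      using c(1) unfolding MS42_def quotient_def by blast
    then have "(T, S) \<in> rel42" using c(2) by simp
    then show ?thesis using T equiv_class_eq[OF equiv_rel42] by (auto simp: rel42_def)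
  qed
  have part1: "\<exists>S \<in> c. \<exists>g1 g2. represented42 S g1 g2" if c: "c \<in> MS42" for c
  proof -
    obtain D x where S: "(D, x) \<in> surfaces42" "c = rel42 `` {(D, x)}"
      using c by (auto simp: MS42_def elim: quotientE)
    obtain S' g1 g2 where S': "S' \<in> surfaces42" "germ_motion_equiv sign42 (D, x) S'"
        "represented42 S' g1 g2"
      using represented42_up_to_motion[OF S(1)] by metis
    then have "((D, x), S') \<in> rel42" using S by (simp add: rel42_def)
    then show ?thesis using S(2) S'(3) by blast
  qed
  \<comment> \<open>The assignment as a relation, before independence of the choices is
    known.\<close>
  define R where "R c y \<longleftrightarrow> (\<exists>S\<in>c. \<exists>g1 g2. represented42 S g1 g2 \<and>
      (\<exists>S1\<in>surfaces31. \<exists>S2\<in>surfaces31. represented31 S1 g1 \<and> represented31 S2 g2 \<and>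
        y = (rel31 `` {S1}, rel31 `` {S2})))" for c y
  have R_ex: "\<exists>y. R c y" if c: "c \<in> MS42" for c
  proof -
    obtain S g1 g2 where S: "S \<in> c" "represented42 S g1 g2" using part1[OF c] by blast
    with represented42_imp_represented31[OF S(2)] show ?thesis unfolding R_def by metis
  qed
  \<comment> \<open>Read from left to right this makes \<open>R\<close> single-valued, from right to
    left injective.\<close>
  have cmp: "c = c' \<longleftrightarrow> y = y'" if c: "c \<in> MS42" "c' \<in> MS42" and R: "R c y" "R c' y'" for c c' y y'
  proof -
    obtain S g1 g2 S1 S2 where S: "S \<in> c" "represented42 S g1 g2" "S1 \<in> surfaces31" "S2 \<in> surfaces31"
      "represented31 S1 g1" "represented31 S2 g2" "y = (rel31 `` {S1}, rel31 `` {S2})"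
      using R(1) unfolding R_def by blast
    obtain T h1 h2 T1 T2 where T: "T \<in> c'" "represented42 T h1 h2" "T1 \<in> surfaces31" "T2 \<in> surfaces31"
      "represented31 T1 h1" "represented31 T2 h2" "y' = (rel31 `` {T1}, rel31 `` {T2})"
      using R(2) unfolding R_def by blast
    note cS = cls[OF c(1) S(1)] and cT = cls[OF c(2) T(1)]
    have "c = c' \<longleftrightarrow> (S, T) \<in> rel42"
      using cS cT eq_equiv_class_iff[OF equiv_rel42] by blast
    also have "\<dots> \<longleftrightarrow> (S1, T1) \<in> rel31 \<and> (S2, T2) \<in> rel31"
      by (rule rel42_iff_rel31) (use cS cT S T in auto)
    also have "\<dots> \<longleftrightarrow> y = y'"
      using S T eq_equiv_class_iff[OF equiv_rel31] by simp
    finally show ?thesis .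
  qed
  define F where "F c = (SOME y. R c y)" for c
  have F: "R c (F c)" if "c \<in> MS42" for c unfolding F_def using R_ex[OF that] by (rule someI_ex)
  have F_eq: "F c = y" if "c \<in> MS42" "R c y" for c y using cmp[OF that(1,1) F[OF that(1)] that(2)]
    by simp
  have "bij_betw F MS42 (MS31 \<times> MS31)"
    unfolding bij_betw_def
  proof (intro conjI equalityI subsetI)
    show "inj_on F MS42"
    proof (rule inj_onI)
      fix c c' assume "c \<in> MS42" "c' \<in> MS42" "F c = F c'"
      with cmp[OF this(1,2) F[OF this(1)] F[OF this(2)]] show "c = c'" by (simp only:)
    qed
  next
    fix y assume "y \<in> F ` MS42"
    then obtain c where "c \<in> MS42" "y = F c" by blast
    then show "y \<in> MS31 \<times> MS31" using F[of c] by (auto simp: R_def MS31_def intro: quotientI)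
  next
    fix y assume "y \<in> MS31 \<times> MS31"
    then obtain D1 x1 D2 x2 where y: "y = (rel31 `` {(D1, x1)}, rel31 `` {(D2, x2)})"
      "(D1, x1) \<in> surfaces31" "(D2, x2) \<in> surfaces31"
      by (auto simp: MS31_def elim!: quotientE)
    obtain S1 U1 g1 where 1: "S1 \<in> surfaces31" "germ_motion_equiv sign31 (D1, x1) S1"
      "open U1" "0 \<in> U1" "g1 holomorphic_on U1" "\<And>z. z \<in> U1 \<Longrightarrow> deriv g1 z \<noteq> 0"
      "\<And>z. z \<in> U1 \<Longrightarrow> cmod (g1 z) < 1" "represented31 S1 g1"
      by (rule represented31_up_to_motion[OF y(2)]) (rule that)
    obtain S2 U2 g2 where 2: "S2 \<in> surfaces31" "germ_motion_equiv sign31 (D2, x2) S2"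
      "open U2" "0 \<in> U2" "g2 holomorphic_on U2" "\<And>z. z \<in> U2 \<Longrightarrow> deriv g2 z \<noteq> 0"
      "\<And>z. z \<in> U2 \<Longrightarrow> cmod (g2 z) < 1" "represented31 S2 g2"
      by (rule represented31_up_to_motion[OF y(3)]) (rule that)
    \<comment> \<open>With both Gauss maps inside the disc the two factors of the side condition are
      negative, so the pair is admissible in R^4_2.\<close>
    have lt: "(cmod w)\<^sup>2 - 1 < 0" if "cmod w < 1" for w using that by (simp add: abs_square_less_1)
    obtain S where S: "S \<in> surfaces42" "represented42 S g1 g2"
      by (rule exists_surface42[of "U1 \<inter> U2" g1 g2])
         (use 1 2 lt in \<open>auto elim: holomorphic_on_subset intro: mult_neg_neg\<close>)
    have c: "rel42 `` {S} \<in> MS42" "S \<in> rel42 `` {S}"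
      using S equiv_class_self[OF equiv_rel42] by (auto simp: MS42_def intro: quotientI)
    have "((D1, x1), S1) \<in> rel31" "((D2, x2), S2) \<in> rel31"
      using 1(1,2) 2(1,2) y(2,3) by (simp_all add: rel31_def)
    then have "rel31 `` {(D1, x1)} = rel31 `` {S1}" "rel31 `` {(D2, x2)} = rel31 `` {S2}"
      by (simp_all add: equiv_class_eq[OF equiv_rel31])
    then have "y = (rel31 `` {S1}, rel31 `` {S2})" using y by simp
    then have "R (rel42 `` {S}) y" unfolding R_def using c(2) S 1 2 by blast
    then have "F (rel42 `` {S}) = y" by (rule F_eq[OF c(1)])
    then show "y \<in> F ` MS42" using c(1) by blast
  qed
  moreover have "F c = (rel31 `` {S1}, rel31 `` {S2})"
    if "c \<in> MS42" "S \<in> c" "represented42 S g1 g2" "S1 \<in> surfaces31" "S2 \<in> surfaces31"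
      "represented31 S1 g1" "represented31 S2 g2" for c S g1 g2 S1 S2
    by (rule F_eq[OF that(1)]) (unfold R_def, use that in blast)
  moreover have "(\<exists>S1 \<in> surfaces31. represented31 S1 g1) \<and> (\<exists>S2 \<in> surfaces31. represented31 S2 g2)"
    if "represented42 S g1 g2" for S g1 g2
    using represented42_imp_represented31[OF that] by metis
  ultimately show ?thesis using part1 by (intro conjI exI[of _ F]) blast+
qed

end
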